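(* Let $\mathcal{C}$ be an abelian tensor category. Then the assignment $([U],[V])\mapsto[U\otimes V]$ for $U,V\in\mathcal{C}^r$ gives a well-defined (biadditive) map $\mathrm{K}_0^r(\mathcal{C})\times\mathrm{K}_0^r(\mathcal{C})\to\mathrm{K}_0^r(\mathcal{C})$, and this map is an associative product on $\mathrm{K}_0^r(\mathcal{C})$ with unit element $[\mathbf{1}]$. If, moreover, $\mathcal{C}$ satisfies Condition C (defined in the context), then $\mathrm{K}_0^b(\mathcal{C})\subset\mathrm{K}_0^r(\mathcal{C})$ and the product on $\mathrm{K}_0^r(\mathcal{C})$ restricts to a product on $\mathrm{K}_0^b(\mathcal{C})$.
   Context: A tensor category is a (not necessarily strict) monoidal category $(\mathcal{C},\otimes,\mathbf{1},\alpha,\lambda,\rho)$ with $\alpha_{U,V,W}:U\otimes(V\otimes W)\to(U\otimes V)\otimes W$, $\lambda_U:\mathbf{1}\otimes U\to U$, $\rho_U:U\otimes\mathbf{1}\to U$. An abelian tensor category is a tensor category whose underlying category is abelian; its tensor product functor is not assumed to be exact. "Injective" means monomorphism. The Grothendieck group $\mathrm{K}_0(\mathcal{C})$ is the free abelian group generated by isomorphism classes of objects in $\mathcal{C}$, divided by the subgroup generated by the elements $[U]+[W]-[V]$ for each exact sequence $0\to U\to V\to W\to0$ in $\mathcal{C}$. Right dual of $U$: an object $U^\vee$ with morphisms $b_U:\mathbf{1}\to U\otimes U^\vee$, $d_U:U^\vee\otimes U\to\mathbf{1}$ such that $\rho_U\circ(\mathrm{id}_U\otimes d_U)\circ\alpha^{-1}_{U,U^\vee,U}\circ(b_U\otimes\mathrm{id}_U)\circ\lambda_U^{-1}=\mathrm{id}_U$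 and $\lambda_{U^\vee}\circ(d_U\otimes\mathrm{id}_{U^\vee})\circ\alpha_{U^\vee,U,U^\vee}\circ(\mathrm{id}_{U^\vee}\otimes b_U)\circ\rho^{-1}_{U^\vee}=\mathrm{id}_{U^\vee}$. Left dual of $U$: an object ${}^\vee U$ with morphisms $\tilde b_U:\mathbf{1}\to{}^\vee U\otimes U$, $\tilde d_U:U\otimes{}^\vee U\to\mathbf{1}$ satisfying the analogous two zig-zag identities. $\mathcal{C}^r$ is the full subcategory of $\mathcal{C}$ consisting of all objects that have both a right and a left dual. $\mathrm{K}_0^r(\mathcal{C})$ is the subgroup of $\mathrm{K}_0(\mathcal{C})$ generated by $[U]$ for all $U\in\mathcal{C}^r$. Condition C: $\mathcal{C}$ is equipped with a contravariant involutive functor $(-)^*:\mathcal{C}\to\mathcal{C}$, i.e. there is a natural isomorphism $\delta_U:U\to U^{**}$, and with isomorphisms $\pi_{U,V}:\mathrm{Hom}(U,V^* )\to\mathrm{Hom}(U\otimes V,\mathbf{1}^* )$ natural in $U$ and $V$. In that case $\mathcal{C}^b$ is the subcategory of $\mathcal{C}$ consisting of all objects $U$ for which $U^*$ is both a right dual and a left dual of $U$ (for some choice of duality morphisms), and for which both $b_U:\mathbf{1}\to U\otimes U^*$ and $\tilde b_U:\mathbf{1}\to U^*\otimes U$ are injective. $\mathrm{K}_0^b(\mathcal{C})$ is the subgroup of $\mathrm{K}_0(\mathcal{C})$ generated by $[U]$ for all $U\in\mathcal{C}^b$. *)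

theory Defs
  imports "HOL-Algebra.Elementary_Groups" "HOL-Algebra.Free_Abelian_Groups"
begin

section \<open>Categories\<close>

record ('o, 'm) cat =
  Ob :: "'o set"
  Ar :: "'m set"
  Dom :: "'m \<Rightarrow> 'o"
  Cod :: "'m \<Rightarrow> 'o"
  Id :: "'o \<Rightarrow> 'm"
  Comp :: "'m \<Rightarrow> 'm \<Rightarrow> 'm"  (infixr "\<bullet>\<index>" 60)

definition Hom :: "('o, 'm, 'x) cat_scheme \<Rightarrow> 'o \<Rightarrow> 'o \<Rightarrow> 'm set" where
  "Hom C U V = {f \<in> Ar C. Dom C f = U \<and> Cod C f = V}"

locale category =
  fixes C :: "('o, 'm, 'x) cat_scheme" (structure)
  assumes Dom_closed: "f \<in> Ar C \<Longrightarrow> Dom C f \<in> Ob C"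
    and Cod_closed: "f \<in> Ar C \<Longrightarrow> Cod C f \<in> Ob C"
    and Id_Hom: "U \<in> Ob C \<Longrightarrow> Id C U \<in> Hom C U U"
    and Comp_Hom: "\<lbrakk>f \<in> Hom C U V; g \<in> Hom C V W\<rbrakk> \<Longrightarrow> g \<bullet> f \<in> Hom C U W"
    and Id_left: "f \<in> Hom C U V \<Longrightarrow> Id C V \<bullet> f = f"
    and Id_right: "f \<in> Hom C U V \<Longrightarrow> f \<bullet> Id C U = f"
    and Comp_assoc: "\<lbrakk>f \<in> Hom C U V; g \<in> Hom C V W; h \<in> Hom C W X\<rbrakk>
      \<Longrightarrow> (h \<bullet> g) \<bullet> f = h \<bullet> (g \<bullet> f)"

context
  fixes C :: "('o, 'm, 'x) cat_scheme" (structure)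
begin

definition monic :: "'m \<Rightarrow> bool" where
  "monic f \<longleftrightarrow> f \<in> Ar C \<and>
    (\<forall>X. \<forall>g\<in>Hom C X (Dom C f). \<forall>h\<in>Hom C X (Dom C f). f \<bullet> g = f \<bullet> h \<longrightarrow> g = h)"

definition epic :: "'m \<Rightarrow> bool" where
  "epic f \<longleftrightarrow> f \<in> Ar C \<and>
    (\<forall>X. \<forall>g\<in>Hom C (Cod C f) X. \<forall>h\<in>Hom C (Cod C f) X. g \<bullet> f = h \<bullet> f \<longrightarrow> g = h)"

definition inverse_arrows :: "'m \<Rightarrow> 'm \<Rightarrow> bool" where
  "inverse_arrows f g \<longleftrightarrow> f \<in> Ar C \<and> g \<in> Hom C (Cod C f) (Dom C f) \<and>
    g \<bullet> f = Id C (Dom C f) \<and> f \<bullet> g = Id C (Cod C f)"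

definition iso_arrow :: "'m \<Rightarrow> bool" where
  "iso_arrow f \<longleftrightarrow> (\<exists>g. inverse_arrows f g)"

definition inv_arrow :: "'m \<Rightarrow> 'm" where
  "inv_arrow f = (THE g. inverse_arrows f g)"

definition isomorphic :: "'o \<Rightarrow> 'o \<Rightarrow> bool" where
  "isomorphic U V \<longleftrightarrow> (\<exists>f\<in>Hom C U V. iso_arrow f)"

definition iso_class :: "'o \<Rightarrow> 'o set" where
  "iso_class U = {V \<in> Ob C. isomorphic U V}"

section \<open>Zero morphisms, kernels, cokernels and exact sequences\<close>

definition zero_object :: "'o \<Rightarrow> bool" where
  "zero_object Z \<longleftrightarrow> Z \<in> Ob C \<and>
    (\<forall>X\<in>Ob C. (\<exists>!f. f \<in> Hom C X Z) \<and> (\<exists>!f. f \<in> Hom C Z X))"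

definition zero_arrow :: "'m \<Rightarrow> bool" where
  "zero_arrow f \<longleftrightarrow> (\<exists>Z g h. zero_object Z \<and> g \<in> Hom C (Dom C f) Z \<and>
    h \<in> Hom C Z (Cod C f) \<and> f = h \<bullet> g)"

definition is_kernel :: "'m \<Rightarrow> 'm \<Rightarrow> bool" where
  "is_kernel k f \<longleftrightarrow> f \<in> Ar C \<and> k \<in> Ar C \<and> Cod C k = Dom C f \<and> zero_arrow (f \<bullet> k) \<and>
    (\<forall>X. \<forall>h\<in>Hom C X (Dom C f). zero_arrow (f \<bullet> h) \<longrightarrow>
      (\<exists>!u. u \<in> Hom C X (Dom C k) \<and> k \<bullet> u = h))"

definition is_cokernel :: "'m \<Rightarrow> 'm \<Rightarrow> bool" where
  "is_cokernel c f \<longleftrightarrow> f \<in> Ar C \<and> c \<in> Ar C \<and> Dom C c = Cod C f \<and> zero_arrow (c \<bullet> f) \<and>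
    (\<forall>X. \<forall>h\<in>Hom C (Cod C f) X. zero_arrow (h \<bullet> f) \<longrightarrow>
      (\<exists>!u. u \<in> Hom C (Cod C c) X \<and> u \<bullet> c = h))"

definition is_image :: "'m \<Rightarrow> 'm \<Rightarrow> bool" where
  "is_image m f \<longleftrightarrow> (\<exists>c. is_cokernel c f \<and> is_kernel m c)"

definition exact_pair :: "'m \<Rightarrow> 'm \<Rightarrow> bool" where
  "exact_pair f g \<longleftrightarrow> (\<exists>m. is_image m f \<and> is_kernel m g)"

text \<open>Exactness of the sequence 0 -> U -> V -> W -> 0 with middle maps f and g.\<close>
definition short_exact :: "'o \<Rightarrow> 'm \<Rightarrow> 'o \<Rightarrow> 'm \<Rightarrow> 'o \<Rightarrow> bool" where
  "short_exact U f V g W \<longleftrightarrow> f \<in> Hom C U V \<and> g \<in> Hom C V W \<and>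
    monic f \<and> exact_pair f g \<and> epic g"

definition is_product :: "'o \<Rightarrow> 'm \<Rightarrow> 'm \<Rightarrow> 'o \<Rightarrow> 'o \<Rightarrow> bool" where
  "is_product P p q U V \<longleftrightarrow> p \<in> Hom C P U \<and> q \<in> Hom C P V \<and>
    (\<forall>X. \<forall>f\<in>Hom C X U. \<forall>g\<in>Hom C X V. \<exists>!u. u \<in> Hom C X P \<and> p \<bullet> u = f \<and> q \<bullet> u = g)"

text \<open>An enrichment in abelian groups: \<open>pl\<close> is the addition of parallel arrows and
  \<open>ze U V\<close> the neutral element of the group of arrows from U to V.\<close>
definition preadditive :: "('m \<Rightarrow> 'm \<Rightarrow> 'm) \<Rightarrow> ('o \<Rightarrow> 'o \<Rightarrow> 'm) \<Rightarrow> bool" where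
  "preadditive pl ze \<longleftrightarrow>
    (\<forall>U\<in>Ob C. \<forall>V\<in>Ob C. comm_group \<lparr>carrier = Hom C U V, monoid.mult = pl, one = ze U V\<rparr>) \<and>
    (\<forall>U V W. \<forall>f\<in>Hom C U V. \<forall>f'\<in>Hom C U V. \<forall>g\<in>Hom C V W. \<forall>g'\<in>Hom C V W.
      g \<bullet> pl f f' = pl (g \<bullet> f) (g \<bullet> f') \<and> pl g g' \<bullet> f = pl (g \<bullet> f) (g' \<bullet> f))"

end

locale abelian_category = category C for C :: "('o, 'm, 'x) cat_scheme" (structure) +
  assumes ex_preadditive: "\<exists>pl ze. preadditive C pl ze"
    and ex_zero_object: "\<exists>Z. zero_object C Z"
    and ex_product: "\<lbrakk>U \<in> Ob C; V \<in> Ob C\<rbrakk> \<Longrightarrow> \<exists>P p q. is_product C P p q U V"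
    and ex_kernel: "f \<in> Ar C \<Longrightarrow> \<exists>k. is_kernel C k f"
    and ex_cokernel: "f \<in> Ar C \<Longrightarrow> \<exists>c. is_cokernel C c f"
    and monic_normal: "monic C f \<Longrightarrow> \<exists>g. is_kernel C f g"
    and epic_normal: "epic C f \<Longrightarrow> \<exists>g. is_cokernel C f g"

section \<open>Tensor categories\<close>

record ('o, 'm) tensor_cat = "('o, 'm) cat" +
  TOb :: "'o \<Rightarrow> 'o \<Rightarrow> 'o"  (infixr "\<otimes>\<^sub>o\<index>" 70)
  TAr :: "'m \<Rightarrow> 'm \<Rightarrow> 'm"  (infixr "\<otimes>\<^sub>a\<index>" 70)
  TUnit :: "'o"  ("\<one>\<^sub>o\<index>")
  assoc :: "'o \<Rightarrow> 'o \<Rightarrow> 'o \<Rightarrow> 'm"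
  lunit :: "'o \<Rightarrow> 'm"
  runit :: "'o \<Rightarrow> 'm"

locale tensor_category = category C for C :: "('o, 'm, 'x) tensor_cat_scheme" (structure) +
  assumes TOb_closed: "\<lbrakk>U \<in> Ob C; V \<in> Ob C\<rbrakk> \<Longrightarrow> U \<otimes>\<^sub>o V \<in> Ob C"
    and TUnit_closed: "\<one>\<^sub>o \<in> Ob C"
    and TAr_Hom: "\<lbrakk>f \<in> Hom C U U'; g \<in> Hom C V V'\<rbrakk>
      \<Longrightarrow> f \<otimes>\<^sub>a g \<in> Hom C (U \<otimes>\<^sub>o V) (U' \<otimes>\<^sub>o V')"
    and TAr_Id: "\<lbrakk>U \<in> Ob C; V \<in> Ob C\<rbrakk> \<Longrightarrow> Id C U \<otimes>\<^sub>a Id C V = Id C (U \<otimes>\<^sub>o V)"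
    and TAr_Comp: "\<lbrakk>f \<in> Hom C U U'; f' \<in> Hom C U' U''; g \<in> Hom C V V'; g' \<in> Hom C V' V''\<rbrakk>
      \<Longrightarrow> (f' \<bullet> f) \<otimes>\<^sub>a (g' \<bullet> g) = (f' \<otimes>\<^sub>a g') \<bullet> (f \<otimes>\<^sub>a g)"
    and assoc_Hom: "\<lbrakk>U \<in> Ob C; V \<in> Ob C; W \<in> Ob C\<rbrakk>
      \<Longrightarrow> assoc C U V W \<in> Hom C (U \<otimes>\<^sub>o (V \<otimes>\<^sub>o W)) ((U \<otimes>\<^sub>o V) \<otimes>\<^sub>o W)"
    and assoc_iso: "\<lbrakk>U \<in> Ob C; V \<in> Ob C; W \<in> Ob C\<rbrakk> \<Longrightarrow> iso_arrow C (assoc C U V W)"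
    and assoc_natural: "\<lbrakk>f \<in> Hom C U U'; g \<in> Hom C V V'; h \<in> Hom C W W'\<rbrakk>
      \<Longrightarrow> assoc C U' V' W' \<bullet> (f \<otimes>\<^sub>a (g \<otimes>\<^sub>a h)) = ((f \<otimes>\<^sub>a g) \<otimes>\<^sub>a h) \<bullet> assoc C U V W"
    and lunit_Hom: "U \<in> Ob C \<Longrightarrow> lunit C U \<in> Hom C (\<one>\<^sub>o \<otimes>\<^sub>o U) U"
    and lunit_iso: "U \<in> Ob C \<Longrightarrow> iso_arrow C (lunit C U)"
    and lunit_natural: "f \<in> Hom C U V \<Longrightarrow> lunit C V \<bullet> (Id C \<one>\<^sub>o \<otimes>\<^sub>a f) = f \<bullet> lunit C U"
    and runit_Hom: "U \<in> Ob C \<Longrightarrow> runit C U \<in> Hom C (U \<otimes>\<^sub>o \<one>\<^sub>o) U"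
    and runit_iso: "U \<in> Ob C \<Longrightarrow> iso_arrow C (runit C U)"
    and runit_natural: "f \<in> Hom C U V \<Longrightarrow> runit C V \<bullet> (f \<otimes>\<^sub>a Id C \<one>\<^sub>o) = f \<bullet> runit C U"
    and pentagon: "\<lbrakk>U \<in> Ob C; V \<in> Ob C; W \<in> Ob C; X \<in> Ob C\<rbrakk>
      \<Longrightarrow> (assoc C U V W \<otimes>\<^sub>a Id C X) \<bullet> assoc C U (V \<otimes>\<^sub>o W) X \<bullet> (Id C U \<otimes>\<^sub>a assoc C V W X)
        = assoc C (U \<otimes>\<^sub>o V) W X \<bullet> assoc C U V (W \<otimes>\<^sub>o X)"
    and triangle: "\<lbrakk>U \<in> Ob C; V \<in> Ob C\<rbrakk>
      \<Longrightarrow> (runit C U \<otimes>\<^sub>a Id C V) \<bullet> assoc C U \<one>\<^sub>o V = Id C U \<otimes>\<^sub>a lunit C V"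

text \<open>The tensor product is not assumed to be exact, nor additive on arrows.\<close>
locale abelian_tensor_category = tensor_category C + abelian_category C
  for C :: "('o, 'm, 'x) tensor_cat_scheme" (structure)

context
  fixes C :: "('o, 'm, 'x) tensor_cat_scheme" (structure)
begin

text \<open>\<open>D\<close> is a right dual of \<open>U\<close> with duality morphisms \<open>b\<close> and \<open>d\<close>.\<close>
definition right_dual :: "'o \<Rightarrow> 'o \<Rightarrow> 'm \<Rightarrow> 'm \<Rightarrow> bool" where
  "right_dual U D b d \<longleftrightarrow> U \<in> Ob C \<and> D \<in> Ob C \<and>
    b \<in> Hom C \<one>\<^sub>o (U \<otimes>\<^sub>o D) \<and> d \<in> Hom C (D \<otimes>\<^sub>o U) \<one>\<^sub>o \<and>
    runit C U \<bullet> (Id C U \<otimes>\<^sub>a d) \<bullet> inv_arrow C (assoc C U D U) \<bullet> (b \<otimes>\<^sub>a Id C U)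
      \<bullet> inv_arrow C (lunit C U) = Id C U \<and>
    lunit C D \<bullet> (d \<otimes>\<^sub>a Id C D) \<bullet> assoc C D U D \<bullet> (Id C D \<otimes>\<^sub>a b)
      \<bullet> inv_arrow C (runit C D) = Id C D"

text \<open>\<open>D\<close> is a left dual of \<open>U\<close> with duality morphisms \<open>b\<close> and \<open>d\<close>.\<close>
definition left_dual :: "'o \<Rightarrow> 'o \<Rightarrow> 'm \<Rightarrow> 'm \<Rightarrow> bool" where
  "left_dual U D b d \<longleftrightarrow> U \<in> Ob C \<and> D \<in> Ob C \<and>
    b \<in> Hom C \<one>\<^sub>o (D \<otimes>\<^sub>o U) \<and> d \<in> Hom C (U \<otimes>\<^sub>o D) \<one>\<^sub>o \<and>
    lunit C U \<bullet> (d \<otimes>\<^sub>a Id C U) \<bullet> assoc C U D U \<bullet> (Id C U \<otimes>\<^sub>a b)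
      \<bullet> inv_arrow C (runit C U) = Id C U \<and>
    runit C D \<bullet> (Id C D \<otimes>\<^sub>a d) \<bullet> inv_arrow C (assoc C D U D) \<bullet> (b \<otimes>\<^sub>a Id C D)
      \<bullet> inv_arrow C (lunit C D) = Id C D"

text \<open>The objects of the full subcategory of objects having both a right and a left dual.\<close>
definition Ob_r :: "'o set" where
  "Ob_r = {U \<in> Ob C. (\<exists>D b d. right_dual U D b d) \<and> (\<exists>D b d. left_dual U D b d)}"

end

section \<open>Condition C\<close>

record ('o, 'm) star_data =
  star_ob :: "'o \<Rightarrow> 'o"
  star_ar :: "'m \<Rightarrow> 'm"
  star_unit :: "'o \<Rightarrow> 'm"  (* the natural isomorphism delta *)
  star_hom :: "'o \<Rightarrow> 'o \<Rightarrow> 'm \<Rightarrow> 'm"  (* the family pi *)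

locale condition_C = tensor_category C
  for C :: "('o, 'm, 'x) tensor_cat_scheme" (structure) +
  fixes S :: "('o, 'm) star_data"
  assumes star_ob_closed: "U \<in> Ob C \<Longrightarrow> star_ob S U \<in> Ob C"
    and star_ar_Hom: "f \<in> Hom C U V \<Longrightarrow> star_ar S f \<in> Hom C (star_ob S V) (star_ob S U)"
    and star_ar_Id: "U \<in> Ob C \<Longrightarrow> star_ar S (Id C U) = Id C (star_ob S U)"
    and star_ar_Comp: "\<lbrakk>f \<in> Hom C U V; g \<in> Hom C V W\<rbrakk>
      \<Longrightarrow> star_ar S (g \<bullet> f) = star_ar S f \<bullet> star_ar S g"
    and star_unit_Hom: "U \<in> Ob C \<Longrightarrow> star_unit S U \<in> Hom C U (star_ob S (star_ob S U))"
    and star_unit_iso: "U \<in> Ob C \<Longrightarrow> iso_arrow C (star_unit S U)"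
    and star_unit_natural: "f \<in> Hom C U V
      \<Longrightarrow> star_unit S V \<bullet> f = star_ar S (star_ar S f) \<bullet> star_unit S U"
    and star_hom_bij: "\<lbrakk>U \<in> Ob C; V \<in> Ob C\<rbrakk>
      \<Longrightarrow> bij_betw (star_hom S U V) (Hom C U (star_ob S V)) (Hom C (U \<otimes>\<^sub>o V) (star_ob S \<one>\<^sub>o))"
    and star_hom_natural: "\<lbrakk>f \<in> Hom C U' U; g \<in> Hom C V' V; h \<in> Hom C U (star_ob S V)\<rbrakk>
      \<Longrightarrow> star_hom S U' V' (star_ar S g \<bullet> h \<bullet> f) = star_hom S U V h \<bullet> (f \<otimes>\<^sub>a g)"

definition Ob_b :: "('o, 'm, 'x) tensor_cat_scheme \<Rightarrow> ('o, 'm) star_data \<Rightarrow> 'o set" where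
  "Ob_b C S = {U \<in> Ob C. \<exists>b d b' d'.
     right_dual C U (star_ob S U) b d \<and> left_dual C U (star_ob S U) b' d' \<and>
     monic C b \<and> monic C b'}"

section \<open>Grothendieck groups\<close>

text \<open>All groups are written multiplicatively, following HOL-Algebra; the operation of
  the free abelian group on the isomorphism classes is addition of finitely supported
  integer-valued functions.\<close>

definition K0_free :: "('o, 'm, 'x) cat_scheme \<Rightarrow> ('o set \<Rightarrow>\<^sub>0 int) monoid" where
  "K0_free C = free_Abelian_group (iso_class C ` Ob C)"

definition K0_relations :: "('o, 'm, 'x) cat_scheme \<Rightarrow> ('o set \<Rightarrow>\<^sub>0 int) set" where
  "K0_relations C = generate (K0_free C)
     {frag_of (iso_class C U) + frag_of (iso_class C W) - frag_of (iso_class C V) | U V W.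
       \<exists>f g. short_exact C U f V g W}"

definition K0 :: "('o, 'm, 'x) cat_scheme \<Rightarrow> ('o set \<Rightarrow>\<^sub>0 int) set monoid" where
  "K0 C = K0_free C Mod K0_relations C"

definition K0_class :: "('o, 'm, 'x) cat_scheme \<Rightarrow> 'o \<Rightarrow> ('o set \<Rightarrow>\<^sub>0 int) set" where
  "K0_class C U = K0_relations C #>\<^bsub>K0_free C\<^esub> frag_of (iso_class C U)"

definition K0r :: "('o, 'm, 'x) tensor_cat_scheme \<Rightarrow> ('o set \<Rightarrow>\<^sub>0 int) set monoid" where
  "K0r C = subgroup_generated (K0 C) (K0_class C ` Ob_r C)"

definition K0b ::
  "('o, 'm, 'x) tensor_cat_scheme \<Rightarrow> ('o, 'm) star_data \<Rightarrow> ('o set \<Rightarrow>\<^sub>0 int) set monoid" where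
  "K0b C S = subgroup_generated (K0 C) (K0_class C ` Ob_b C S)"

definition biadditive :: "('a, 'x) monoid_scheme \<Rightarrow> ('a \<Rightarrow> 'a \<Rightarrow> 'a) \<Rightarrow> bool" where
  "biadditive G mul \<longleftrightarrow> (\<forall>x\<in>carrier G. mul x \<in> hom G G) \<and>
    (\<forall>y\<in>carrier G. (\<lambda>x. mul x y) \<in> hom G G)"

definition K0r_product :: "('o, 'm, 'x) tensor_cat_scheme \<Rightarrow>
    (('o set \<Rightarrow>\<^sub>0 int) set \<Rightarrow> ('o set \<Rightarrow>\<^sub>0 int) set \<Rightarrow> ('o set \<Rightarrow>\<^sub>0 int) set) \<Rightarrow> bool" where
  "K0r_product C mul \<longleftrightarrow> biadditive (K0r C) mul \<and>
    (\<forall>U\<in>Ob_r C. \<forall>V\<in>Ob_r C. mul (K0_class C U) (K0_class C V) = K0_class C (U \<otimes>\<^sub>o\<^bsub>C\<^esub> V))"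

end

theory Submission
  imports Defs
begin

text \<open>
  If \<open>D\<close> is a right dual of \<open>U\<close>, then \<open>D \<otimes> -\<close> is left adjoint to \<open>U \<otimes> -\<close>, and \<open>- \<otimes> U\<close> is left
  adjoint to \<open>- \<otimes> D\<close>. Hence, for an object with duals on both sides, tensoring with it on either
  side has both adjoints and is exact, so it induces an endomorphism of the Grothendieck group; these
  endomorphisms combine to a biadditive product. Adjunctions compose, so dualizable objects are closed
  under \<open>\<otimes>\<close>. Under Condition C, both \<open>(U \<otimes> V)\<^sup>*\<close> and \<open>V\<^sup>* \<otimes> U\<^sup>*\<close> represent
  \<open>X \<mapsto> Hom (X \<otimes> (U \<otimes> V), \<one>\<^sup>*)\<close>, and coevaluations of tensor products are composites of monomorphisms
  because right adjoints preserve monomorphisms.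
\<close>

section \<open>Categories and tensor categories\<close>

text \<open>The tensor product is not assumed additive, so exactness has to come from universal
  properties alone: zero arrows are handled through zero objects, which adjoint functors preserve,
  and short exactness is rephrased as a mutual kernel and cokernel. A dual comes with zig-zag
  identities at \<open>U\<close> and \<open>D\<close> only; an adjunction needs them at every
  object, so they are tensored with an arbitrary \<open>X\<close>, which calls for classical
  coherence consequences of pentagon and triangle. On the group side the obstacle is that
  \<open>K0r\<close> is a subgroup generated by classes and has no presentation, so a map given on
  its generators need not extend. A combination \<open>x\<close> of classes is therefore multiplied
  with a generator [V] by applying the endomorphism induced by - \<otimes> V to \<open>x\<close>:
  the value depends on \<open>x\<close> and not on how it is written. The same combination of the
  left multiplications by the classes in \<open>x\<close> has these values on generators, which
  gives a homomorphism in the other argument. Exactness on both sides is thus what makes the product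
  well defined.\<close>

context category
begin

lemma mem_Hom [simp]: "f \<in> Hom C U V \<longleftrightarrow> f \<in> Ar C \<and> Dom C f = U \<and> Cod C f = V"
  by (auto simp: Hom_def)

lemma Id_simps [simp]:
  assumes "U \<in> Ob C"
  shows "Id C U \<in> Ar C" "Dom C (Id C U) = U" "Cod C (Id C U) = U"
  using Id_Hom[OF assms] by auto

lemma Dom_Ob [simp]: "f \<in> Ar C \<Longrightarrow> Dom C f \<in> Ob C"
  and Cod_Ob [simp]: "f \<in> Ar C \<Longrightarrow> Cod C f \<in> Ob C"
  by (fact Dom_closed Cod_closed)+

lemma comp_simps [simp]:
  assumes "f \<in> Ar C" "g \<in> Ar C" "Dom C g = Cod C f"
  shows "g \<bullet> f \<in> Ar C" "Dom C (g \<bullet> f) = Dom C f" "Cod C (g \<bullet> f) = Cod C g"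
  using Comp_Hom[of f "Dom C f" "Cod C f" g "Cod C g"] assms by auto

lemma comp_Id [simp]:
  assumes "f \<in> Ar C"
  shows "Cod C f = V \<Longrightarrow> Id C V \<bullet> f = f" "Dom C f = U \<Longrightarrow> f \<bullet> Id C U = f"
  using assms by (auto intro: Id_left Id_right)

lemma comp_assoc:
  "\<lbrakk>f \<in> Ar C; g \<in> Ar C; h \<in> Ar C; Dom C g = Cod C f; Dom C h = Cod C g\<rbrakk>
    \<Longrightarrow> (h \<bullet> g) \<bullet> f = h \<bullet> g \<bullet> f"
  by (rule Comp_assoc[of f "Dom C f" "Cod C f" g "Cod C g" h "Cod C h"]) auto

text \<open>Composites are kept nested to the right, so an equation about
  \<open>h \<bullet> g\<close> does not match inside a longer chain. This rule and
  \<open>comp_extend2\<close> apply such an equation to the head of a chain; the diagram chases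
  below rest on them.\<close>

lemma comp_extend:
  "\<lbrakk>h \<bullet> g = k; f \<in> Ar C; g \<in> Ar C; h \<in> Ar C; Dom C g = Cod C f; Dom C h = Cod C g\<rbrakk>
    \<Longrightarrow> h \<bullet> g \<bullet> f = k \<bullet> f"
  using comp_assoc by metis

lemma comp_extend2:
  "\<lbrakk>h \<bullet> g = k \<bullet> l; f \<in> Ar C; g \<in> Ar C; h \<in> Ar C; k \<in> Ar C; l \<in> Ar C;
    Dom C g = Cod C f; Dom C h = Cod C g; Dom C k = Cod C l; Dom C l = Cod C f\<rbrakk>
    \<Longrightarrow> h \<bullet> g \<bullet> f = k \<bullet> l \<bullet> f"
  using comp_assoc by metis

lemma inverse_arrows_unique:
  assumes "inverse_arrows C f g" "inverse_arrows C f h"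
  shows "g = h"
proof -
  have "g = (h \<bullet> f) \<bullet> g"
    using assms unfolding inverse_arrows_def by auto
  also have "\<dots> = h \<bullet> f \<bullet> g"
    using assms unfolding inverse_arrows_def by (intro comp_assoc) auto
  also have "\<dots> = h"
    using assms unfolding inverse_arrows_def by auto
  finally show ?thesis .
qed

lemma inv_arrowI: "inverse_arrows C f g \<Longrightarrow> inv_arrow C f = g"
  unfolding inv_arrow_def using inverse_arrows_unique by blast

lemma inverse_inv_arrow: "iso_arrow C f \<Longrightarrow> inverse_arrows C f (inv_arrow C f)"
  unfolding iso_arrow_def using inv_arrowI by metis

lemma iso_Ar: "iso_arrow C f \<Longrightarrow> f \<in> Ar C"
  by (auto simp: iso_arrow_def inverse_arrows_def)

lemma inv_arrow_simps [simp]: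
  assumes "iso_arrow C f"
  shows "inv_arrow C f \<in> Ar C" "Dom C (inv_arrow C f) = Cod C f" "Cod C (inv_arrow C f) = Dom C f"
    "f \<bullet> inv_arrow C f = Id C (Cod C f)" "inv_arrow C f \<bullet> f = Id C (Dom C f)"
  using inverse_inv_arrow[OF assms] by (auto simp: inverse_arrows_def)

lemma inverse_arrows_sym: "inverse_arrows C f g \<Longrightarrow> inverse_arrows C g f"
  by (auto simp: inverse_arrows_def)

lemma iso_inv_arrow [simp]:
  assumes "iso_arrow C f"
  shows "iso_arrow C (inv_arrow C f)" "inv_arrow C (inv_arrow C f) = f"
  using inverse_inv_arrow[OF assms] inv_arrowI inverse_arrows_sym iso_arrow_def by metis+

lemma inv_arrow_cancel [simp]:
  assumes "iso_arrow C f" "g \<in> Ar C"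
  shows "Cod C g = Cod C f \<Longrightarrow> f \<bullet> inv_arrow C f \<bullet> g = g"
    "Cod C g = Dom C f \<Longrightarrow> inv_arrow C f \<bullet> f \<bullet> g = g"
  using assms iso_Ar[OF assms(1)] by (auto simp: comp_assoc[symmetric])

lemma iso_cancel_left:
  assumes "iso_arrow C f" "g \<in> Ar C" "h \<in> Ar C" "Cod C g = Dom C f" "Cod C h = Dom C f"
    "f \<bullet> g = f \<bullet> h"
  shows "g = h"
  using assms inv_arrow_cancel(2) by metis

lemma iso_cancel_right:
  assumes "iso_arrow C f" "g \<in> Ar C" "h \<in> Ar C" "Dom C g = Cod C f" "Dom C h = Cod C f"
    "g \<bullet> f = h \<bullet> f"
  shows "g = h"
proof -
  have f: "f \<in> Ar C" using assms(1) by (rule iso_Ar)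
  have "(k \<bullet> f) \<bullet> inv_arrow C f = k" if "k \<in> Ar C" "Dom C k = Cod C f" for k
    using that assms(1) f by (simp add: comp_assoc)
  then show ?thesis
    using assms by metis
qed

lemma iso_arrowI:
  "\<lbrakk>f \<in> Ar C; g \<in> Ar C; Dom C g = Cod C f; Cod C g = Dom C f;
    g \<bullet> f = Id C (Dom C f); f \<bullet> g = Id C (Cod C f)\<rbrakk> \<Longrightarrow> iso_arrow C f"
  unfolding iso_arrow_def inverse_arrows_def by auto

lemma iso_Id [simp]: "U \<in> Ob C \<Longrightarrow> iso_arrow C (Id C U)"
  by (rule iso_arrowI[of _ "Id C U"]) auto

lemma iso_comp:
  assumes "iso_arrow C f" "iso_arrow C g" "Dom C g = Cod C f"
  shows "iso_arrow C (g \<bullet> f)"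
proof (rule iso_arrowI)
  have [simp]: "f \<in> Ar C" "g \<in> Ar C" using assms iso_Ar by auto
  show "g \<bullet> f \<in> Ar C" "inv_arrow C f \<bullet> inv_arrow C g \<in> Ar C"
    "Dom C (inv_arrow C f \<bullet> inv_arrow C g) = Cod C (g \<bullet> f)"
    "Cod C (inv_arrow C f \<bullet> inv_arrow C g) = Dom C (g \<bullet> f)"
    "(inv_arrow C f \<bullet> inv_arrow C g) \<bullet> g \<bullet> f = Id C (Dom C (g \<bullet> f))"
    "(g \<bullet> f) \<bullet> inv_arrow C f \<bullet> inv_arrow C g = Id C (Cod C (g \<bullet> f))"
    using assms by (simp_all add: comp_assoc)
qed

lemma isomorphic_refl: "U \<in> Ob C \<Longrightarrow> isomorphic C U U"
  unfolding isomorphic_def using iso_Id by (auto intro!: bexI[of _ "Id C U"])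

lemma isomorphic_sym: "isomorphic C U V \<Longrightarrow> isomorphic C V U"
  unfolding isomorphic_def using iso_Ar by (metis inv_arrow_simps(1-3) iso_inv_arrow(1) mem_Hom)

lemma isomorphic_trans:
  assumes "isomorphic C U V" "isomorphic C V W"
  shows "isomorphic C U W"
proof -
  obtain f g where "f \<in> Hom C U V" "iso_arrow C f" "g \<in> Hom C V W" "iso_arrow C g"
    using assms unfolding isomorphic_def by blast
  then show ?thesis
    unfolding isomorphic_def by (intro bexI[of _ "g \<bullet> f"] iso_comp) auto
qed

lemma iso_class_eq: "isomorphic C U V \<Longrightarrow> iso_class C U = iso_class C V"
  unfolding iso_class_def using isomorphic_sym isomorphic_trans by blast

lemma monic_comp:
  assumes "monic C f" "monic C g" "Dom C g = Cod C f"
  shows "monic C (g \<bullet> f)"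
  unfolding monic_def
proof (intro conjI allI ballI impI)
  have [simp]: "f \<in> Ar C" "g \<in> Ar C" using assms by (auto simp: monic_def)
  show "g \<bullet> f \<in> Ar C" using assms by simp
  fix X h k
  assume h: "h \<in> Hom C X (Dom C (g \<bullet> f))" and k: "k \<in> Hom C X (Dom C (g \<bullet> f))"
    and "(g \<bullet> f) \<bullet> h = (g \<bullet> f) \<bullet> k"
  then have "g \<bullet> f \<bullet> h = g \<bullet> f \<bullet> k"
    using assms by (simp add: comp_assoc)
  then have "f \<bullet> h = f \<bullet> k"
    using assms h k unfolding monic_def[of _ g] by (metis comp_simps mem_Hom \<open>f \<in> Ar C\<close> \<open>g \<in> Ar C\<close>)
  then show "h = k"
    using assms h k unfolding monic_def[of _ f] by (metis comp_simps mem_Hom \<open>f \<in> Ar C\<close> \<open>g \<in> Ar C\<close>)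
qed

lemma iso_monic: "iso_arrow C f \<Longrightarrow> monic C f"
  unfolding monic_def using iso_cancel_left iso_Ar by auto

end

section \<open>Coherence of the unit constraints\<close>

context tensor_category
begin

declare TOb_closed [simp] TUnit_closed [simp] TAr_Id [simp]
  assoc_iso [simp] lunit_iso [simp] runit_iso [simp]

lemma TAr_simps [simp]:
  assumes "f \<in> Ar C" "g \<in> Ar C"
  shows "f \<otimes>\<^sub>a g \<in> Ar C" "Dom C (f \<otimes>\<^sub>a g) = Dom C f \<otimes>\<^sub>o Dom C g" "Cod C (f \<otimes>\<^sub>a g) = Cod C f \<otimes>\<^sub>o Cod C g"
  using TAr_Hom[of f "Dom C f" "Cod C f" g "Dom C g" "Cod C g"] assms by auto

lemma constraint_simps [simp]:
  shows "\<lbrakk>U \<in> Ob C; V \<in> Ob C; W \<in> Ob C\<rbrakk> \<Longrightarrow> assoc C U V W \<in> Ar C"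
    "\<lbrakk>U \<in> Ob C; V \<in> Ob C; W \<in> Ob C\<rbrakk> \<Longrightarrow> Dom C (assoc C U V W) = U \<otimes>\<^sub>o V \<otimes>\<^sub>o W"
    "\<lbrakk>U \<in> Ob C; V \<in> Ob C; W \<in> Ob C\<rbrakk> \<Longrightarrow> Cod C (assoc C U V W) = (U \<otimes>\<^sub>o V) \<otimes>\<^sub>o W"
    "U \<in> Ob C \<Longrightarrow> lunit C U \<in> Ar C" "U \<in> Ob C \<Longrightarrow> Dom C (lunit C U) = \<one>\<^sub>o \<otimes>\<^sub>o U"
    "U \<in> Ob C \<Longrightarrow> Cod C (lunit C U) = U"
    "U \<in> Ob C \<Longrightarrow> runit C U \<in> Ar C" "U \<in> Ob C \<Longrightarrow> Dom C (runit C U) = U \<otimes>\<^sub>o \<one>\<^sub>o"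
    "U \<in> Ob C \<Longrightarrow> Cod C (runit C U) = U"
  using assoc_Hom lunit_Hom runit_Hom by auto

lemma interchange:
  "\<lbrakk>f \<in> Ar C; f' \<in> Ar C; g \<in> Ar C; g' \<in> Ar C; Dom C f' = Cod C f; Dom C g' = Cod C g\<rbrakk>
    \<Longrightarrow> (f' \<otimes>\<^sub>a g') \<bullet> (f \<otimes>\<^sub>a g) = (f' \<bullet> f) \<otimes>\<^sub>a (g' \<bullet> g)"
  by (rule TAr_Comp[symmetric, of _ "Dom C f" "Cod C f" _ "Cod C f'" _ "Dom C g" "Cod C g" _ "Cod C g'"]) auto

lemma whisker_left:
  "\<lbrakk>U \<in> Ob C; f \<in> Ar C; g \<in> Ar C; Dom C g = Cod C f\<rbrakk>
    \<Longrightarrow> Id C U \<otimes>\<^sub>a (g \<bullet> f) = (Id C U \<otimes>\<^sub>a g) \<bullet> (Id C U \<otimes>\<^sub>a f)"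
  by (simp add: interchange)

lemma whisker_right:
  "\<lbrakk>U \<in> Ob C; f \<in> Ar C; g \<in> Ar C; Dom C g = Cod C f\<rbrakk>
    \<Longrightarrow> (g \<bullet> f) \<otimes>\<^sub>a Id C U = (g \<otimes>\<^sub>a Id C U) \<bullet> (f \<otimes>\<^sub>a Id C U)"
  by (simp add: interchange)

lemma assoc_nat:
  "\<lbrakk>f \<in> Ar C; g \<in> Ar C; h \<in> Ar C\<rbrakk> \<Longrightarrow>
    assoc C (Cod C f) (Cod C g) (Cod C h) \<bullet> (f \<otimes>\<^sub>a g \<otimes>\<^sub>a h)
      = ((f \<otimes>\<^sub>a g) \<otimes>\<^sub>a h) \<bullet> assoc C (Dom C f) (Dom C g) (Dom C h)"
  by (rule assoc_natural) auto

lemma iso_TAr [simp]: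
  assumes "iso_arrow C f" "iso_arrow C g"
  shows "iso_arrow C (f \<otimes>\<^sub>a g)"
  using assms iso_Ar by (intro iso_arrowI[of _ "inv_arrow C f \<otimes>\<^sub>a inv_arrow C g"]) (auto simp: interchange)

lemma inv_TAr:
  assumes "iso_arrow C f" "iso_arrow C g"
  shows "inv_arrow C (f \<otimes>\<^sub>a g) = inv_arrow C f \<otimes>\<^sub>a inv_arrow C g"
  using assms iso_Ar by (intro inv_arrowI) (auto simp: interchange inverse_arrows_def)

text \<open>Naturality of the isomorphism \<open>lunit\<close> conjugates tensoring with the unit
  object into the identity functor, which is faithful.\<close>

lemma unit_left_faithful:
  assumes "f \<in> Ar C" "g \<in> Ar C" "Dom C f = Dom C g" "Cod C f = Cod C g"
    "Id C \<one>\<^sub>o \<otimes>\<^sub>a f = Id C \<one>\<^sub>o \<otimes>\<^sub>a g"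
  shows "f = g"
proof (rule iso_cancel_right[of "lunit C (Dom C f)"])
  show "f \<bullet> lunit C (Dom C f) = g \<bullet> lunit C (Dom C f)"
    using lunit_natural[of f "Dom C f" "Cod C f"] lunit_natural[of g "Dom C f" "Cod C f"] assms by simp
qed (use assms in auto)

lemma unit_right_faithful:
  assumes "f \<in> Ar C" "g \<in> Ar C" "Dom C f = Dom C g" "Cod C f = Cod C g"
    "f \<otimes>\<^sub>a Id C \<one>\<^sub>o = g \<otimes>\<^sub>a Id C \<one>\<^sub>o"
  shows "f = g"
proof (rule iso_cancel_right[of "runit C (Dom C f)"])
  show "f \<bullet> runit C (Dom C f) = g \<bullet> runit C (Dom C f)"
    using runit_natural[of f "Dom C f" "Cod C f"] runit_natural[of g "Dom C f" "Cod C f"] assms by simp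
qed (use assms in auto)

text \<open>Kelly's argument: the axioms contain only the triangle with the unit in the middle, and
  this one, with the unit on the left, is derived. After tensoring with the unit once more, the
  pentagon at \<one>, \<one>, X, Y and two instances of the middle triangle give the equation;
  \<open>unit_left_faithful\<close> then removes the extra unit.\<close>

lemma lunit_tensor:
  assumes [simp]: "X \<in> Ob C" "Y \<in> Ob C"
  shows "lunit C (X \<otimes>\<^sub>o Y) = (lunit C X \<otimes>\<^sub>a Id C Y) \<bullet> assoc C \<one>\<^sub>o X Y"
proof (rule unit_left_faithful)
  let ?I = "\<one>\<^sub>o" let ?r = "runit C ?I"
  have "assoc C ?I X Y \<bullet> (Id C ?I \<otimes>\<^sub>a lunit C (X \<otimes>\<^sub>o Y))
      = assoc C ?I X Y \<bullet> (?r \<otimes>\<^sub>a Id C X \<otimes>\<^sub>a Id C Y) \<bullet> assoc C ?I ?I (X \<otimes>\<^sub>o Y)"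
    using triangle[of ?I "X \<otimes>\<^sub>o Y"] by simp
  also have "\<dots> = ((?r \<otimes>\<^sub>a Id C X) \<otimes>\<^sub>a Id C Y) \<bullet> assoc C (?I \<otimes>\<^sub>o ?I) X Y \<bullet> assoc C ?I ?I (X \<otimes>\<^sub>o Y)"
    using assoc_nat[of ?r "Id C X" "Id C Y"] by (intro comp_extend2) auto
  also have "\<dots> = ((?r \<otimes>\<^sub>a Id C X) \<otimes>\<^sub>a Id C Y) \<bullet> (assoc C ?I ?I X \<otimes>\<^sub>a Id C Y)
      \<bullet> assoc C ?I (?I \<otimes>\<^sub>o X) Y \<bullet> (Id C ?I \<otimes>\<^sub>a assoc C ?I X Y)"
    using pentagon[of ?I ?I X Y] by simp
  also have "\<dots> = ((Id C ?I \<otimes>\<^sub>a lunit C X) \<otimes>\<^sub>a Id C Y)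
      \<bullet> assoc C ?I (?I \<otimes>\<^sub>o X) Y \<bullet> (Id C ?I \<otimes>\<^sub>a assoc C ?I X Y)"
    using triangle[of ?I X] by (intro comp_extend) (auto simp: interchange)
  also have "\<dots> = assoc C ?I X Y \<bullet> (Id C ?I \<otimes>\<^sub>a lunit C X \<otimes>\<^sub>a Id C Y) \<bullet> (Id C ?I \<otimes>\<^sub>a assoc C ?I X Y)"
    using assoc_nat[of "Id C ?I" "lunit C X" "Id C Y"] by (intro comp_extend2) auto
  also have "\<dots> = assoc C ?I X Y \<bullet> (Id C ?I \<otimes>\<^sub>a ((lunit C X \<otimes>\<^sub>a Id C Y) \<bullet> assoc C \<one>\<^sub>o X Y))"
    by (simp add: interchange)
  finally show "Id C ?I \<otimes>\<^sub>a lunit C (X \<otimes>\<^sub>o Y) = Id C ?I \<otimes>\<^sub>a ((lunit C X \<otimes>\<^sub>a Id C Y) \<bullet> assoc C \<one>\<^sub>o X Y)"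
    by (rule iso_cancel_left[rotated -1]) simp_all
qed simp_all

text \<open>Naturality of \<open>lunit\<close> at its own component identifies \<open>lunit\<close>
  of \<one> \<otimes> \<one> with the whiskered \<open>lunit\<close> of \<one>. Comparing
  \<open>lunit_tensor\<close> with the middle triangle at \<one>, \<one> leaves the two unit
  constraints equal after tensoring with \<one>.\<close>

lemma lunit_unit: "lunit C \<one>\<^sub>o = runit C \<one>\<^sub>o"
proof (rule unit_right_faithful)
  let ?I = "\<one>\<^sub>o"
  have "lunit C ?I \<bullet> (Id C ?I \<otimes>\<^sub>a lunit C ?I) = lunit C ?I \<bullet> lunit C (?I \<otimes>\<^sub>o ?I)"
    by (rule lunit_natural) simp
  then have "Id C ?I \<otimes>\<^sub>a lunit C ?I = lunit C (?I \<otimes>\<^sub>o ?I)"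
    by (rule iso_cancel_left[rotated -1]) simp_all
  then have "(lunit C ?I \<otimes>\<^sub>a Id C ?I) \<bullet> assoc C ?I ?I ?I = (runit C ?I \<otimes>\<^sub>a Id C ?I) \<bullet> assoc C ?I ?I ?I"
    using triangle[of ?I ?I] lunit_tensor[of ?I ?I] by simp
  then show "lunit C ?I \<otimes>\<^sub>a Id C ?I = runit C ?I \<otimes>\<^sub>a Id C ?I"
    by (rule iso_cancel_right[rotated -1]) simp_all
qed simp_all

end

section \<open>Duality and adjunction\<close>

lemma (in category) inv_square:
  assumes "iso_arrow C i" "iso_arrow C j" "f \<in> Ar C" "g \<in> Ar C"
    "Dom C f = Dom C i" "Cod C f = Dom C j" "Dom C g = Cod C i" "Cod C g = Cod C j"
    and eq: "j \<bullet> f = g \<bullet> i"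
  shows "inv_arrow C j \<bullet> g = f \<bullet> inv_arrow C i"
proof (rule iso_cancel_left[of j])
  have [simp]: "i \<in> Ar C" "j \<in> Ar C" using assms iso_Ar by auto
  have "j \<bullet> f \<bullet> inv_arrow C i = (g \<bullet> i) \<bullet> inv_arrow C i"
    using assms by (intro comp_extend) auto
  also have "\<dots> = g"
    using assms by (simp add: comp_assoc)
  finally show "j \<bullet> inv_arrow C j \<bullet> g = j \<bullet> f \<bullet> inv_arrow C i"
    using assms by simp
  show "inv_arrow C j \<bullet> g \<in> Ar C" "f \<bullet> inv_arrow C i \<in> Ar C"
    "Cod C (inv_arrow C j \<bullet> g) = Dom C j" "Cod C (f \<bullet> inv_arrow C i) = Dom C j" "iso_arrow C j"
    using assms by simp_all
qed

context tensor_category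
begin

text \<open>The component X \<rightarrow> U \<otimes> (D \<otimes> X) of the unit of the prospective
  adjunction between D \<otimes> - and U \<otimes> -; \<open>ev_at\<close> is the component D
  \<otimes> (U \<otimes> X) \<rightarrow> X of its counit.\<close>

definition coev_at :: "'o \<Rightarrow> 'o \<Rightarrow> 'm \<Rightarrow> 'o \<Rightarrow> 'm" where
  "coev_at U D b X = inv_arrow C (assoc C U D X) \<bullet> (b \<otimes>\<^sub>a Id C X) \<bullet> inv_arrow C (lunit C X)"

definition ev_at :: "'o \<Rightarrow> 'o \<Rightarrow> 'm \<Rightarrow> 'o \<Rightarrow> 'm" where
  "ev_at U D d X = lunit C X \<bullet> (d \<otimes>\<^sub>a Id C X) \<bullet> assoc C D U X"

end

text \<open>The zig-zag identities are left out on purpose: naturality and compatibility with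
  \<otimes> hold for any such \<open>b\<close> and \<open>d\<close>, and are used on candidates for
  a dual whose zig-zag identities are still to be proved.\<close>

locale predual = tensor_category +
  fixes U D b d
  assumes U_Ob [simp]: "U \<in> Ob C" and D_Ob [simp]: "D \<in> Ob C"
    and b_Hom: "b \<in> Hom C \<one>\<^sub>o (U \<otimes>\<^sub>o D)" and d_Hom: "d \<in> Hom C (D \<otimes>\<^sub>o U) \<one>\<^sub>o"
begin

abbreviation "\<eta> \<equiv> coev_at U D b"
abbreviation "\<epsilon> \<equiv> ev_at U D d"

lemma bd_simps [simp]:
  "b \<in> Ar C" "Dom C b = \<one>\<^sub>o" "Cod C b = U \<otimes>\<^sub>o D"
  "d \<in> Ar C" "Dom C d = D \<otimes>\<^sub>o U" "Cod C d = \<one>\<^sub>o"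
  using b_Hom d_Hom by auto

lemma coev_ev_simps [simp]:
  assumes "X \<in> Ob C"
  shows "\<eta> X \<in> Ar C" "Dom C (\<eta> X) = X" "Cod C (\<eta> X) = U \<otimes>\<^sub>o D \<otimes>\<^sub>o X"
    "\<epsilon> X \<in> Ar C" "Dom C (\<epsilon> X) = D \<otimes>\<^sub>o U \<otimes>\<^sub>o X" "Cod C (\<epsilon> X) = X"
  unfolding coev_at_def ev_at_def using assms by simp_all

lemma coev_nat:
  assumes f: "f \<in> Ar C"
  shows "\<eta> (Cod C f) \<bullet> f = (Id C U \<otimes>\<^sub>a Id C D \<otimes>\<^sub>a f) \<bullet> \<eta> (Dom C f)"
proof -
  let ?X = "Dom C f" let ?Y = "Cod C f"
  have [simp]: "f \<in> Ar C" by fact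
  have "\<eta> ?Y \<bullet> f = inv_arrow C (assoc C U D ?Y) \<bullet> (b \<otimes>\<^sub>a Id C ?Y) \<bullet> inv_arrow C (lunit C ?Y) \<bullet> f"
    unfolding coev_at_def by (simp add: comp_assoc)
  also have "inv_arrow C (lunit C ?Y) \<bullet> f = (Id C \<one>\<^sub>o \<otimes>\<^sub>a f) \<bullet> inv_arrow C (lunit C ?X)"
    by (rule inv_square) (simp_all add: lunit_natural[of f ?X ?Y])
  also have "(b \<otimes>\<^sub>a Id C ?Y) \<bullet> \<dots> = (Id C (U \<otimes>\<^sub>o D) \<otimes>\<^sub>a f) \<bullet> (b \<otimes>\<^sub>a Id C ?X) \<bullet> inv_arrow C (lunit C ?X)"
    by (rule comp_extend2) (simp_all add: interchange)
  also have "inv_arrow C (assoc C U D ?Y) \<bullet> \<dots>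
      = (Id C U \<otimes>\<^sub>a Id C D \<otimes>\<^sub>a f) \<bullet> inv_arrow C (assoc C U D ?X) \<bullet> (b \<otimes>\<^sub>a Id C ?X) \<bullet> inv_arrow C (lunit C ?X)"
  proof (rule comp_extend2)
    show "inv_arrow C (assoc C U D ?Y) \<bullet> (Id C (U \<otimes>\<^sub>o D) \<otimes>\<^sub>a f)
        = (Id C U \<otimes>\<^sub>a Id C D \<otimes>\<^sub>a f) \<bullet> inv_arrow C (assoc C U D ?X)"
      using assoc_nat[of "Id C U" "Id C D" f] by (intro inv_square) simp_all
  qed simp_all
  finally show ?thesis
    unfolding coev_at_def .
qed

lemma ev_nat:
  assumes f: "f \<in> Ar C"
  shows "\<epsilon> (Cod C f) \<bullet> (Id C D \<otimes>\<^sub>a Id C U \<otimes>\<^sub>a f) = f \<bullet> \<epsilon> (Dom C f)"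
proof -
  let ?X = "Dom C f" let ?Y = "Cod C f"
  have [simp]: "f \<in> Ar C" by fact
  have "\<epsilon> ?Y \<bullet> (Id C D \<otimes>\<^sub>a Id C U \<otimes>\<^sub>a f)
      = lunit C ?Y \<bullet> (d \<otimes>\<^sub>a Id C ?Y) \<bullet> assoc C D U ?Y \<bullet> (Id C D \<otimes>\<^sub>a Id C U \<otimes>\<^sub>a f)"
    unfolding ev_at_def by (simp add: comp_assoc)
  also have "assoc C D U ?Y \<bullet> (Id C D \<otimes>\<^sub>a Id C U \<otimes>\<^sub>a f) = (Id C (D \<otimes>\<^sub>o U) \<otimes>\<^sub>a f) \<bullet> assoc C D U ?X"
    using assoc_nat[of "Id C D" "Id C U" f] by simp
  also have "(d \<otimes>\<^sub>a Id C ?Y) \<bullet> \<dots> = (Id C \<one>\<^sub>o \<otimes>\<^sub>a f) \<bullet> (d \<otimes>\<^sub>a Id C ?X) \<bullet> assoc C D U ?X"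
    by (rule comp_extend2) (simp_all add: interchange)
  also have "lunit C ?Y \<bullet> \<dots> = f \<bullet> lunit C ?X \<bullet> (d \<otimes>\<^sub>a Id C ?X) \<bullet> assoc C D U ?X"
    by (rule comp_extend2) (simp_all add: lunit_natural[of f ?X ?Y])
  finally show ?thesis
    unfolding ev_at_def .
qed

text \<open>The unit acts only to the left of its argument, so on X \<otimes> Y it is the unit on X
  tensored with Y, up to reassociation. The pentagon rearranges the three associators and
  \<open>lunit_tensor\<close> splits the left unit constraint.\<close>

lemma coev_tensor:
  assumes [simp]: "X \<in> Ob C" "Y \<in> Ob C"
  shows "assoc C U (D \<otimes>\<^sub>o X) Y \<bullet> (Id C U \<otimes>\<^sub>a assoc C D X Y) \<bullet> \<eta> (X \<otimes>\<^sub>o Y) = \<eta> X \<otimes>\<^sub>a Id C Y"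
proof (rule iso_cancel_left[of "assoc C U D X \<otimes>\<^sub>a Id C Y"])
  have "assoc C \<one>\<^sub>o X Y = (inv_arrow C (lunit C X) \<otimes>\<^sub>a Id C Y) \<bullet> lunit C (X \<otimes>\<^sub>o Y)"
    by (simp add: lunit_tensor comp_assoc[symmetric] interchange)
  then have *: "assoc C \<one>\<^sub>o X Y \<bullet> inv_arrow C (lunit C (X \<otimes>\<^sub>o Y)) = inv_arrow C (lunit C X) \<otimes>\<^sub>a Id C Y"
    by (simp add: comp_assoc)
  have "(assoc C U D X \<otimes>\<^sub>a Id C Y) \<bullet> assoc C U (D \<otimes>\<^sub>o X) Y \<bullet> (Id C U \<otimes>\<^sub>a assoc C D X Y) \<bullet> \<eta> (X \<otimes>\<^sub>o Y)
      = ((assoc C U D X \<otimes>\<^sub>a Id C Y) \<bullet> assoc C U (D \<otimes>\<^sub>o X) Y \<bullet> (Id C U \<otimes>\<^sub>a assoc C D X Y)) \<bullet> \<eta> (X \<otimes>\<^sub>o Y)"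
    by (simp add: comp_assoc)
  also have "\<dots> = assoc C (U \<otimes>\<^sub>o D) X Y \<bullet> assoc C U D (X \<otimes>\<^sub>o Y) \<bullet> \<eta> (X \<otimes>\<^sub>o Y)"
    by (simp add: pentagon comp_assoc)
  also have "\<dots> = assoc C (U \<otimes>\<^sub>o D) X Y \<bullet> (b \<otimes>\<^sub>a Id C (X \<otimes>\<^sub>o Y)) \<bullet> inv_arrow C (lunit C (X \<otimes>\<^sub>o Y))"
    by (simp add: coev_at_def)
  also have "\<dots> = ((b \<otimes>\<^sub>a Id C X) \<otimes>\<^sub>a Id C Y) \<bullet> assoc C \<one>\<^sub>o X Y \<bullet> inv_arrow C (lunit C (X \<otimes>\<^sub>o Y))"
    using assoc_nat[of b "Id C X" "Id C Y"] by (intro comp_extend2) simp_all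
  also have "\<dots> = (assoc C U D X \<otimes>\<^sub>a Id C Y) \<bullet> (\<eta> X \<otimes>\<^sub>a Id C Y)"
    unfolding * by (simp add: interchange coev_at_def)
  finally show "(assoc C U D X \<otimes>\<^sub>a Id C Y) \<bullet> assoc C U (D \<otimes>\<^sub>o X) Y \<bullet> (Id C U \<otimes>\<^sub>a assoc C D X Y) \<bullet> \<eta> (X \<otimes>\<^sub>o Y)
      = (assoc C U D X \<otimes>\<^sub>a Id C Y) \<bullet> (\<eta> X \<otimes>\<^sub>a Id C Y)" .
qed simp_all

lemma ev_tensor:
  assumes [simp]: "X \<in> Ob C" "Y \<in> Ob C"
  shows "(\<epsilon> X \<otimes>\<^sub>a Id C Y) \<bullet> assoc C D (U \<otimes>\<^sub>o X) Y \<bullet> (Id C D \<otimes>\<^sub>a assoc C U X Y) = \<epsilon> (X \<otimes>\<^sub>o Y)"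
proof -
  have "(\<epsilon> X \<otimes>\<^sub>a Id C Y) \<bullet> assoc C D (U \<otimes>\<^sub>o X) Y \<bullet> (Id C D \<otimes>\<^sub>a assoc C U X Y)
      = (lunit C X \<otimes>\<^sub>a Id C Y) \<bullet> ((d \<otimes>\<^sub>a Id C X) \<otimes>\<^sub>a Id C Y) \<bullet> (assoc C D U X \<otimes>\<^sub>a Id C Y)
        \<bullet> assoc C D (U \<otimes>\<^sub>o X) Y \<bullet> (Id C D \<otimes>\<^sub>a assoc C U X Y)"
    by (simp add: ev_at_def whisker_right comp_assoc)
  also have "\<dots> = (lunit C X \<otimes>\<^sub>a Id C Y) \<bullet> ((d \<otimes>\<^sub>a Id C X) \<otimes>\<^sub>a Id C Y) \<bullet> assoc C (D \<otimes>\<^sub>o U) X Y \<bullet> assoc C D U (X \<otimes>\<^sub>o Y)"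
    by (simp add: pentagon)
  also have "((d \<otimes>\<^sub>a Id C X) \<otimes>\<^sub>a Id C Y) \<bullet> assoc C (D \<otimes>\<^sub>o U) X Y \<bullet> assoc C D U (X \<otimes>\<^sub>o Y)
      = assoc C \<one>\<^sub>o X Y \<bullet> (d \<otimes>\<^sub>a Id C (X \<otimes>\<^sub>o Y)) \<bullet> assoc C D U (X \<otimes>\<^sub>o Y)"
    using assoc_nat[of d "Id C X" "Id C Y"] by (intro comp_extend2) simp_all
  also have "(lunit C X \<otimes>\<^sub>a Id C Y) \<bullet> \<dots> = \<epsilon> (X \<otimes>\<^sub>o Y)"
    by (simp add: ev_at_def lunit_tensor comp_assoc)
  finally show ?thesis .
qed

text \<open>By \<open>coev_tensor\<close> the unit at U \<otimes> X is the unit at U tensored with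
  X, and the triangle axiom trades the \<open>lunit\<close> of X inside the counit for the
  \<open>runit\<close> of U. What remains is the first zig-zag composite of \<open>U\<close>,
  tensored with X.\<close>

lemma zigzag_left_at:
  assumes [simp]: "X \<in> Ob C"
  shows "(Id C U \<otimes>\<^sub>a \<epsilon> X) \<bullet> \<eta> (U \<otimes>\<^sub>o X) = (runit C U \<bullet> (Id C U \<otimes>\<^sub>a d) \<bullet> \<eta> U) \<otimes>\<^sub>a Id C X"
proof -
  have "(Id C U \<otimes>\<^sub>a \<epsilon> X) \<bullet> \<eta> (U \<otimes>\<^sub>o X)
      = (Id C U \<otimes>\<^sub>a lunit C X) \<bullet> (Id C U \<otimes>\<^sub>a d \<otimes>\<^sub>a Id C X) \<bullet> (Id C U \<otimes>\<^sub>a assoc C D U X) \<bullet> \<eta> (U \<otimes>\<^sub>o X)"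
    by (simp add: ev_at_def whisker_left comp_assoc)
  also have "\<dots> = (runit C U \<otimes>\<^sub>a Id C X) \<bullet> assoc C U \<one>\<^sub>o X \<bullet> (Id C U \<otimes>\<^sub>a d \<otimes>\<^sub>a Id C X)
      \<bullet> (Id C U \<otimes>\<^sub>a assoc C D U X) \<bullet> \<eta> (U \<otimes>\<^sub>o X)"
    by (simp add: triangle[symmetric] comp_assoc)
  also have "assoc C U \<one>\<^sub>o X \<bullet> (Id C U \<otimes>\<^sub>a d \<otimes>\<^sub>a Id C X) \<bullet> (Id C U \<otimes>\<^sub>a assoc C D U X) \<bullet> \<eta> (U \<otimes>\<^sub>o X)
     = ((Id C U \<otimes>\<^sub>a d) \<otimes>\<^sub>a Id C X) \<bullet> assoc C U (D \<otimes>\<^sub>o U) X \<bullet> (Id C U \<otimes>\<^sub>a assoc C D U X) \<bullet> \<eta> (U \<otimes>\<^sub>o X)"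
    using assoc_nat[of "Id C U" d "Id C X"] by (intro comp_extend2) simp_all
  also have "assoc C U (D \<otimes>\<^sub>o U) X \<bullet> (Id C U \<otimes>\<^sub>a assoc C D U X) \<bullet> \<eta> (U \<otimes>\<^sub>o X) = \<eta> U \<otimes>\<^sub>a Id C X"
    by (rule coev_tensor) simp_all
  finally show ?thesis
    by (simp add: whisker_right)
qed

lemma zigzag_right_at:
  assumes [simp]: "X \<in> Ob C"
  shows "\<epsilon> (D \<otimes>\<^sub>o X) \<bullet> (Id C D \<otimes>\<^sub>a \<eta> X) = (\<epsilon> D \<bullet> (Id C D \<otimes>\<^sub>a b) \<bullet> inv_arrow C (runit C D)) \<otimes>\<^sub>a Id C X"
proof -
  \<comment> \<open>The triangle axiom, solved for the inverses of the unit constraints.\<close>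
  have *: "assoc C D \<one>\<^sub>o X \<bullet> (Id C D \<otimes>\<^sub>a inv_arrow C (lunit C X)) = inv_arrow C (runit C D) \<otimes>\<^sub>a Id C X"
  proof (rule iso_cancel_left)
    have "(runit C D \<otimes>\<^sub>a Id C X) \<bullet> assoc C D \<one>\<^sub>o X \<bullet> (Id C D \<otimes>\<^sub>a inv_arrow C (lunit C X))
        = (Id C D \<otimes>\<^sub>a lunit C X) \<bullet> (Id C D \<otimes>\<^sub>a inv_arrow C (lunit C X))"
      by (rule comp_extend) (simp_all add: triangle)
    then show "(runit C D \<otimes>\<^sub>a Id C X) \<bullet> assoc C D \<one>\<^sub>o X \<bullet> (Id C D \<otimes>\<^sub>a inv_arrow C (lunit C X))
        = (runit C D \<otimes>\<^sub>a Id C X) \<bullet> (inv_arrow C (runit C D) \<otimes>\<^sub>a Id C X)"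
      by (simp add: interchange)
  qed simp_all
  have "\<epsilon> (D \<otimes>\<^sub>o X) \<bullet> (Id C D \<otimes>\<^sub>a \<eta> X) = (\<epsilon> D \<otimes>\<^sub>a Id C X) \<bullet> assoc C D (U \<otimes>\<^sub>o D) X \<bullet> (Id C D \<otimes>\<^sub>a assoc C U D X)
      \<bullet> (Id C D \<otimes>\<^sub>a \<eta> X)"
    by (simp add: ev_tensor[symmetric] comp_assoc)
  also have "(Id C D \<otimes>\<^sub>a assoc C U D X) \<bullet> (Id C D \<otimes>\<^sub>a \<eta> X)
      = (Id C D \<otimes>\<^sub>a b \<otimes>\<^sub>a Id C X) \<bullet> (Id C D \<otimes>\<^sub>a inv_arrow C (lunit C X))"
    by (simp add: interchange coev_at_def)
  also have "assoc C D (U \<otimes>\<^sub>o D) X \<bullet> \<dots>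
      = ((Id C D \<otimes>\<^sub>a b) \<otimes>\<^sub>a Id C X) \<bullet> assoc C D \<one>\<^sub>o X \<bullet> (Id C D \<otimes>\<^sub>a inv_arrow C (lunit C X))"
    using assoc_nat[of "Id C D" b "Id C X"] by (intro comp_extend2) simp_all
  finally show ?thesis
    unfolding * by (simp add: whisker_right)
qed

lemma right_dual_iff:
  "right_dual C U D b d \<longleftrightarrow> runit C U \<bullet> (Id C U \<otimes>\<^sub>a d) \<bullet> \<eta> U = Id C U \<and>
    \<epsilon> D \<bullet> (Id C D \<otimes>\<^sub>a b) \<bullet> inv_arrow C (runit C D) = Id C D"
  unfolding right_dual_def coev_at_def ev_at_def by (auto simp: comp_assoc)

text \<open>The zig-zag identities say precisely that \<open>D \<otimes> -\<close> is left adjoint to \<open>U \<otimes> -\<close>, and it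
  suffices to test this at the unit object.\<close>

lemma right_dualI:
  assumes "(Id C U \<otimes>\<^sub>a \<epsilon> \<one>\<^sub>o) \<bullet> \<eta> (U \<otimes>\<^sub>o \<one>\<^sub>o) = Id C (U \<otimes>\<^sub>o \<one>\<^sub>o)"
    and "\<epsilon> (D \<otimes>\<^sub>o \<one>\<^sub>o) \<bullet> (Id C D \<otimes>\<^sub>a \<eta> \<one>\<^sub>o) = Id C (D \<otimes>\<^sub>o \<one>\<^sub>o)"
  shows "right_dual C U D b d"
  unfolding right_dual_iff
proof
  show "runit C U \<bullet> (Id C U \<otimes>\<^sub>a d) \<bullet> \<eta> U = Id C U"
    using assms(1) zigzag_left_at[of "\<one>\<^sub>o"] by - (rule unit_right_faithful, simp_all)
  show "\<epsilon> D \<bullet> (Id C D \<otimes>\<^sub>a b) \<bullet> inv_arrow C (runit C D) = Id C D"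
    using assms(2) zigzag_right_at[of "\<one>\<^sub>o"] by - (rule unit_right_faithful, simp_all)
qed

text \<open>Tensoring the two defining identities with X yields the triangle identities of the
  adjunction at every object.\<close>

lemma right_dualD:
  assumes "right_dual C U D b d" and [simp]: "X \<in> Ob C"
  shows "(Id C U \<otimes>\<^sub>a \<epsilon> X) \<bullet> \<eta> (U \<otimes>\<^sub>o X) = Id C (U \<otimes>\<^sub>o X)"
    and "\<epsilon> (D \<otimes>\<^sub>o X) \<bullet> (Id C D \<otimes>\<^sub>a \<eta> X) = Id C (D \<otimes>\<^sub>o X)"
  using assms unfolding right_dual_iff by (simp_all add: zigzag_left_at zigzag_right_at)

end

context tensor_category
begin

lemma predual_of_right_dual: "right_dual C U D b d \<Longrightarrow> predual C U D b d"
  unfolding right_dual_def by unfold_locales auto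

text \<open>Exchanging \<open>U\<close> and \<open>D\<close> swaps the two zig-zag identities of the
  two definitions. All later work with left duals is done through right duals in this way.\<close>

lemma left_dual_iff_right_dual: "left_dual C U D b d \<longleftrightarrow> right_dual C D U b d"
  unfolding left_dual_def right_dual_def by blast

lemma right_dual_unit: "right_dual C \<one>\<^sub>o \<one>\<^sub>o (inv_arrow C (lunit C \<one>\<^sub>o)) (lunit C \<one>\<^sub>o)"
proof -
  let ?I = "\<one>\<^sub>o" and ?l = "lunit C \<one>\<^sub>o" and ?a = "assoc C \<one>\<^sub>o \<one>\<^sub>o \<one>\<^sub>o"
  have tri: "(?l \<otimes>\<^sub>a Id C ?I) \<bullet> ?a = Id C ?I \<otimes>\<^sub>a ?l"
    using triangle[of ?I ?I] by (simp add: lunit_unit)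
  have "(Id C ?I \<otimes>\<^sub>a ?l) \<bullet> inv_arrow C ?a = ?l \<otimes>\<^sub>a Id C ?I"
    by (simp add: tri[symmetric] comp_assoc)
  then have "(Id C ?I \<otimes>\<^sub>a ?l) \<bullet> inv_arrow C ?a \<bullet> (inv_arrow C ?l \<otimes>\<^sub>a Id C ?I) \<bullet> inv_arrow C ?l
      = (?l \<otimes>\<^sub>a Id C ?I) \<bullet> (inv_arrow C ?l \<otimes>\<^sub>a Id C ?I) \<bullet> inv_arrow C ?l"
    by (rule comp_extend) simp_all
  also have "\<dots> = inv_arrow C ?l"
    by (simp add: comp_assoc[symmetric] interchange)
  finally have 1: "(Id C ?I \<otimes>\<^sub>a ?l) \<bullet> inv_arrow C ?a \<bullet> (inv_arrow C ?l \<otimes>\<^sub>a Id C ?I) \<bullet> inv_arrow C ?l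
      = inv_arrow C ?l" .
  have "(?l \<otimes>\<^sub>a Id C ?I) \<bullet> ?a \<bullet> (Id C ?I \<otimes>\<^sub>a inv_arrow C ?l) \<bullet> inv_arrow C ?l
      = (Id C ?I \<otimes>\<^sub>a ?l) \<bullet> (Id C ?I \<otimes>\<^sub>a inv_arrow C ?l) \<bullet> inv_arrow C ?l"
    using tri by (rule comp_extend) simp_all
  also have "\<dots> = inv_arrow C ?l"
    by (simp add: comp_assoc[symmetric] interchange)
  finally show ?thesis
    unfolding right_dual_def lunit_unit[symmetric] using 1 by simp
qed

end

section \<open>Duals of tensor products\<close>

locale predual_pair = P: predual C U F b d + Q: predual C V E b' d'
  for C :: "('o, 'm, 'x) tensor_cat_scheme" (structure) and U F b d V E b' d'
begin

text \<open>The coevaluation of \<open>V\<close> is inserted between the factors of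
  \<open>b\<close>: \<one> \<rightarrow> U \<otimes> F \<rightarrow> U \<otimes> (V \<otimes> (E
  \<otimes> F)), followed by reassociation. Dually, \<open>tensor_d\<close> evaluates U against F in
  the middle and then V against E. The dual factors appear in reverse order.\<close>

definition tensor_b where
  "tensor_b = assoc C U V (E \<otimes>\<^sub>o F) \<bullet> (Id C U \<otimes>\<^sub>a Q.\<eta> F) \<bullet> b"

definition tensor_d where
  "tensor_d = d' \<bullet> (Id C E \<otimes>\<^sub>a P.\<epsilon> V) \<bullet> inv_arrow C (assoc C E F (U \<otimes>\<^sub>o V))"

sublocale R: predual C "U \<otimes>\<^sub>o V" "E \<otimes>\<^sub>o F" tensor_b tensor_d
  by unfold_locales (simp_all add: tensor_b_def tensor_d_def)

text \<open>Up to associators this is the unit of a composite adjunction: the unit for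
  \<open>U\<close> followed by U \<otimes> - applied to the unit for \<open>V\<close>. The pentagon
  moves the X, tensored on the right of \<open>tensor_b\<close>, inwards, where
  \<open>coev_tensor\<close> absorbs it.\<close>

lemma coev_pair:
  assumes [simp]: "X \<in> Ob C"
  shows "R.\<eta> X = assoc C U V ((E \<otimes>\<^sub>o F) \<otimes>\<^sub>o X) \<bullet> (Id C U \<otimes>\<^sub>a Id C V \<otimes>\<^sub>a assoc C E F X)
    \<bullet> (Id C U \<otimes>\<^sub>a Q.\<eta> (F \<otimes>\<^sub>o X)) \<bullet> P.\<eta> X"
proof (rule P.iso_cancel_left[of "assoc C (U \<otimes>\<^sub>o V) (E \<otimes>\<^sub>o F) X"])
  have "assoc C (U \<otimes>\<^sub>o V) (E \<otimes>\<^sub>o F) X \<bullet> R.\<eta> X = (tensor_b \<otimes>\<^sub>a Id C X) \<bullet> inv_arrow C (lunit C X)"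
    by (simp add: P.coev_at_def)
  also have "\<dots> = (assoc C U V (E \<otimes>\<^sub>o F) \<otimes>\<^sub>a Id C X) \<bullet> ((Id C U \<otimes>\<^sub>a Q.\<eta> F) \<otimes>\<^sub>a Id C X)
      \<bullet> (b \<otimes>\<^sub>a Id C X) \<bullet> inv_arrow C (lunit C X)"
    by (simp add: tensor_b_def P.whisker_right P.comp_assoc)
  also have "(b \<otimes>\<^sub>a Id C X) \<bullet> inv_arrow C (lunit C X) = assoc C U F X \<bullet> P.\<eta> X"
    by (simp add: P.coev_at_def)
  also have "((Id C U \<otimes>\<^sub>a Q.\<eta> F) \<otimes>\<^sub>a Id C X) \<bullet> assoc C U F X \<bullet> P.\<eta> X
      = assoc C U (V \<otimes>\<^sub>o E \<otimes>\<^sub>o F) X \<bullet> (Id C U \<otimes>\<^sub>a Q.\<eta> F \<otimes>\<^sub>a Id C X) \<bullet> P.\<eta> X"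
    using P.assoc_nat[of "Id C U" "Q.\<eta> F" "Id C X"] by (intro P.comp_extend2) simp_all
  also have "(Id C U \<otimes>\<^sub>a Q.\<eta> F \<otimes>\<^sub>a Id C X) \<bullet> P.\<eta> X
      = (Id C U \<otimes>\<^sub>a assoc C V (E \<otimes>\<^sub>o F) X) \<bullet> (Id C U \<otimes>\<^sub>a Id C V \<otimes>\<^sub>a assoc C E F X)
        \<bullet> (Id C U \<otimes>\<^sub>a Q.\<eta> (F \<otimes>\<^sub>o X)) \<bullet> P.\<eta> X"
    by (simp add: Q.coev_tensor[symmetric] P.whisker_left P.comp_assoc)
  also have "(assoc C U V (E \<otimes>\<^sub>o F) \<otimes>\<^sub>a Id C X) \<bullet> assoc C U (V \<otimes>\<^sub>o E \<otimes>\<^sub>o F) X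
        \<bullet> (Id C U \<otimes>\<^sub>a assoc C V (E \<otimes>\<^sub>o F) X) \<bullet> (Id C U \<otimes>\<^sub>a Id C V \<otimes>\<^sub>a assoc C E F X)
        \<bullet> (Id C U \<otimes>\<^sub>a Q.\<eta> (F \<otimes>\<^sub>o X)) \<bullet> P.\<eta> X
      = ((assoc C U V (E \<otimes>\<^sub>o F) \<otimes>\<^sub>a Id C X) \<bullet> assoc C U (V \<otimes>\<^sub>o E \<otimes>\<^sub>o F) X
        \<bullet> (Id C U \<otimes>\<^sub>a assoc C V (E \<otimes>\<^sub>o F) X)) \<bullet> (Id C U \<otimes>\<^sub>a Id C V \<otimes>\<^sub>a assoc C E F X)
        \<bullet> (Id C U \<otimes>\<^sub>a Q.\<eta> (F \<otimes>\<^sub>o X)) \<bullet> P.\<eta> X"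
    by (simp add: P.comp_assoc)
  also have "\<dots> = assoc C (U \<otimes>\<^sub>o V) (E \<otimes>\<^sub>o F) X \<bullet> assoc C U V ((E \<otimes>\<^sub>o F) \<otimes>\<^sub>o X)
      \<bullet> (Id C U \<otimes>\<^sub>a Id C V \<otimes>\<^sub>a assoc C E F X) \<bullet> (Id C U \<otimes>\<^sub>a Q.\<eta> (F \<otimes>\<^sub>o X)) \<bullet> P.\<eta> X"
    by (simp add: P.pentagon P.comp_assoc)
  finally show "assoc C (U \<otimes>\<^sub>o V) (E \<otimes>\<^sub>o F) X \<bullet> R.\<eta> X = assoc C (U \<otimes>\<^sub>o V) (E \<otimes>\<^sub>o F) X
    \<bullet> assoc C U V ((E \<otimes>\<^sub>o F) \<otimes>\<^sub>o X) \<bullet> (Id C U \<otimes>\<^sub>a Id C V \<otimes>\<^sub>a assoc C E F X)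
    \<bullet> (Id C U \<otimes>\<^sub>a Q.\<eta> (F \<otimes>\<^sub>o X)) \<bullet> P.\<eta> X" .
qed simp_all

text \<open>The counit counterpart of \<open>coev_pair\<close>. Keeping the associators on the side
  of the composite counit, instead of solving for it, leaves inverse associators out of the
  statement.\<close>

lemma ev_pair:
  assumes [simp]: "X \<in> Ob C"
  shows "R.\<epsilon> X \<bullet> assoc C E F ((U \<otimes>\<^sub>o V) \<otimes>\<^sub>o X) \<bullet> (Id C E \<otimes>\<^sub>a Id C F \<otimes>\<^sub>a assoc C U V X)
    = Q.\<epsilon> X \<bullet> (Id C E \<otimes>\<^sub>a P.\<epsilon> (V \<otimes>\<^sub>o X))"
proof -
  let ?Y = "U \<otimes>\<^sub>o V"
  have "R.\<epsilon> X \<bullet> assoc C E F (?Y \<otimes>\<^sub>o X) \<bullet> (Id C E \<otimes>\<^sub>a Id C F \<otimes>\<^sub>a assoc C U V X)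
      = lunit C X \<bullet> (tensor_d \<otimes>\<^sub>a Id C X) \<bullet> (assoc C (E \<otimes>\<^sub>o F) ?Y X \<bullet> assoc C E F (?Y \<otimes>\<^sub>o X))
        \<bullet> (Id C E \<otimes>\<^sub>a Id C F \<otimes>\<^sub>a assoc C U V X)"
    by (simp add: P.ev_at_def P.comp_assoc)
  also have "assoc C (E \<otimes>\<^sub>o F) ?Y X \<bullet> assoc C E F (?Y \<otimes>\<^sub>o X)
      = (assoc C E F ?Y \<otimes>\<^sub>a Id C X) \<bullet> assoc C E (F \<otimes>\<^sub>o ?Y) X \<bullet> (Id C E \<otimes>\<^sub>a assoc C F ?Y X)"
    by (simp add: P.pentagon)
  also have "(tensor_d \<otimes>\<^sub>a Id C X) \<bullet> \<dots> \<bullet> (Id C E \<otimes>\<^sub>a Id C F \<otimes>\<^sub>a assoc C U V X)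
      = ((d' \<bullet> (Id C E \<otimes>\<^sub>a P.\<epsilon> V)) \<otimes>\<^sub>a Id C X) \<bullet> ((inv_arrow C (assoc C E F ?Y) \<otimes>\<^sub>a Id C X)
        \<bullet> (assoc C E F ?Y \<otimes>\<^sub>a Id C X)) \<bullet> assoc C E (F \<otimes>\<^sub>o ?Y) X \<bullet> (Id C E \<otimes>\<^sub>a assoc C F ?Y X)
        \<bullet> (Id C E \<otimes>\<^sub>a Id C F \<otimes>\<^sub>a assoc C U V X)"
    by (simp add: tensor_d_def P.whisker_right P.comp_assoc)
  also have "(inv_arrow C (assoc C E F ?Y) \<otimes>\<^sub>a Id C X) \<bullet> (assoc C E F ?Y \<otimes>\<^sub>a Id C X)
      = Id C ((E \<otimes>\<^sub>o F \<otimes>\<^sub>o ?Y) \<otimes>\<^sub>o X)"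
    by (simp add: P.interchange)
  also have "((d' \<bullet> (Id C E \<otimes>\<^sub>a P.\<epsilon> V)) \<otimes>\<^sub>a Id C X) \<bullet> \<dots> \<bullet> assoc C E (F \<otimes>\<^sub>o ?Y) X
        \<bullet> (Id C E \<otimes>\<^sub>a assoc C F ?Y X) \<bullet> (Id C E \<otimes>\<^sub>a Id C F \<otimes>\<^sub>a assoc C U V X)
      = (d' \<otimes>\<^sub>a Id C X) \<bullet> ((Id C E \<otimes>\<^sub>a P.\<epsilon> V) \<otimes>\<^sub>a Id C X) \<bullet> assoc C E (F \<otimes>\<^sub>o ?Y) X
        \<bullet> (Id C E \<otimes>\<^sub>a assoc C F ?Y X) \<bullet> (Id C E \<otimes>\<^sub>a Id C F \<otimes>\<^sub>a assoc C U V X)"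
    by (simp add: P.whisker_right P.comp_assoc)
  also have "((Id C E \<otimes>\<^sub>a P.\<epsilon> V) \<otimes>\<^sub>a Id C X) \<bullet> assoc C E (F \<otimes>\<^sub>o ?Y) X
        \<bullet> (Id C E \<otimes>\<^sub>a assoc C F ?Y X) \<bullet> (Id C E \<otimes>\<^sub>a Id C F \<otimes>\<^sub>a assoc C U V X)
      = assoc C E V X \<bullet> (Id C E \<otimes>\<^sub>a P.\<epsilon> V \<otimes>\<^sub>a Id C X)
        \<bullet> (Id C E \<otimes>\<^sub>a assoc C F ?Y X) \<bullet> (Id C E \<otimes>\<^sub>a Id C F \<otimes>\<^sub>a assoc C U V X)"
    using P.assoc_nat[of "Id C E" "P.\<epsilon> V" "Id C X"] by (intro P.comp_extend2) simp_all
  also have "(Id C E \<otimes>\<^sub>a P.\<epsilon> V \<otimes>\<^sub>a Id C X) \<bullet> (Id C E \<otimes>\<^sub>a assoc C F ?Y X)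
        \<bullet> (Id C E \<otimes>\<^sub>a Id C F \<otimes>\<^sub>a assoc C U V X) = Id C E \<otimes>\<^sub>a P.\<epsilon> (V \<otimes>\<^sub>o X)"
    by (simp add: P.ev_tensor[symmetric] P.whisker_left)
  finally show ?thesis
    by (simp add: P.ev_at_def P.comp_assoc)
qed

context
  assumes P_dual: "right_dual C U F b d" and Q_dual: "right_dual C V E b' d'"
begin

text \<open>The usual proof that adjunctions compose: naturality of the inner unit brings it next to
  its own counit, the triangle identity for \<open>V\<close> removes the pair, and the one for
  \<open>U\<close> removes the rest.\<close>

lemma tensor_zigzag_left:
  assumes [simp]: "X \<in> Ob C"
  shows "(Id C (U \<otimes>\<^sub>o V) \<otimes>\<^sub>a R.\<epsilon> X) \<bullet> R.\<eta> ((U \<otimes>\<^sub>o V) \<otimes>\<^sub>o X) = Id C ((U \<otimes>\<^sub>o V) \<otimes>\<^sub>o X)"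
proof -
  let ?Y = "(U \<otimes>\<^sub>o V) \<otimes>\<^sub>o X"
  \<comment> \<open>The counit for \<open>U\<close> at V \<otimes> X, with the associator of the
    source absorbed, so that the composite counit factors as the counit for \<open>V\<close> after E
    \<otimes> k.\<close>
  define k where "k = P.\<epsilon> (V \<otimes>\<^sub>o X) \<bullet> (Id C F \<otimes>\<^sub>a inv_arrow C (assoc C U V X))"
  have k [simp]: "k \<in> Ar C" "Dom C k = F \<otimes>\<^sub>o ?Y" "Cod C k = V \<otimes>\<^sub>o X"
    by (simp_all add: k_def)
  have eps: "R.\<epsilon> X \<bullet> assoc C E F ?Y = Q.\<epsilon> X \<bullet> (Id C E \<otimes>\<^sub>a k)"
  proof -
    have "Q.\<epsilon> X \<bullet> (Id C E \<otimes>\<^sub>a k) = (Q.\<epsilon> X \<bullet> (Id C E \<otimes>\<^sub>a P.\<epsilon> (V \<otimes>\<^sub>o X)))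
        \<bullet> (Id C E \<otimes>\<^sub>a Id C F \<otimes>\<^sub>a inv_arrow C (assoc C U V X))"
      by (simp add: k_def P.whisker_left P.comp_assoc)
    also have "\<dots> = R.\<epsilon> X \<bullet> assoc C E F ?Y \<bullet> (Id C E \<otimes>\<^sub>a Id C F \<otimes>\<^sub>a assoc C U V X)
        \<bullet> (Id C E \<otimes>\<^sub>a Id C F \<otimes>\<^sub>a inv_arrow C (assoc C U V X))"
      by (simp add: ev_pair[symmetric] P.comp_assoc)
    also have "\<dots> = R.\<epsilon> X \<bullet> assoc C E F ?Y"
      by (simp add: P.interchange)
    finally show ?thesis by simp
  qed
  have "(Id C (U \<otimes>\<^sub>o V) \<otimes>\<^sub>a R.\<epsilon> X) \<bullet> R.\<eta> ?Y = (Id C (U \<otimes>\<^sub>o V) \<otimes>\<^sub>a R.\<epsilon> X)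
      \<bullet> assoc C U V ((E \<otimes>\<^sub>o F) \<otimes>\<^sub>o ?Y) \<bullet> (Id C U \<otimes>\<^sub>a Id C V \<otimes>\<^sub>a assoc C E F ?Y)
      \<bullet> (Id C U \<otimes>\<^sub>a Q.\<eta> (F \<otimes>\<^sub>o ?Y)) \<bullet> P.\<eta> ?Y"
    by (simp add: coev_pair)
  also have "\<dots> = assoc C U V X \<bullet> (Id C U \<otimes>\<^sub>a Id C V \<otimes>\<^sub>a R.\<epsilon> X)
      \<bullet> (Id C U \<otimes>\<^sub>a Id C V \<otimes>\<^sub>a assoc C E F ?Y) \<bullet> (Id C U \<otimes>\<^sub>a Q.\<eta> (F \<otimes>\<^sub>o ?Y)) \<bullet> P.\<eta> ?Y"
    using P.assoc_nat[of "Id C U" "Id C V" "R.\<epsilon> X"] by (intro P.comp_extend2) simp_all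
  also have "(Id C U \<otimes>\<^sub>a Id C V \<otimes>\<^sub>a R.\<epsilon> X) \<bullet> (Id C U \<otimes>\<^sub>a Id C V \<otimes>\<^sub>a assoc C E F ?Y)
        \<bullet> (Id C U \<otimes>\<^sub>a Q.\<eta> (F \<otimes>\<^sub>o ?Y)) \<bullet> P.\<eta> ?Y
      = (Id C U \<otimes>\<^sub>a ((Id C V \<otimes>\<^sub>a (R.\<epsilon> X \<bullet> assoc C E F ?Y)) \<bullet> Q.\<eta> (F \<otimes>\<^sub>o ?Y))) \<bullet> P.\<eta> ?Y"
    by (simp add: P.whisker_left P.comp_assoc)
  also have "(Id C V \<otimes>\<^sub>a (R.\<epsilon> X \<bullet> assoc C E F ?Y)) \<bullet> Q.\<eta> (F \<otimes>\<^sub>o ?Y)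
      = (Id C V \<otimes>\<^sub>a Q.\<epsilon> X) \<bullet> (Id C V \<otimes>\<^sub>a Id C E \<otimes>\<^sub>a k) \<bullet> Q.\<eta> (F \<otimes>\<^sub>o ?Y)"
    by (simp add: eps P.whisker_left P.comp_assoc)
  \<comment> \<open>Naturality at \<open>k\<close> moves the unit for \<open>V\<close> past
    \<open>k\<close>, directly in front of the counit for \<open>V\<close>.\<close>
  also have "(Id C V \<otimes>\<^sub>a Id C E \<otimes>\<^sub>a k) \<bullet> Q.\<eta> (F \<otimes>\<^sub>o ?Y) = Q.\<eta> (V \<otimes>\<^sub>o X) \<bullet> k"
    using Q.coev_nat[of k] by simp
  also have "(Id C V \<otimes>\<^sub>a Q.\<epsilon> X) \<bullet> Q.\<eta> (V \<otimes>\<^sub>o X) \<bullet> k = Id C (V \<otimes>\<^sub>o X) \<bullet> k"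
    by (rule P.comp_extend) (simp_all add: Q.right_dualD[OF Q_dual])
  also have "(Id C U \<otimes>\<^sub>a \<dots>) \<bullet> P.\<eta> ?Y
      = (Id C U \<otimes>\<^sub>a P.\<epsilon> (V \<otimes>\<^sub>o X)) \<bullet> (Id C U \<otimes>\<^sub>a Id C F \<otimes>\<^sub>a inv_arrow C (assoc C U V X)) \<bullet> P.\<eta> ?Y"
    by (simp add: k_def P.whisker_left P.comp_assoc)
  also have "(Id C U \<otimes>\<^sub>a Id C F \<otimes>\<^sub>a inv_arrow C (assoc C U V X)) \<bullet> P.\<eta> ?Y
      = P.\<eta> (U \<otimes>\<^sub>o V \<otimes>\<^sub>o X) \<bullet> inv_arrow C (assoc C U V X)"
    using P.coev_nat[of "inv_arrow C (assoc C U V X)"] by simp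
  also have "(Id C U \<otimes>\<^sub>a P.\<epsilon> (V \<otimes>\<^sub>o X)) \<bullet> P.\<eta> (U \<otimes>\<^sub>o V \<otimes>\<^sub>o X) \<bullet> inv_arrow C (assoc C U V X)
      = Id C (U \<otimes>\<^sub>o V \<otimes>\<^sub>o X) \<bullet> inv_arrow C (assoc C U V X)"
    by (rule P.comp_extend) (simp_all add: P.right_dualD[OF P_dual])
  finally show ?thesis
    by simp
qed

text \<open>Mirror image of \<open>tensor_zigzag_left\<close>: here the counit for \<open>U\<close>
  is moved past the unit for \<open>V\<close>, which is contained in \<open>h\<close>. The equation
  is checked after precomposition with an associator, so that \<open>ev_pair\<close>
  applies.\<close>

lemma tensor_zigzag_right:
  assumes [simp]: "X \<in> Ob C"
  shows "R.\<epsilon> ((E \<otimes>\<^sub>o F) \<otimes>\<^sub>o X) \<bullet> (Id C (E \<otimes>\<^sub>o F) \<otimes>\<^sub>a R.\<eta> X) = Id C ((E \<otimes>\<^sub>o F) \<otimes>\<^sub>o X)"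
proof (rule P.iso_cancel_right[of "assoc C E F X"])
  let ?W = "(E \<otimes>\<^sub>o F) \<otimes>\<^sub>o X"
  define h where "h = (Id C V \<otimes>\<^sub>a assoc C E F X) \<bullet> Q.\<eta> (F \<otimes>\<^sub>o X)"
  have h [simp]: "h \<in> Ar C" "Dom C h = F \<otimes>\<^sub>o X" "Cod C h = V \<otimes>\<^sub>o ?W"
    by (simp_all add: h_def)
  have eta: "R.\<eta> X = assoc C U V ?W \<bullet> (Id C U \<otimes>\<^sub>a h) \<bullet> P.\<eta> X"
    by (simp add: coev_pair h_def P.whisker_left P.comp_assoc)
  have "(R.\<epsilon> ?W \<bullet> (Id C (E \<otimes>\<^sub>o F) \<otimes>\<^sub>a R.\<eta> X)) \<bullet> assoc C E F X
      = R.\<epsilon> ?W \<bullet> (Id C (E \<otimes>\<^sub>o F) \<otimes>\<^sub>a R.\<eta> X) \<bullet> assoc C E F X"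
    by (simp add: P.comp_assoc)
  also have "(Id C (E \<otimes>\<^sub>o F) \<otimes>\<^sub>a R.\<eta> X) \<bullet> assoc C E F X
      = assoc C E F ((U \<otimes>\<^sub>o V) \<otimes>\<^sub>o ?W) \<bullet> (Id C E \<otimes>\<^sub>a Id C F \<otimes>\<^sub>a R.\<eta> X)"
    using P.assoc_nat[of "Id C E" "Id C F" "R.\<eta> X"] by simp
  also have "R.\<epsilon> ?W \<bullet> \<dots> = (R.\<epsilon> ?W \<bullet> assoc C E F ((U \<otimes>\<^sub>o V) \<otimes>\<^sub>o ?W)
      \<bullet> (Id C E \<otimes>\<^sub>a Id C F \<otimes>\<^sub>a assoc C U V ?W)) \<bullet> (Id C E \<otimes>\<^sub>a Id C F \<otimes>\<^sub>a Id C U \<otimes>\<^sub>a h)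
      \<bullet> (Id C E \<otimes>\<^sub>a Id C F \<otimes>\<^sub>a P.\<eta> X)"
    by (simp add: eta P.whisker_left P.comp_assoc)
  also have "\<dots> = Q.\<epsilon> ?W \<bullet> (Id C E \<otimes>\<^sub>a ((P.\<epsilon> (V \<otimes>\<^sub>o ?W) \<bullet> (Id C F \<otimes>\<^sub>a Id C U \<otimes>\<^sub>a h)) \<bullet> (Id C F \<otimes>\<^sub>a P.\<eta> X)))"
    by (simp add: ev_pair P.whisker_left P.comp_assoc)
  also have "P.\<epsilon> (V \<otimes>\<^sub>o ?W) \<bullet> (Id C F \<otimes>\<^sub>a Id C U \<otimes>\<^sub>a h) = h \<bullet> P.\<epsilon> (F \<otimes>\<^sub>o X)"
    using P.ev_nat[of h] by simp
  also have "\<dots> \<bullet> (Id C F \<otimes>\<^sub>a P.\<eta> X) = h \<bullet> P.\<epsilon> (F \<otimes>\<^sub>o X) \<bullet> (Id C F \<otimes>\<^sub>a P.\<eta> X)"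
    by (simp add: P.comp_assoc)
  also have "\<dots> = h"
    by (simp add: P.right_dualD[OF P_dual])
  also have "Q.\<epsilon> ?W \<bullet> (Id C E \<otimes>\<^sub>a h)
      = Q.\<epsilon> ?W \<bullet> (Id C E \<otimes>\<^sub>a Id C V \<otimes>\<^sub>a assoc C E F X) \<bullet> (Id C E \<otimes>\<^sub>a Q.\<eta> (F \<otimes>\<^sub>o X))"
    by (simp add: h_def P.whisker_left)
  also have "\<dots> = assoc C E F X \<bullet> Q.\<epsilon> (E \<otimes>\<^sub>o F \<otimes>\<^sub>o X) \<bullet> (Id C E \<otimes>\<^sub>a Q.\<eta> (F \<otimes>\<^sub>o X))"
    using Q.ev_nat[of "assoc C E F X"] by (intro P.comp_extend2) simp_all
  also have "\<dots> = assoc C E F X"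
    by (simp add: Q.right_dualD[OF Q_dual])
  finally show "(R.\<epsilon> ?W \<bullet> (Id C (E \<otimes>\<^sub>o F) \<otimes>\<^sub>a R.\<eta> X)) \<bullet> assoc C E F X = Id C ?W \<bullet> assoc C E F X"
    by simp
qed simp_all

lemma right_dual_tensor: "right_dual C (U \<otimes>\<^sub>o V) (E \<otimes>\<^sub>o F) tensor_b tensor_d"
  by (intro R.right_dualI tensor_zigzag_left tensor_zigzag_right) simp_all

end

end

section \<open>Transport of a dual along an isomorphism\<close>

context tensor_category
begin

text \<open>Tensor products of objects of \<open>Ob_b\<close> have V* \<otimes> U* as a dual,
  whereas membership in \<open>Ob_b\<close> demands the object (U \<otimes> V)* itself. The duality
  morphisms are given explicitly because the coevaluation must later be seen to be monic.\<close>

lemma right_dual_transport: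
  assumes dual: "right_dual C U D b d" and i: "iso_arrow C i" and Di: "Dom C i = D"
  shows "right_dual C U (Cod C i) ((Id C U \<otimes>\<^sub>a i) \<bullet> b) (d \<bullet> (inv_arrow C i \<otimes>\<^sub>a Id C U))"
proof -
  interpret P: predual C U D b d
    using dual by (rule predual_of_right_dual)
  let ?D = "Cod C i"
  have [simp]: "i \<in> Ar C" "iso_arrow C i" "Dom C i = D" using i Di iso_Ar by auto
  interpret R: predual C U ?D "(Id C U \<otimes>\<^sub>a i) \<bullet> b" "d \<bullet> (inv_arrow C i \<otimes>\<^sub>a Id C U)"
    by unfold_locales simp_all
  have eta: "R.\<eta> X = (Id C U \<otimes>\<^sub>a i \<otimes>\<^sub>a Id C X) \<bullet> P.\<eta> X" if [simp]: "X \<in> Ob C" for X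
  proof -
    have "R.\<eta> X = inv_arrow C (assoc C U ?D X) \<bullet> ((Id C U \<otimes>\<^sub>a i) \<otimes>\<^sub>a Id C X) \<bullet> (b \<otimes>\<^sub>a Id C X)
        \<bullet> inv_arrow C (lunit C X)"
      by (simp add: coev_at_def whisker_right comp_assoc)
    also have "\<dots> = (Id C U \<otimes>\<^sub>a i \<otimes>\<^sub>a Id C X) \<bullet> inv_arrow C (assoc C U D X) \<bullet> (b \<otimes>\<^sub>a Id C X)
        \<bullet> inv_arrow C (lunit C X)"
    proof (rule comp_extend2)
      show "inv_arrow C (assoc C U ?D X) \<bullet> ((Id C U \<otimes>\<^sub>a i) \<otimes>\<^sub>a Id C X)
          = (Id C U \<otimes>\<^sub>a i \<otimes>\<^sub>a Id C X) \<bullet> inv_arrow C (assoc C U D X)"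
        using assoc_nat[of "Id C U" i "Id C X"] by (intro inv_square) simp_all
    qed simp_all
    finally show ?thesis
      by (simp add: coev_at_def)
  qed
  have eps: "R.\<epsilon> X = P.\<epsilon> X \<bullet> (inv_arrow C i \<otimes>\<^sub>a Id C (U \<otimes>\<^sub>o X))" if [simp]: "X \<in> Ob C" for X
  proof -
    have "R.\<epsilon> X = lunit C X \<bullet> (d \<otimes>\<^sub>a Id C X) \<bullet> ((inv_arrow C i \<otimes>\<^sub>a Id C U) \<otimes>\<^sub>a Id C X) \<bullet> assoc C ?D U X"
      by (simp add: ev_at_def whisker_right comp_assoc)
    also have "((inv_arrow C i \<otimes>\<^sub>a Id C U) \<otimes>\<^sub>a Id C X) \<bullet> assoc C ?D U X
        = assoc C D U X \<bullet> (inv_arrow C i \<otimes>\<^sub>a Id C (U \<otimes>\<^sub>o X))"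
      using assoc_nat[of "inv_arrow C i" "Id C U" "Id C X"] by simp
    finally show ?thesis
      by (simp add: ev_at_def comp_assoc)
  qed
  show ?thesis
  proof (rule R.right_dualI)
    have "(Id C U \<otimes>\<^sub>a R.\<epsilon> \<one>\<^sub>o) \<bullet> R.\<eta> (U \<otimes>\<^sub>o \<one>\<^sub>o) = (Id C U \<otimes>\<^sub>a P.\<epsilon> \<one>\<^sub>o)
        \<bullet> ((Id C U \<otimes>\<^sub>a inv_arrow C i \<otimes>\<^sub>a Id C (U \<otimes>\<^sub>o \<one>\<^sub>o)) \<bullet> (Id C U \<otimes>\<^sub>a i \<otimes>\<^sub>a Id C (U \<otimes>\<^sub>o \<one>\<^sub>o)))
        \<bullet> P.\<eta> (U \<otimes>\<^sub>o \<one>\<^sub>o)"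
      by (simp add: eta eps whisker_left comp_assoc)
    also have "\<dots> = (Id C U \<otimes>\<^sub>a P.\<epsilon> \<one>\<^sub>o) \<bullet> P.\<eta> (U \<otimes>\<^sub>o \<one>\<^sub>o)"
      by (simp add: interchange)
    finally show "(Id C U \<otimes>\<^sub>a R.\<epsilon> \<one>\<^sub>o) \<bullet> R.\<eta> (U \<otimes>\<^sub>o \<one>\<^sub>o) = Id C (U \<otimes>\<^sub>o \<one>\<^sub>o)"
      by (simp add: P.right_dualD[OF dual])
    let ?Di = "?D \<otimes>\<^sub>o \<one>\<^sub>o"
    have "R.\<epsilon> ?Di \<bullet> (Id C ?D \<otimes>\<^sub>a R.\<eta> \<one>\<^sub>o)
        = P.\<epsilon> ?Di \<bullet> (inv_arrow C i \<otimes>\<^sub>a ((Id C U \<otimes>\<^sub>a i \<otimes>\<^sub>a Id C \<one>\<^sub>o) \<bullet> P.\<eta> \<one>\<^sub>o))"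
      by (simp add: eta eps comp_assoc interchange)
    also have "inv_arrow C i \<otimes>\<^sub>a ((Id C U \<otimes>\<^sub>a i \<otimes>\<^sub>a Id C \<one>\<^sub>o) \<bullet> P.\<eta> \<one>\<^sub>o)
        = (Id C D \<otimes>\<^sub>a Id C U \<otimes>\<^sub>a i \<otimes>\<^sub>a Id C \<one>\<^sub>o) \<bullet> (Id C D \<otimes>\<^sub>a P.\<eta> \<one>\<^sub>o) \<bullet> (inv_arrow C i \<otimes>\<^sub>a Id C \<one>\<^sub>o)"
      by (simp add: interchange)
    \<comment> \<open>Naturality of the counit carries \<open>i\<close> to the far left; once the
      triangle identity has removed unit and counit, \<open>i\<close> meets its inverse.\<close>
    also have "P.\<epsilon> ?Di \<bullet> \<dots> = (i \<otimes>\<^sub>a Id C \<one>\<^sub>o) \<bullet> P.\<epsilon> (D \<otimes>\<^sub>o \<one>\<^sub>o) \<bullet> (Id C D \<otimes>\<^sub>a P.\<eta> \<one>\<^sub>o) \<bullet> (inv_arrow C i \<otimes>\<^sub>a Id C \<one>\<^sub>o)"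
      using P.ev_nat[of "i \<otimes>\<^sub>a Id C \<one>\<^sub>o"] by (intro comp_extend2) simp_all
    also have "P.\<epsilon> (D \<otimes>\<^sub>o \<one>\<^sub>o) \<bullet> (Id C D \<otimes>\<^sub>a P.\<eta> \<one>\<^sub>o) \<bullet> (inv_arrow C i \<otimes>\<^sub>a Id C \<one>\<^sub>o)
        = Id C (D \<otimes>\<^sub>o \<one>\<^sub>o) \<bullet> (inv_arrow C i \<otimes>\<^sub>a Id C \<one>\<^sub>o)"
      by (rule comp_extend) (simp_all add: P.right_dualD[OF dual])
    finally show "R.\<epsilon> ?Di \<bullet> (Id C ?D \<otimes>\<^sub>a R.\<eta> \<one>\<^sub>o) = Id C ?Di"
      by (simp add: interchange)
  qed
qed

end

section \<open>Adjoint endofunctors\<close>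

context category
begin

lemma zero_arrowI:
  "\<lbrakk>zero_object C Z; p \<in> Ar C; q \<in> Ar C; Cod C p = Z; Dom C q = Z\<rbrakk> \<Longrightarrow> zero_arrow C (q \<bullet> p)"
  unfolding zero_arrow_def by (intro exI[of _ Z] exI[of _ p] exI[of _ q]) simp

lemma zero_arrowE:
  assumes "zero_arrow C f"
  obtains Z p q where "zero_object C Z" "p \<in> Ar C" "q \<in> Ar C" "Cod C p = Z" "Dom C q = Z" "f = q \<bullet> p"
  using assms unfolding zero_arrow_def by auto

lemma zero_arrow_comp_left:
  assumes "zero_arrow C f" "g \<in> Ar C" "Dom C g = Cod C f"
  shows "zero_arrow C (g \<bullet> f)"
  using assms(1)
proof (rule zero_arrowE)
  fix Z p q
  assume *: "zero_object C Z" "p \<in> Ar C" "q \<in> Ar C" "Cod C p = Z" "Dom C q = Z" "f = q \<bullet> p"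
  then have "zero_arrow C ((g \<bullet> q) \<bullet> p)"
    using assms(2,3) by (intro zero_arrowI) auto
  then show ?thesis
    using * assms(2,3) by (simp add: comp_assoc)
qed

lemma zero_arrow_comp_right:
  assumes "zero_arrow C f" "g \<in> Ar C" "Cod C g = Dom C f"
  shows "zero_arrow C (f \<bullet> g)"
  using assms(1)
proof (rule zero_arrowE)
  fix Z p q
  assume *: "zero_object C Z" "p \<in> Ar C" "q \<in> Ar C" "Cod C p = Z" "Dom C q = Z" "f = q \<bullet> p"
  then have "zero_arrow C (q \<bullet> p \<bullet> g)"
    using assms(2,3) by (intro zero_arrowI) auto
  then show ?thesis
    using * assms(2,3) by (simp add: comp_assoc)
qed

lemma kernel_monic:
  assumes "is_kernel C k f"
  shows "monic C k"
  unfolding monic_def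
proof (intro conjI allI ballI impI)
  show "k \<in> Ar C" using assms by (simp add: is_kernel_def)
  fix Y g g' assume g: "g \<in> Hom C Y (Dom C k)" "g' \<in> Hom C Y (Dom C k)" "k \<bullet> g = k \<bullet> g'"
  have k: "f \<in> Ar C" "k \<in> Ar C" "Cod C k = Dom C f" and zero: "zero_arrow C (f \<bullet> k)"
    and univ: "\<And>X h. h \<in> Hom C X (Dom C f) \<Longrightarrow> zero_arrow C (f \<bullet> h) \<Longrightarrow> \<exists>!v. v \<in> Hom C X (Dom C k) \<and> k \<bullet> v = h"
    using assms unfolding is_kernel_def by auto
  have "zero_arrow C (f \<bullet> k \<bullet> g)"
    using zero_arrow_comp_right[OF zero, of g] g k by (simp add: comp_assoc)
  moreover have "k \<bullet> g \<in> Hom C Y (Dom C f)"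
    using g k by simp
  ultimately show "g = g'"
    using univ[of "k \<bullet> g" Y] g by metis
qed

lemma cokernel_epic:
  assumes "is_cokernel C k f"
  shows "epic C k"
  unfolding epic_def
proof (intro conjI allI ballI impI)
  show "k \<in> Ar C" using assms by (simp add: is_cokernel_def)
  fix Y g g' assume g: "g \<in> Hom C (Cod C k) Y" "g' \<in> Hom C (Cod C k) Y" "g \<bullet> k = g' \<bullet> k"
  have k: "f \<in> Ar C" "k \<in> Ar C" "Dom C k = Cod C f" and zero: "zero_arrow C (k \<bullet> f)"
    and univ: "\<And>X h. h \<in> Hom C (Cod C f) X \<Longrightarrow> zero_arrow C (h \<bullet> f) \<Longrightarrow> \<exists>!v. v \<in> Hom C (Cod C k) X \<and> v \<bullet> k = h"
    using assms unfolding is_cokernel_def by auto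
  have "(g \<bullet> k) \<bullet> f = g \<bullet> k \<bullet> f"
    using g(1) k by (intro comp_assoc) simp_all
  then have "zero_arrow C ((g \<bullet> k) \<bullet> f)"
    using zero_arrow_comp_left[OF zero, of g] g(1) k by simp
  moreover have "g \<bullet> k \<in> Hom C (Cod C f) Y"
    using g(1) k by simp
  ultimately show "g = g'"
    using univ[of "g \<bullet> k" Y] g by metis
qed

text \<open>Terminality forces T \<rightarrow> Z \<rightarrow> T to be the identity, so arrows out
  of \<open>T\<close> are arrows out of \<open>Z\<close> preceded by \<open>s\<close>. In this way
  preservation of terminal objects by right adjoints becomes preservation of zero objects.\<close>

lemma zero_object_if_terminal:
  assumes Z: "zero_object C Z" and T: "T \<in> Ob C" "\<And>X. X \<in> Ob C \<Longrightarrow> \<exists>!f. f \<in> Hom C X T"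
  shows "zero_object C T"
proof -
  obtain s t where s: "s \<in> Hom C T Z" and t: "t \<in> Hom C Z T"
    using Z T unfolding zero_object_def by meson
  then have ts: "t \<bullet> s = Id C T"
    using T(2)[of T] T(1) by (metis Comp_Hom Id_Hom)
  have "\<exists>!f. f \<in> Hom C T X" if X: "X \<in> Ob C" for X
  proof -
    obtain p where p: "p \<in> Hom C Z X" "\<And>q. q \<in> Hom C Z X \<Longrightarrow> q = p"
      using Z X unfolding zero_object_def by meson
    have "f = p \<bullet> s" if f: "f \<in> Hom C T X" for f
    proof -
      have "f = f \<bullet> t \<bullet> s" using ts f by simp
      also have "\<dots> = (f \<bullet> t) \<bullet> s" using f s t by (simp add: comp_assoc)
      also have "f \<bullet> t = p" using f t by (intro p Comp_Hom)
      finally show ?thesis .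
    qed
    moreover have "p \<bullet> s \<in> Hom C T X" using p s by (intro Comp_Hom)
    ultimately show ?thesis by blast
  qed
  then show ?thesis
    unfolding zero_object_def using T by blast
qed

lemma zero_object_if_initial:
  assumes Z: "zero_object C Z" and T: "T \<in> Ob C" "\<And>X. X \<in> Ob C \<Longrightarrow> \<exists>!f. f \<in> Hom C T X"
  shows "zero_object C T"
proof -
  obtain s t where s: "s \<in> Hom C T Z" and t: "t \<in> Hom C Z T"
    using Z T unfolding zero_object_def by meson
  then have ts: "t \<bullet> s = Id C T"
    using T(2)[of T] T(1) by (metis Comp_Hom Id_Hom)
  have "\<exists>!f. f \<in> Hom C X T" if X: "X \<in> Ob C" for X
  proof -
    obtain p where p: "p \<in> Hom C X Z" "\<And>q. q \<in> Hom C X Z \<Longrightarrow> q = p"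
      using Z X unfolding zero_object_def by meson
    have "f = t \<bullet> p" if f: "f \<in> Hom C X T" for f
    proof -
      have "f = (t \<bullet> s) \<bullet> f" using ts f by simp
      also have "\<dots> = t \<bullet> s \<bullet> f" using f s t by (simp add: comp_assoc)
      also have "s \<bullet> f = p" using f s by (intro p Comp_Hom)
      finally show ?thesis .
    qed
    moreover have "t \<bullet> p \<in> Hom C X T" using p t by (intro Comp_Hom)
    ultimately show ?thesis by blast
  qed
  then show ?thesis
    unfolding zero_object_def using T by blast
qed

end

section \<open>Adjunctions presented by unit and counit\<close>

locale endofunctor = category +
  fixes FO FA
  assumes FA_simps [simp]: "f \<in> Ar C \<Longrightarrow> FA f \<in> Ar C" "f \<in> Ar C \<Longrightarrow> Dom C (FA f) = FO (Dom C f)"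
      "f \<in> Ar C \<Longrightarrow> Cod C (FA f) = FO (Cod C f)"
    and FO_Ob [simp]: "X \<in> Ob C \<Longrightarrow> FO X \<in> Ob C"
    and FA_Id [simp]: "X \<in> Ob C \<Longrightarrow> FA (Id C X) = Id C (FO X)"
    and FA_comp: "\<lbrakk>f \<in> Ar C; g \<in> Ar C; Dom C g = Cod C f\<rbrakk> \<Longrightarrow> FA (g \<bullet> f) = FA g \<bullet> FA f"
begin

lemma FA_iso: "iso_arrow C f \<Longrightarrow> iso_arrow C (FA f)"
  using iso_Ar[of f] by (intro iso_arrowI[of _ "FA (inv_arrow C f)"]) (simp_all add: FA_comp[symmetric])

lemma FO_isomorphic: "isomorphic C U V \<Longrightarrow> isomorphic C (FO U) (FO V)"
  unfolding isomorphic_def using FA_iso FA_simps by (metis mem_Hom)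

text \<open>A factorization through a zero object is carried along by any functor that preserves
  zero objects. This takes the place of additivity of the functor.\<close>

lemma FA_zero_arrow:
  assumes FO_zero: "\<And>Z. zero_object C Z \<Longrightarrow> zero_object C (FO Z)" and f: "zero_arrow C f"
  shows "zero_arrow C (FA f)"
  using f
proof (rule zero_arrowE)
  fix Z p q
  assume *: "zero_object C Z" "p \<in> Ar C" "q \<in> Ar C" "Cod C p = Z" "Dom C q = Z" "f = q \<bullet> p"
  then have "zero_arrow C (FA q \<bullet> FA p)"
    using FO_zero[OF *(1)] by (intro zero_arrowI) auto
  then show ?thesis
    using * by (simp add: FA_comp)
qed

end

text \<open>\<open>FO\<close>, \<open>FA\<close> form the left adjoint and \<open>GO\<close>,
  \<open>GA\<close> the right adjoint; \<open>u\<close> is the unit and \<open>c\<close> the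
  counit.\<close>

locale endo_adjunction = F: endofunctor C FO FA + G: endofunctor C GO GA
  for C :: "('o, 'm, 'x) cat_scheme" (structure) and FO FA GO GA +
  fixes u c :: "'o \<Rightarrow> 'm"
  assumes unit_counit_simps [simp]: "X \<in> Ob C \<Longrightarrow> u X \<in> Ar C" "X \<in> Ob C \<Longrightarrow> Dom C (u X) = X"
      "X \<in> Ob C \<Longrightarrow> Cod C (u X) = GO (FO X)" "X \<in> Ob C \<Longrightarrow> c X \<in> Ar C"
      "X \<in> Ob C \<Longrightarrow> Dom C (c X) = FO (GO X)" "X \<in> Ob C \<Longrightarrow> Cod C (c X) = X"
    and unit_nat: "f \<in> Ar C \<Longrightarrow> u (Cod C f) \<bullet> f = GA (FA f) \<bullet> u (Dom C f)"
    and counit_nat: "f \<in> Ar C \<Longrightarrow> c (Cod C f) \<bullet> FA (GA f) = f \<bullet> c (Dom C f)"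
    and triangle_F: "X \<in> Ob C \<Longrightarrow> c (FO X) \<bullet> FA (u X) = Id C (FO X)"
    and triangle_G: "X \<in> Ob C \<Longrightarrow> GA (c X) \<bullet> u (GO X) = Id C (GO X)"
begin

text \<open>One half of the bijection between Hom(X, G Y) and Hom(F X, Y), which sends h to c
  \<bullet> F h and f to G f \<bullet> u; \<open>flat_sharp\<close> is the other half.\<close>

lemma sharp_flat:
  assumes [simp]: "h \<in> Ar C" "Y \<in> Ob C" and Y: "Cod C h = GO Y"
  shows "GA (c Y \<bullet> FA h) \<bullet> u (Dom C h) = h"
proof -
  have "GA (c Y \<bullet> FA h) \<bullet> u (Dom C h) = GA (c Y) \<bullet> GA (FA h) \<bullet> u (Dom C h)"
    using Y by (simp add: G.FA_comp F.comp_assoc)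
  also have "GA (FA h) \<bullet> u (Dom C h) = u (GO Y) \<bullet> h"
    using unit_nat[of h] Y by simp
  also have "GA (c Y) \<bullet> u (GO Y) \<bullet> h = Id C (GO Y) \<bullet> h"
    using Y by (intro F.comp_extend triangle_G) simp_all
  finally show ?thesis
    using Y by simp
qed

lemma flat_sharp:
  assumes [simp]: "f \<in> Ar C" "X \<in> Ob C" and X: "Dom C f = FO X"
  shows "c (Cod C f) \<bullet> FA (GA f \<bullet> u X) = f"
proof -
  have "c (Cod C f) \<bullet> FA (GA f \<bullet> u X) = c (Cod C f) \<bullet> FA (GA f) \<bullet> FA (u X)"
    using X by (simp add: F.FA_comp F.comp_assoc)
  also have "\<dots> = f \<bullet> c (FO X) \<bullet> FA (u X)"
    using counit_nat[of f] X by (intro F.comp_extend2) simp_all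
  finally show ?thesis
    using X by (simp add: triangle_F)
qed

text \<open>Transposition is natural: postcomposing with G f before transposing amounts to
  postcomposing with f afterwards. All preservation results below reduce to this and to
  \<open>sharp_comp\<close>.\<close>

lemma flat_comp:
  assumes "f \<in> Ar C" "h \<in> Ar C" "Cod C h = GO (Dom C f)"
  shows "c (Cod C f) \<bullet> FA (GA f \<bullet> h) = f \<bullet> c (Dom C f) \<bullet> FA h"
proof -
  have "c (Cod C f) \<bullet> FA (GA f) \<bullet> FA h = f \<bullet> c (Dom C f) \<bullet> FA h"
    using assms counit_nat[of f] by (intro F.comp_extend2) simp_all
  then show ?thesis
    using assms by (simp add: F.FA_comp)
qed

lemma sharp_comp:
  assumes "f \<in> Ar C" "h \<in> Ar C" "Dom C h = FO (Cod C f)"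
  shows "GA (h \<bullet> FA f) \<bullet> u (Dom C f) = (GA h \<bullet> u (Cod C f)) \<bullet> f"
proof -
  have "GA h \<bullet> GA (FA f) \<bullet> u (Dom C f) = GA h \<bullet> u (Cod C f) \<bullet> f"
    using assms unit_nat[of f] by simp
  then show ?thesis
    using assms by (simp add: G.FA_comp F.comp_assoc)
qed

lemma GA_monic:
  assumes "monic C f"
  shows "monic C (GA f)"
  unfolding monic_def
proof (intro conjI allI ballI impI)
  have f [simp]: "f \<in> Ar C" using assms by (simp add: monic_def)
  show "GA f \<in> Ar C" by simp
  fix X g h
  assume g: "g \<in> Hom C X (Dom C (GA f))" and h: "h \<in> Hom C X (Dom C (GA f))" and eq: "GA f \<bullet> g = GA f \<bullet> h"
  have "f \<bullet> c (Dom C f) \<bullet> FA g = f \<bullet> c (Dom C f) \<bullet> FA h"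
    using g h flat_comp[of f g] flat_comp[of f h] eq by simp
  moreover have "c (Dom C f) \<bullet> FA g \<in> Hom C (FO X) (Dom C f)" "c (Dom C f) \<bullet> FA h \<in> Hom C (FO X) (Dom C f)"
    using g h by auto
  ultimately have "c (Dom C f) \<bullet> FA g = c (Dom C f) \<bullet> FA h"
    using assms unfolding monic_def by blast
  then show "g = h"
    using sharp_flat[of g "Dom C f"] sharp_flat[of h "Dom C f"] g h by auto
qed

lemma FA_epic:
  assumes "epic C f"
  shows "epic C (FA f)"
  unfolding epic_def
proof (intro conjI allI ballI impI)
  have f [simp]: "f \<in> Ar C" using assms by (simp add: epic_def)
  show "FA f \<in> Ar C" by simp
  fix X g h
  assume g: "g \<in> Hom C (Cod C (FA f)) X" and h: "h \<in> Hom C (Cod C (FA f)) X" and eq: "g \<bullet> FA f = h \<bullet> FA f"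
  have "(GA g \<bullet> u (Cod C f)) \<bullet> f = (GA h \<bullet> u (Cod C f)) \<bullet> f"
    using g h sharp_comp[of f] eq by (metis f F.FA_simps(3) F.mem_Hom)
  moreover have "GA g \<bullet> u (Cod C f) \<in> Hom C (Cod C f) (GO X)" "GA h \<bullet> u (Cod C f) \<in> Hom C (Cod C f) (GO X)"
    using g h by auto
  ultimately have "GA g \<bullet> u (Cod C f) = GA h \<bullet> u (Cod C f)"
    using assms unfolding epic_def by blast
  then show "g = h"
    using flat_sharp[of g "Cod C f"] flat_sharp[of h "Cod C f"] g h by auto
qed

lemma GO_zero_object:
  assumes Z: "zero_object C Z"
  shows "zero_object C (GO Z)"
proof (rule F.zero_object_if_terminal[OF Z])
  have [simp]: "Z \<in> Ob C" using Z by (simp add: zero_object_def)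
  show "GO Z \<in> Ob C" by simp
  fix X assume X [simp]: "X \<in> Ob C"
  obtain p where p: "p \<in> Hom C (FO X) Z" "\<And>q. q \<in> Hom C (FO X) Z \<Longrightarrow> q = p"
    using Z X F.FO_Ob[OF X] unfolding zero_object_def by meson
  have "f = GA p \<bullet> u X" if f: "f \<in> Hom C X (GO Z)" for f
  proof -
    have "c Z \<bullet> FA f = p" using f by (intro p) auto
    then show ?thesis using sharp_flat[of f Z] f by simp
  qed
  moreover have "GA p \<bullet> u X \<in> Hom C X (GO Z)" using p(1) by auto
  ultimately show "\<exists>!f. f \<in> Hom C X (GO Z)" by blast
qed

lemma FO_zero_object:
  assumes Z: "zero_object C Z"
  shows "zero_object C (FO Z)"
proof (rule F.zero_object_if_initial[OF Z])
  have [simp]: "Z \<in> Ob C" using Z by (simp add: zero_object_def)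
  show "FO Z \<in> Ob C" by simp
  fix X assume X [simp]: "X \<in> Ob C"
  obtain p where p: "p \<in> Hom C Z (GO X)" "\<And>q. q \<in> Hom C Z (GO X) \<Longrightarrow> q = p"
    using Z X G.FO_Ob[OF X] unfolding zero_object_def by meson
  have "f = c X \<bullet> FA p" if f: "f \<in> Hom C (FO Z) X" for f
  proof -
    have "GA f \<bullet> u Z = p" using f by (intro p) auto
    then show ?thesis using flat_sharp[of f Z] f by auto
  qed
  moreover have "c X \<bullet> FA p \<in> Hom C (FO Z) X" using p(1) by auto
  ultimately show "\<exists>!f. f \<in> Hom C (FO Z) X" by blast
qed

text \<open>An arrow killed by G f transposes to an arrow killed by f, since F preserves zero
  arrows; this factors through \<open>k\<close>, and the transpose of the factor is the
  factorization sought. Uniqueness comes from right adjoints preserving monomorphisms.\<close>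

lemma GA_kernel:
  assumes k: "is_kernel C k f"
  shows "is_kernel C (GA k) (GA f)"
proof -
  have [simp]: "f \<in> Ar C" "k \<in> Ar C" "Cod C k = Dom C f" and zero: "zero_arrow C (f \<bullet> k)"
    and univ: "\<And>X h. h \<in> Hom C X (Dom C f) \<Longrightarrow> zero_arrow C (f \<bullet> h) \<Longrightarrow> \<exists>!v. v \<in> Hom C X (Dom C k) \<and> k \<bullet> v = h"
    using k unfolding is_kernel_def by auto
  have "zero_arrow C (GA f \<bullet> GA k)"
    using G.FA_zero_arrow[OF GO_zero_object zero] by (simp add: G.FA_comp)
  moreover have "\<exists>!v. v \<in> Hom C X (Dom C (GA k)) \<and> GA k \<bullet> v = h"
    if h: "h \<in> Hom C X (Dom C (GA f))" and "zero_arrow C (GA f \<bullet> h)" for X h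
  proof -
    have X [simp]: "X \<in> Ob C" using h by auto
    have "zero_arrow C (c (Cod C f) \<bullet> FA (GA f \<bullet> h))"
      using F.FA_zero_arrow[OF FO_zero_object that(2)] h by (intro F.zero_arrow_comp_left) auto
    then have "zero_arrow C (f \<bullet> c (Dom C f) \<bullet> FA h)"
      using flat_comp[of f h] h by auto
    then obtain v where v: "v \<in> Hom C (FO X) (Dom C k)" "k \<bullet> v = c (Dom C f) \<bullet> FA h"
      using univ[of "c (Dom C f) \<bullet> FA h" "FO X"] h by auto
    have "GA k \<bullet> GA v \<bullet> u X = GA (k \<bullet> v) \<bullet> u X"
      using v(1) by (simp add: G.FA_comp F.comp_assoc)
    also have "\<dots> = h"
      using v h sharp_flat[of h "Dom C f"] by auto
    finally have "GA k \<bullet> GA v \<bullet> u X = h" .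
    moreover have "GA v \<bullet> u X \<in> Hom C X (Dom C (GA k))"
      using v by auto
    ultimately have ex: "\<exists>v. v \<in> Hom C X (Dom C (GA k)) \<and> GA k \<bullet> v = h"
      by blast
    have "monic C (GA k)"
      using F.kernel_monic[OF k] by (rule GA_monic)
    then show ?thesis
      using ex unfolding monic_def by metis
  qed
  ultimately show ?thesis
    unfolding is_kernel_def by (simp del: F.mem_Hom)
qed

lemma FA_cokernel:
  assumes k: "is_cokernel C k f"
  shows "is_cokernel C (FA k) (FA f)"
proof -
  have [simp]: "f \<in> Ar C" "k \<in> Ar C" "Dom C k = Cod C f" and zero: "zero_arrow C (k \<bullet> f)"
    and univ: "\<And>X h. h \<in> Hom C (Cod C f) X \<Longrightarrow> zero_arrow C (h \<bullet> f) \<Longrightarrow> \<exists>!v. v \<in> Hom C (Cod C k) X \<and> v \<bullet> k = h"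
    using k unfolding is_cokernel_def by auto
  have "zero_arrow C (FA k \<bullet> FA f)"
    using F.FA_zero_arrow[OF FO_zero_object zero] by (simp add: F.FA_comp)
  moreover have "\<exists>!v. v \<in> Hom C (Cod C (FA k)) X \<and> v \<bullet> FA k = h"
    if h: "h \<in> Hom C (Cod C (FA f)) X" and "zero_arrow C (h \<bullet> FA f)" for X h
  proof -
    have X [simp]: "X \<in> Ob C" using h by auto
    have "zero_arrow C (GA (h \<bullet> FA f) \<bullet> u (Dom C f))"
      using G.FA_zero_arrow[OF GO_zero_object that(2)] h by (intro F.zero_arrow_comp_right) auto
    then have "zero_arrow C ((GA h \<bullet> u (Cod C f)) \<bullet> f)"
      using sharp_comp[of f h] h by simp
    then obtain v where v: "v \<in> Hom C (Cod C k) (GO X)" "v \<bullet> k = GA h \<bullet> u (Cod C f)"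
      using univ[of "GA h \<bullet> u (Cod C f)" "GO X"] h by auto
    have "(c X \<bullet> FA v) \<bullet> FA k = c X \<bullet> FA (v \<bullet> k)"
      using v(1) by (simp add: F.FA_comp F.comp_assoc)
    also have "\<dots> = h"
      using v h flat_sharp[of h "Cod C f"] by auto
    finally have "(c X \<bullet> FA v) \<bullet> FA k = h" .
    moreover have "c X \<bullet> FA v \<in> Hom C (Cod C (FA k)) X"
      using v by auto
    ultimately have ex: "\<exists>v. v \<in> Hom C (Cod C (FA k)) X \<and> v \<bullet> FA k = h"
      by blast
    have "epic C (FA k)"
      using F.cokernel_epic[OF k] by (rule FA_epic)
    then show ?thesis
      using ex unfolding epic_def by metis
  qed
  ultimately show ?thesis
    unfolding is_cokernel_def by (simp del: F.mem_Hom)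
qed

end

section \<open>Short exact sequences\<close>

context category
begin

lemma kernelD:
  assumes "is_kernel C k f"
  shows "f \<in> Ar C" "k \<in> Ar C" "Cod C k = Dom C f" "zero_arrow C (f \<bullet> k)"
  using assms unfolding is_kernel_def by auto

lemma cokernelD:
  assumes "is_cokernel C k f"
  shows "f \<in> Ar C" "k \<in> Ar C" "Dom C k = Cod C f" "zero_arrow C (k \<bullet> f)"
  using assms unfolding is_cokernel_def by auto

lemma kernel_factor:
  assumes "is_kernel C k f" "h \<in> Hom C X (Dom C f)" "zero_arrow C (f \<bullet> h)"
  obtains w where "w \<in> Hom C X (Dom C k)" "k \<bullet> w = h"
  using assms unfolding is_kernel_def by blast

lemma cokernel_factor:
  assumes "is_cokernel C k f" "h \<in> Hom C (Cod C f) X" "zero_arrow C (h \<bullet> f)"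
  obtains w where "w \<in> Hom C (Cod C k) X" "w \<bullet> k = h"
  using assms unfolding is_cokernel_def by blast

end

context abelian_category
begin

text \<open>Middle exactness is defined through an image \<open>m\<close>, while adjoints preserve
  kernels and cokernels. Since monomorphisms are kernels and epimorphisms are cokernels,
  \<open>f\<close> represents its own image, and the sequence is exact precisely if each of
  \<open>f\<close> and \<open>g\<close> is determined by the other.\<close>

lemma short_exact_iff:
  "short_exact C U f V g W \<longleftrightarrow> f \<in> Hom C U V \<and> g \<in> Hom C V W \<and> is_kernel C f g \<and> is_cokernel C g f"
proof
  assume R: "f \<in> Hom C U V \<and> g \<in> Hom C V W \<and> is_kernel C f g \<and> is_cokernel C g f"
  then have "is_image C f f"
    unfolding is_image_def by blast
  with R show "short_exact C U f V g W"
    unfolding short_exact_def exact_pair_def using kernel_monic cokernel_epic by blast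
next
  assume "short_exact C U f V g W"
  then obtain m k where f: "f \<in> Ar C" "Dom C f = U" "Cod C f = V" and g: "g \<in> Ar C" "Dom C g = V" "Cod C g = W"
    and "monic C f" "epic C g" and k: "is_cokernel C k f" and mk: "is_kernel C m k" and mg: "is_kernel C m g"
    unfolding short_exact_def exact_pair_def is_image_def by auto
  note k_facts = cokernelD[OF k] note m_facts = kernelD[OF mk] kernelD[OF mg]
  \<comment> \<open>\<open>f\<close> is a kernel of some \<open>h\<close>, and \<open>h\<close>
    factors through the cokernel \<open>k\<close> of \<open>f\<close>. Hence \<open>m\<close>, which
    \<open>k\<close> kills, is killed by \<open>h\<close> and factors through \<open>f\<close>; as
    \<open>f\<close> also factors through \<open>m\<close>, both represent the same
    subobject.\<close>
  obtain h where h: "is_kernel C f h"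
    using monic_normal[OF \<open>monic C f\<close>] by blast
  note h_facts = kernelD[OF h]
  have "h \<in> Hom C (Cod C f) (Cod C h)"
    using h_facts by simp
  then obtain w where w: "w \<in> Hom C (Cod C k) (Cod C h)" "w \<bullet> k = h"
    by (rule cokernel_factor[OF k _ h_facts(4)])
  have "zero_arrow C (w \<bullet> k \<bullet> m)"
    using w(1) k_facts m_facts by - (rule zero_arrow_comp_left, simp_all)
  moreover have "w \<bullet> k \<bullet> m = h \<bullet> m"
    using w(1) k_facts m_facts by (intro comp_extend w) simp_all
  ultimately have "zero_arrow C (h \<bullet> m)"
    by simp
  moreover have "m \<in> Hom C (Dom C m) (Dom C h)"
    using m_facts k_facts h_facts by simp
  ultimately obtain i where i: "i \<in> Hom C (Dom C m) U" "f \<bullet> i = m"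
    using kernel_factor[OF h] f(2) by blast
  have "f \<in> Hom C U (Dom C k)"
    using f k_facts by simp
  then obtain j where j: "j \<in> Hom C U (Dom C m)" "m \<bullet> j = f"
    using kernel_factor[OF mk] k_facts(4) by blast
  have "zero_arrow C ((g \<bullet> m) \<bullet> j)"
    using j(1) m_facts by - (rule zero_arrow_comp_right, simp_all)
  moreover have "(g \<bullet> m) \<bullet> j = g \<bullet> m \<bullet> j"
    using j(1) m_facts by (intro comp_assoc) simp_all
  ultimately have gf: "zero_arrow C (g \<bullet> f)"
    using j(2) by simp
  have ker: "is_kernel C f g"
    unfolding is_kernel_def
  proof (intro conjI allI ballI impI)
    fix X x assume x: "x \<in> Hom C X (Dom C g)" "zero_arrow C (g \<bullet> x)"
    then obtain v where v: "v \<in> Hom C X (Dom C m)" "m \<bullet> v = x"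
      by (rule kernel_factor[OF mg])
    have "f \<bullet> i \<bullet> v = m \<bullet> v"
      using i v(1) f by (intro comp_extend) simp_all
    moreover have "i \<bullet> v \<in> Hom C X (Dom C f)"
      using i(1) v(1) f by simp
    ultimately have "\<exists>y. y \<in> Hom C X (Dom C f) \<and> f \<bullet> y = x"
      using v(2) by metis
    then show "\<exists>!y. y \<in> Hom C X (Dom C f) \<and> f \<bullet> y = x"
      using \<open>monic C f\<close> unfolding monic_def by metis
  qed (use f g gf in auto)
  \<comment> \<open>\<open>g\<close> is a cokernel of some \<open>e\<close>, and \<open>e\<close>
    factors through the kernel \<open>f\<close> of \<open>g\<close>. So every arrow killing
    \<open>f\<close> kills \<open>e\<close> and descends along \<open>g\<close>.\<close>
  obtain e where e: "is_cokernel C g e"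
    using epic_normal[OF \<open>epic C g\<close>] by blast
  note e_facts = cokernelD[OF e]
  have "is_cokernel C g f"
    unfolding is_cokernel_def
  proof (intro conjI allI ballI impI)
    fix X x assume x: "x \<in> Hom C (Cod C f) X" "zero_arrow C (x \<bullet> f)"
    have "e \<in> Hom C (Dom C e) (Dom C g)"
      using e_facts by simp
    then obtain v where v: "v \<in> Hom C (Dom C e) (Dom C f)" "f \<bullet> v = e"
      using e_facts(4) by (rule kernel_factor[OF ker])
    have "zero_arrow C ((x \<bullet> f) \<bullet> v)"
      using x v(1) f by - (rule zero_arrow_comp_right, simp_all)
    moreover have "(x \<bullet> f) \<bullet> v = x \<bullet> f \<bullet> v"
      using x(1) v(1) f by (intro comp_assoc) simp_all
    ultimately have "zero_arrow C (x \<bullet> e)"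
      using v(2) by simp
    moreover have "x \<in> Hom C (Cod C e) X"
      using x(1) f g e_facts by simp
    ultimately have "\<exists>y. y \<in> Hom C (Cod C g) X \<and> y \<bullet> g = x"
      using cokernel_factor[OF e] by metis
    then show "\<exists>!y. y \<in> Hom C (Cod C g) X \<and> y \<bullet> g = x"
      using \<open>epic C g\<close> unfolding epic_def by metis
  qed (use f g gf in auto)
  with ker f g show "f \<in> Hom C U V \<and> g \<in> Hom C V W \<and> is_kernel C f g \<and> is_cokernel C g f"
    by simp
qed

definition exact_endofunctor where
  "exact_endofunctor FO FA \<longleftrightarrow> endofunctor C FO FA \<and>
    (\<forall>U f V g W. short_exact C U f V g W \<longrightarrow> short_exact C (FO U) (FA f) (FO V) (FA g) (FO W))"

text \<open>The middle functor preserves kernels as the right adjoint in the first adjunction and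
  cokernels as the left adjoint in the second; \<open>short_exact_iff\<close> combines the
  two.\<close>

lemma exact_endofunctor_if_adjoints:
  assumes "endo_adjunction C LO LA FO FA u c" and "endo_adjunction C FO FA RO RA u' c'"
  shows "exact_endofunctor FO FA"
proof -
  interpret L: endo_adjunction C LO LA FO FA u c by fact
  interpret R: endo_adjunction C FO FA RO RA u' c' by fact
  have "short_exact C (FO U) (FA f) (FO V) (FA g) (FO W)" if "short_exact C U f V g W" for U f V g W
    using that L.GA_kernel R.FA_cokernel unfolding short_exact_iff by auto
  then show ?thesis
    unfolding exact_endofunctor_def using L.G.endofunctor_axioms by blast
qed

end

section \<open>The reversed tensor product\<close>

lemma (in category) inv_comp:
  assumes "iso_arrow C f" "iso_arrow C g" "Dom C g = Cod C f"
  shows "inv_arrow C (g \<bullet> f) = inv_arrow C f \<bullet> inv_arrow C g"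
proof (rule inv_arrowI)
  have "f \<in> Ar C" "g \<in> Ar C" using assms iso_Ar by auto
  then show "inverse_arrows C (g \<bullet> f) (inv_arrow C f \<bullet> inv_arrow C g)"
    using assms by (simp add: inverse_arrows_def comp_assoc)
qed

lemma (in category) inv_Id [simp]: "U \<in> Ob C \<Longrightarrow> inv_arrow C (Id C U) = Id C U"
  by (rule inv_arrowI) (simp add: inverse_arrows_def)

text \<open>Flipping the factors turns D \<otimes> - into - \<otimes> D, so one-sided results
  transfer to the other side. The associator has to be inverted, because its direction changes under
  the flip.\<close>

definition reversed :: "('o, 'm, 'x) tensor_cat_scheme \<Rightarrow> ('o, 'm, 'x) tensor_cat_scheme" where
  "reversed C = C\<lparr>TOb := \<lambda>U V. TOb C V U, TAr := \<lambda>f g. TAr C g f,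
    assoc := \<lambda>U V W. inv_arrow C (assoc C W V U), lunit := runit C, runit := lunit C\<rparr>"

lemma reversed_simps [simp]:
  "Ob (reversed C) = Ob C" "Ar (reversed C) = Ar C" "Dom (reversed C) = Dom C" "Cod (reversed C) = Cod C"
  "Id (reversed C) = Id C" "Comp (reversed C) = Comp C" "TUnit (reversed C) = TUnit C"
  "TOb (reversed C) U V = TOb C V U" "TAr (reversed C) f g = TAr C g f"
  "assoc (reversed C) U V W = inv_arrow C (assoc C W V U)"
  "lunit (reversed C) = runit C" "runit (reversed C) = lunit C"
  by (simp_all add: reversed_def)

lemma reversed_defs [simp]:
  "Hom (reversed C) = Hom C" "inverse_arrows (reversed C) = inverse_arrows C"
  "iso_arrow (reversed C) = iso_arrow C" "inv_arrow (reversed C) = inv_arrow C"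
proof -
  show Hom: "Hom (reversed C) = Hom C"
    by (intro ext) (simp add: Hom_def)
  show inv: "inverse_arrows (reversed C) = inverse_arrows C"
    by (intro ext) (simp add: inverse_arrows_def Hom)
  show "iso_arrow (reversed C) = iso_arrow C" "inv_arrow (reversed C) = inv_arrow C"
    by (intro ext; simp add: iso_arrow_def inv_arrow_def inv)+
qed

lemma category_reversed [simp]: "category (reversed C) = category C"
  by (simp add: category_def)

text \<open>An adjunction refers only to the underlying category, which reversal leaves alone.
  Adjunctions found in the reversed category are thus adjunctions in the original one.\<close>

lemma endo_adjunction_reversed:
  "endo_adjunction (reversed C) FO FA GO GA u c = endo_adjunction C FO FA GO GA u c"
  by (simp add: endo_adjunction_def endo_adjunction_axioms_def endofunctor_def endofunctor_axioms_def)

context tensor_category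
begin

text \<open>The reversed pentagon is the pentagon for the objects in opposite order with both sides
  inverted; the triangle is the original one with its associator moved across.\<close>

lemma tensor_category_reversed: "tensor_category (reversed C)"
proof unfold_locales
  fix U V assume "U \<in> Ob (reversed C)" "V \<in> Ob (reversed C)"
  then show "TAr (reversed C) (runit (reversed C) U) (Id (reversed C) V)
      \<bullet>\<^bsub>reversed C\<^esub> assoc (reversed C) U (TUnit (reversed C)) V
    = TAr (reversed C) (Id (reversed C) U) (lunit (reversed C) V)"
    using triangle[of V U] by (simp add: triangle[symmetric] comp_assoc)
next
  fix U V W X
  assume Ob: "U \<in> Ob (reversed C)" "V \<in> Ob (reversed C)" "W \<in> Ob (reversed C)" "X \<in> Ob (reversed C)"
  have "inv_arrow C ((assoc C X W V \<otimes>\<^sub>a Id C U) \<bullet> assoc C X (W \<otimes>\<^sub>o V) U \<bullet> (Id C X \<otimes>\<^sub>a assoc C W V U))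
      = inv_arrow C (assoc C (X \<otimes>\<^sub>o W) V U \<bullet> assoc C X W (V \<otimes>\<^sub>o U))"
    using Ob by (simp add: pentagon)
  then show "TAr (reversed C) (assoc (reversed C) U V W) (Id (reversed C) X)
      \<bullet>\<^bsub>reversed C\<^esub> assoc (reversed C) U (TOb (reversed C) V W) X
      \<bullet>\<^bsub>reversed C\<^esub> TAr (reversed C) (Id (reversed C) U) (assoc (reversed C) V W X)
    = assoc (reversed C) (TOb (reversed C) U V) W X \<bullet>\<^bsub>reversed C\<^esub> assoc (reversed C) U V (TOb (reversed C) W X)"
    using Ob by (simp add: inv_comp inv_TAr iso_comp comp_assoc)
next
  fix f U U' g V V' h W W'
  assume "f \<in> Hom (reversed C) U U'" "g \<in> Hom (reversed C) V V'" "h \<in> Hom (reversed C) W W'"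
  then show "assoc (reversed C) U' V' W' \<bullet>\<^bsub>reversed C\<^esub> TAr (reversed C) f (TAr (reversed C) g h)
    = TAr (reversed C) (TAr (reversed C) f g) h \<bullet>\<^bsub>reversed C\<^esub> assoc (reversed C) U V W"
    using assoc_nat[of h g f] by (auto intro!: inv_square)
qed (auto simp: comp_assoc interchange lunit_natural runit_natural)

text \<open>With the factors flipped, \<open>b\<close> maps \<one> to the reversed product of
  \<open>D\<close> and \<open>U\<close>, so object and dual exchange roles while \<open>b\<close>
  and \<open>d\<close> stay the same.\<close>

lemma right_dual_reversed:
  "right_dual C U D b d \<Longrightarrow> right_dual (reversed C) D U b d"
  by (simp add: right_dual_def)

lemma right_dual_adjunction:
  assumes "right_dual C U D b d"
  shows "endo_adjunction C (TOb C D) (\<lambda>f. Id C D \<otimes>\<^sub>a f) (TOb C U) (\<lambda>f. Id C U \<otimes>\<^sub>a f) (coev_at U D b) (ev_at U D d)"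
proof -
  interpret predual C U D b d
    using assms by (rule predual_of_right_dual)
  show ?thesis
    by unfold_locales (simp_all add: whisker_left coev_nat ev_nat right_dualD[OF assms])
qed

lemma right_dual_adjunction_right:
  assumes "right_dual C U D b d"
  obtains u c where "endo_adjunction C (\<lambda>X. X \<otimes>\<^sub>o U) (\<lambda>f. f \<otimes>\<^sub>a Id C U) (\<lambda>X. X \<otimes>\<^sub>o D) (\<lambda>f. f \<otimes>\<^sub>a Id C D) u c"
proof -
  interpret R: tensor_category "reversed C" by (rule tensor_category_reversed)
  have "TOb (reversed C) X = (\<lambda>Y. Y \<otimes>\<^sub>o X)" for X
    by (rule ext) simp
  then show thesis
    using R.right_dual_adjunction[OF right_dual_reversed[OF assms]] that
    by (simp add: endo_adjunction_reversed)
qed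

end

section \<open>Bilinear maps on generated subgroups\<close>

text \<open>Inverses are required of generators only, as in the inductive definition of
  \<open>generate\<close>; this keeps the inverse cases below short.\<close>

lemma (in group) subgroup_generated_induct [consumes 2, case_names one gen inv mult]:
  assumes "x \<in> carrier (subgroup_generated G A)" and A: "A \<subseteq> carrier G"
    and "P \<one>" and "\<And>a. a \<in> A \<Longrightarrow> P a"
    and "\<And>a. a \<in> A \<Longrightarrow> P a \<Longrightarrow> P (inv a)"
    and "\<And>a b. \<lbrakk>a \<in> carrier (subgroup_generated G A); b \<in> carrier (subgroup_generated G A); P a; P b\<rbrakk> \<Longrightarrow> P (a \<otimes> b)"
  shows "P x"
proof -
  have eq: "carrier (subgroup_generated G A) = generate G A"
    using A by (simp add: carrier_subgroup_generated Int_absorb1)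
  from assms(1) have "x \<in> generate G A"
    by (simp add: eq)
  then show ?thesis
    by (induction rule: generate.induct) (use assms(3-6) eq in auto)
qed

lemma (in group) generator_in_subgroup_generated:
  "A \<subseteq> carrier G \<Longrightarrow> a \<in> A \<Longrightarrow> a \<in> carrier (subgroup_generated G A)"
  by (simp add: carrier_subgroup_generated generate.incl subset_iff)

lemma (in group) hom_eq_on_generators:
  assumes A: "A \<subseteq> carrier G" and K: "group K"
    and f: "f \<in> hom (subgroup_generated G A) K" and g: "g \<in> hom (subgroup_generated G A) K"
    and eq: "\<And>a. a \<in> A \<Longrightarrow> f a = g a" and x: "x \<in> carrier (subgroup_generated G A)"
  shows "f x = g x"
proof -
  interpret f: group_hom "subgroup_generated G A" K f
    using K f by (simp add: group_hom_def group_hom_axioms_def)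
  interpret g: group_hom "subgroup_generated G A" K g
    using K g by (simp add: group_hom_def group_hom_axioms_def)
  show ?thesis
    using x A
  proof (induction rule: subgroup_generated_induct)
    case one
    then show ?case using f.hom_one g.hom_one by simp
  next
    case (inv a)
    then show ?case
      using f.hom_inv[of a] g.hom_inv[of a] generator_in_subgroup_generated[OF A] by simp
  next
    case (mult a b)
    then show ?case
      using f.hom_mult[of a b] g.hom_mult[of a b] by simp
  qed (rule eq)
qed

lemma (in group) hom_generated_closed:
  assumes A: "A \<subseteq> carrier G" and K: "subgroup K H" and H: "group H"
    and f: "f \<in> hom (subgroup_generated G A) H"
    and gen: "\<And>a. a \<in> A \<Longrightarrow> f a \<in> K" and x: "x \<in> carrier (subgroup_generated G A)"
  shows "f x \<in> K"
proof -
  interpret f: group_hom "subgroup_generated G A" H f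
    using H f by (simp add: group_hom_def group_hom_axioms_def)
  interpret K: subgroup K H by fact
  show ?thesis
    using x A
  proof (induction rule: subgroup_generated_induct)
    case one
    then show ?case using f.hom_one by simp
  next
    case (inv a)
    then show ?case
      using f.hom_inv[of a] generator_in_subgroup_generated[OF A] by simp
  next
    case (mult a b)
    then show ?case
      using f.hom_mult[of a b] by simp
  qed (rule gen)
qed

text \<open>Abstracts the situation of \<open>K0r\<close> inside \<open>K0\<close>: a generator acts
  on all of \<open>G\<close> from either side, but the action is known only on classes of indices in
  \<open>I\<close>, and a product of two elements is sought only on the subgroup \<open>H\<close>
  they generate.\<close>

locale bilinear_generators = comm_group G for G (structure) +
  fixes I :: "'i set" and cls :: "'i \<Rightarrow> 'a" and t :: "'i \<Rightarrow> 'i \<Rightarrow> 'i"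
  assumes cls_closed: "i \<in> I \<Longrightarrow> cls i \<in> carrier G"
    and t_closed: "\<lbrakk>i \<in> I; j \<in> I\<rbrakk> \<Longrightarrow> t i j \<in> I"
    and left_mult: "i \<in> I \<Longrightarrow> \<exists>\<phi>\<in>hom G G. \<forall>j\<in>I. \<phi> (cls j) = cls (t i j)"
    and right_mult: "j \<in> I \<Longrightarrow> \<exists>\<phi>\<in>hom G G. \<forall>i\<in>I. \<phi> (cls i) = cls (t i j)"
begin

abbreviation "H \<equiv> subgroup_generated G (cls ` I)"

lemma gens: "cls ` I \<subseteq> carrier G"
  using cls_closed by blast

lemma cls_in_H: "i \<in> I \<Longrightarrow> cls i \<in> carrier H"
  using generator_in_subgroup_generated[OF gens] by blast

lemma H_subset: "carrier H \<subseteq> carrier G"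
  using carrier_subgroup_generated_subset by blast

sublocale H: comm_group H
  by (rule abelian_subgroup_generated) (rule comm_group_axioms)

lemma hom_H_restrict:
  assumes "\<phi> \<in> hom G G" "\<And>i. i \<in> I \<Longrightarrow> \<phi> (cls i) \<in> carrier H"
  shows "\<phi> \<in> hom H H"
proof (rule homI)
  have sub: "subgroup (carrier H) G"
    by (rule subgroup_subgroup_generated)
  have hom: "\<phi> \<in> hom H G"
    using assms(1) H_subset by (auto simp: hom_def)
  show "\<phi> x \<in> carrier H" if "x \<in> carrier H" for x
    using hom_generated_closed[OF gens sub group_axioms hom _ that] assms(2) by blast
  show "\<phi> (x \<otimes>\<^bsub>H\<^esub> y) = \<phi> x \<otimes>\<^bsub>H\<^esub> \<phi> y" if "x \<in> carrier H" "y \<in> carrier H" for x y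
    using hom_mult[OF hom that] by simp
qed

text \<open>Right multiplication by a generator. On \<open>H\<close> the choice is immaterial, as a
  homomorphism is fixed there by its values on the classes.\<close>

definition rmul where
  "rmul j = (SOME \<phi>. \<phi> \<in> hom H H \<and> (\<forall>i\<in>I. \<phi> (cls i) = cls (t i j)))"

lemma rmul:
  assumes j: "j \<in> I"
  shows "rmul j \<in> hom H H" and "i \<in> I \<Longrightarrow> rmul j (cls i) = cls (t i j)"
proof -
  obtain \<phi> where "\<phi> \<in> hom G G" "\<forall>i\<in>I. \<phi> (cls i) = cls (t i j)"
    using right_mult[OF j] by blast
  then have "\<phi> \<in> hom H H \<and> (\<forall>i\<in>I. \<phi> (cls i) = cls (t i j))"
    using hom_H_restrict cls_in_H t_closed j by metis
  then have "rmul j \<in> hom H H \<and> (\<forall>i\<in>I. rmul j (cls i) = cls (t i j))"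
    unfolding rmul_def by (rule someI[of "\<lambda>\<phi>. \<phi> \<in> hom H H \<and> (\<forall>i\<in>I. \<phi> (cls i) = cls (t i j))"])
  then show "rmul j \<in> hom H H" and "i \<in> I \<Longrightarrow> rmul j (cls i) = cls (t i j)"
    by blast+
qed

text \<open>This is where well-definedness is won. The assignment of \<open>rmul j x\<close> to
  \<open>cls j\<close> is an expression in \<open>x\<close> itself, but \<open>H\<close> has no
  presentation by which to extend it. The \<open>x\<close> for which an extension exists contain the
  generators, by left multiplication, and are closed under the group operations, because
  homomorphisms into a commutative group can be multiplied and inverted pointwise.\<close>

lemma ex_mult_by:
  assumes "x \<in> carrier H"
  shows "\<exists>\<mu>\<in>hom H H. \<forall>j\<in>I. \<mu> (cls j) = rmul j x"
  using assms gens
proof (induction rule: subgroup_generated_induct)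
  case one
  have "(\<lambda>_. \<one>) \<in> hom H H"
    by (rule homI) (use H.one_closed in auto)
  moreover have "rmul j \<one> = \<one>" if "j \<in> I" for j
    using hom_one[OF rmul(1)[OF that]] by simp
  ultimately show ?case by auto
next
  case (gen a)
  then obtain i where i: "i \<in> I" "a = cls i" by blast
  obtain \<phi> where "\<phi> \<in> hom G G" "\<forall>j\<in>I. \<phi> (cls j) = cls (t i j)"
    using left_mult[OF i(1)] by blast
  then have "\<phi> \<in> hom H H" "\<forall>j\<in>I. \<phi> (cls j) = rmul j a"
    using hom_H_restrict[of \<phi>] cls_in_H t_closed i rmul(2) by auto
  then show ?case by blast
next
  case (inv a)
  then obtain \<mu> where \<mu>: "\<mu> \<in> hom H H" "\<forall>j\<in>I. \<mu> (cls j) = rmul j a" by blast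
  have a: "a \<in> carrier H"
    using inv cls_in_H by blast
  have "(\<lambda>y. inv\<^bsub>H\<^esub> (\<mu> y)) \<in> hom H H"
    using \<mu>(1) by (intro homI) (auto simp del: inv_subgroup_generated mult_subgroup_generated
      simp: hom_in_carrier hom_mult H.inv_mult)
  moreover have "inv\<^bsub>H\<^esub> (\<mu> (cls j)) = rmul j (inv a)" if j: "j \<in> I" for j
  proof -
    interpret r: group_hom H H "rmul j"
      using rmul(1)[OF j] by (simp add: group_hom_def group_hom_axioms_def)
    show ?thesis
      using \<mu>(2) j r.hom_inv[OF a] a by simp
  qed
  ultimately show ?case by (intro bexI[of _ "\<lambda>y. inv\<^bsub>H\<^esub> (\<mu> y)"]) auto
next
  case (mult a b)
  then obtain \<mu> \<nu> where \<mu>: "\<mu> \<in> hom H H" "\<forall>j\<in>I. \<mu> (cls j) = rmul j a"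
    and \<nu>: "\<nu> \<in> hom H H" "\<forall>j\<in>I. \<nu> (cls j) = rmul j b" by blast
  have "(\<lambda>y. \<mu> y \<otimes>\<^bsub>H\<^esub> \<nu> y) \<in> hom H H"
    using \<mu>(1) \<nu>(1) by (rule H.hom_group_mult)
  moreover have "\<mu> (cls j) \<otimes>\<^bsub>H\<^esub> \<nu> (cls j) = rmul j (a \<otimes> b)" if j: "j \<in> I" for j
    using \<mu>(2) \<nu>(2) j hom_mult[OF rmul(1)[OF j] mult(1,2)] by simp
  ultimately show ?case by (intro bexI[of _ "\<lambda>y. \<mu> y \<otimes>\<^bsub>H\<^esub> \<nu> y"]) auto
qed

definition bilinear_product where
  "bilinear_product mul \<longleftrightarrow> biadditive H mul \<and> (\<forall>i\<in>I. \<forall>j\<in>I. mul (cls i) (cls j) = cls (t i j))"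

lemma hom_H_eqI:
  assumes "f \<in> hom H H" "g \<in> hom H H" "\<And>i. i \<in> I \<Longrightarrow> f (cls i) = g (cls i)" "x \<in> carrier H"
  shows "f x = g x"
  using hom_eq_on_generators[OF gens H.is_group assms(1,2) _ assms(4)] assms(3) by blast

text \<open>Each \<open>mul x\<close> is a homomorphism by choice. For additivity in the first
  argument, both sides are homomorphisms in \<open>y\<close>, and on generators \<open>y\<close>
  they agree because \<open>rmul j\<close> is a homomorphism.\<close>

lemma ex_product: "\<exists>mul. bilinear_product mul"
proof -
  define mul where "mul x = (SOME \<mu>. \<mu> \<in> hom H H \<and> (\<forall>j\<in>I. \<mu> (cls j) = rmul j x))" for x
  have "mul x \<in> hom H H \<and> (\<forall>j\<in>I. mul x (cls j) = rmul j x)" if "x \<in> carrier H" for x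
    unfolding mul_def by (rule someI_ex[OF ex_mult_by[OF that, unfolded Bex_def]])
  then have hom: "mul x \<in> hom H H" and gen: "j \<in> I \<Longrightarrow> mul x (cls j) = rmul j x"
    if "x \<in> carrier H" for x j
    using that by blast+
  have "(\<lambda>x. mul x y) \<in> hom H H" if y: "y \<in> carrier H" for y
  proof (rule homI)
    show "mul x y \<in> carrier H" if "x \<in> carrier H" for x
      using hom_in_carrier[OF hom[OF that] y] .
    fix x x' assume x: "x \<in> carrier H" "x' \<in> carrier H"
    then have xx: "x \<otimes>\<^bsub>H\<^esub> x' \<in> carrier H" by (rule H.m_closed)
    have "(\<lambda>y. mul x y \<otimes>\<^bsub>H\<^esub> mul x' y) \<in> hom H H"
      using hom x by (intro H.hom_group_mult)
    then show "mul (x \<otimes>\<^bsub>H\<^esub> x') y = mul x y \<otimes>\<^bsub>H\<^esub> mul x' y"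
    proof (rule hom_H_eqI[OF hom[OF xx] _ _ y])
      fix j assume j: "j \<in> I"
      show "mul (x \<otimes>\<^bsub>H\<^esub> x') (cls j) = mul x (cls j) \<otimes>\<^bsub>H\<^esub> mul x' (cls j)"
        using gen[OF xx j] gen[OF x(1) j] gen[OF x(2) j] hom_mult[OF rmul(1)[OF j] x] by metis
    qed
  qed
  moreover have "mul (cls i) (cls j) = cls (t i j)" if "i \<in> I" "j \<in> I" for i j
    using gen[OF cls_in_H] rmul(2) that by simp
  ultimately show ?thesis
    unfolding bilinear_product_def biadditive_def using hom by blast
qed

context
  fixes mul assumes mul: "bilinear_product mul"
begin

lemma
  shows product_hom_right: "x \<in> carrier H \<Longrightarrow> mul x \<in> hom H H"
    and product_hom_left: "y \<in> carrier H \<Longrightarrow> (\<lambda>x. mul x y) \<in> hom H H"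
    and product_cls: "i \<in> I \<Longrightarrow> j \<in> I \<Longrightarrow> mul (cls i) (cls j) = cls (t i j)"
  using mul unfolding bilinear_product_def biadditive_def by blast+

lemma product_closed: "x \<in> carrier H \<Longrightarrow> y \<in> carrier H \<Longrightarrow> mul x y \<in> carrier H"
  using hom_in_carrier product_hom_right by metis

lemma product_unit:
  assumes e: "e \<in> I" and unit: "\<And>i. i \<in> I \<Longrightarrow> cls (t e i) = cls i" "\<And>i. i \<in> I \<Longrightarrow> cls (t i e) = cls i"
    and x: "x \<in> carrier H"
  shows "mul (cls e) x = x" "mul x (cls e) = x"
proof -
  have id: "(\<lambda>x. x) \<in> hom H H" by (rule homI) auto
  show "mul (cls e) x = x"
    using hom_H_eqI[OF product_hom_right[OF cls_in_H[OF e]] id _ x] e unit product_cls by simp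
  show "mul x (cls e) = x"
    using hom_H_eqI[OF product_hom_left[OF cls_in_H[OF e]] id _ x] e unit product_cls by simp
qed

lemma product_assoc:
  assumes t_assoc: "\<And>i j k. \<lbrakk>i \<in> I; j \<in> I; k \<in> I\<rbrakk> \<Longrightarrow> cls (t (t i j) k) = cls (t i (t j k))"
    and x: "x \<in> carrier H" and y: "y \<in> carrier H" and z: "z \<in> carrier H"
  shows "mul (mul x y) z = mul x (mul y z)"
proof -
  have comp: "(\<lambda>x. g (f x)) \<in> hom H H" if "f \<in> hom H H" "g \<in> hom H H" for f g
    using that by (simp add: hom_def Pi_iff)
  \<comment> \<open>Generators are replaced by arbitrary elements of \<open>H\<close> one argument
    at a time, beginning with the last; at each stage both sides are homomorphisms in the argument
    being freed.\<close>
  have 1: "mul (mul (cls i) (cls j)) z = mul (cls i) (mul (cls j) z)"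
    if "i \<in> I" "j \<in> I" "z \<in> carrier H" for i j z
  proof (rule hom_H_eqI[OF _ _ _ that(3)])
    show "mul (mul (cls i) (cls j)) \<in> hom H H" "(\<lambda>z. mul (cls i) (mul (cls j) z)) \<in> hom H H"
      using comp[OF product_hom_right product_hom_right] product_hom_right[OF product_closed] cls_in_H that
      by blast+
  qed (use that t_closed t_assoc product_cls in simp)
  have 2: "mul (mul (cls i) y) z = mul (cls i) (mul y z)"
    if "i \<in> I" "y \<in> carrier H" "z \<in> carrier H" for i y z
  proof (rule hom_H_eqI[OF _ _ _ that(2)])
    show "(\<lambda>y. mul (mul (cls i) y) z) \<in> hom H H" "(\<lambda>y. mul (cls i) (mul y z)) \<in> hom H H"
      using comp[OF product_hom_right product_hom_left] comp[OF product_hom_left product_hom_right]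
        cls_in_H that by blast+
  qed (use that 1 in simp)
  show ?thesis
  proof (rule hom_H_eqI[OF _ _ _ x])
    show "(\<lambda>x. mul (mul x y) z) \<in> hom H H" "(\<lambda>x. mul x (mul y z)) \<in> hom H H"
      using comp[OF product_hom_left product_hom_left] product_hom_left product_closed y z by blast+
  qed (use y z 2 in simp)
qed

lemma product_unique:
  assumes mul': "bilinear_product mul'" and x: "x \<in> carrier H" and y: "y \<in> carrier H"
  shows "mul' x y = mul x y"
proof (rule hom_H_eqI[OF _ _ _ x])
  show "(\<lambda>x. mul' x y) \<in> hom H H" "(\<lambda>x. mul x y) \<in> hom H H"
    using mul' product_hom_left y unfolding bilinear_product_def biadditive_def by blast+
  fix i assume i: "i \<in> I"
  show "mul' (cls i) y = mul (cls i) y"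
  proof (rule hom_H_eqI[OF _ _ _ y])
    show "mul' (cls i) \<in> hom H H" "mul (cls i) \<in> hom H H"
      using mul' product_hom_right cls_in_H[OF i] unfolding bilinear_product_def biadditive_def by blast+
  qed (use mul' i product_cls bilinear_product_def in simp)
qed

text \<open>Intended for \<open>J\<close> the objects of \<open>Ob_b\<close>. Closure is tested on
  generators in one argument at a time, so the product obtained for \<open>I\<close> itself
  restricts.\<close>

lemma product_restricts:
  assumes J: "J \<subseteq> I" and t_J: "\<And>i j. \<lbrakk>i \<in> J; j \<in> J\<rbrakk> \<Longrightarrow> t i j \<in> J"
    and x: "x \<in> carrier (subgroup_generated G (cls ` J))" and y: "y \<in> carrier (subgroup_generated G (cls ` J))"
  shows "mul x y \<in> carrier (subgroup_generated G (cls ` J))"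
proof -
  let ?K = "subgroup_generated G (cls ` J)"
  have gensJ: "cls ` J \<subseteq> carrier G" using gens J by blast
  have sub: "subgroup (carrier ?K) G"
    by (rule subgroup_subgroup_generated)
  have sub_H: "carrier ?K \<subseteq> carrier H"
    using J subgroup_generated_minimal[OF subgroup_subgroup_generated] cls_in_H by blast
  have to_K: "f \<in> hom ?K G" if "f \<in> hom H H" for f
    using that H_subset sub_H unfolding hom_def Pi_iff by (simp add: subset_iff)
  have gen: "mul (cls i) y \<in> carrier ?K" if "i \<in> J" for i
  proof (rule hom_generated_closed[OF gensJ sub group_axioms to_K[OF product_hom_right] _ y])
    show "cls i \<in> carrier H"
      using that J cls_in_H by blast
    show "mul (cls i) a \<in> carrier ?K" if "a \<in> cls ` J" for a
      using that \<open>i \<in> J\<close> J product_cls t_J generator_in_subgroup_generated[OF gensJ] by (auto simp: subset_iff)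
  qed
  show ?thesis
    using hom_generated_closed[OF gensJ sub group_axioms to_K[OF product_hom_left] _ x] gen y sub_H by blast
qed

end

end

section \<open>The Grothendieck group\<close>

context abelian_category
begin

lemma short_exact_Ob: "short_exact C U f V g W \<Longrightarrow> U \<in> Ob C \<and> V \<in> Ob C \<and> W \<in> Ob C"
  unfolding short_exact_def by auto

lemma iso_class_cong: "U \<in> Ob C \<Longrightarrow> V \<in> Ob C \<Longrightarrow> iso_class C U = iso_class C V \<Longrightarrow> isomorphic C U V"
  using isomorphic_refl unfolding iso_class_def by blast

lemma K0_class_iso: "isomorphic C U V \<Longrightarrow> K0_class C U = K0_class C V"
  unfolding K0_class_def by (simp add: iso_class_eq)

lemma comm_group_K0_free: "comm_group (K0_free C)"
  unfolding K0_free_def by (rule abelian_free_Abelian_group)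

lemma frag_of_iso_class: "U \<in> Ob C \<Longrightarrow> frag_of (iso_class C U) \<in> carrier (K0_free C)"
  by (simp add: K0_free_def)

text \<open>Passes from addition of finitely supported functions, in which the relations are stated,
  to the multiplicative group operations, to which homomorphism laws apply.\<close>

lemma relation_eq:
  assumes "U \<in> Ob C" "V \<in> Ob C" "W \<in> Ob C"
  shows "frag_of (iso_class C U) + frag_of (iso_class C W) - frag_of (iso_class C V)
    = frag_of (iso_class C U) \<otimes>\<^bsub>K0_free C\<^esub> frag_of (iso_class C W)
      \<otimes>\<^bsub>K0_free C\<^esub> inv\<^bsub>K0_free C\<^esub> frag_of (iso_class C V)"
  using assms by (simp add: K0_free_def)

lemma relations_subset:
  "{frag_of (iso_class C U) + frag_of (iso_class C W) - frag_of (iso_class C V) | U V W.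
     \<exists>f g. short_exact C U f V g W} \<subseteq> carrier (K0_free C)"
proof -
  interpret F: comm_group "K0_free C" by (rule comm_group_K0_free)
  show ?thesis
    by (auto dest!: short_exact_Ob simp: relation_eq frag_of_iso_class simp del: mult_free_Abelian_group)
qed

lemma subgroup_K0_relations: "subgroup (K0_relations C) (K0_free C)"
  unfolding K0_relations_def
  using comm_group_K0_free relations_subset
  by (intro group.generate_is_subgroup) (auto simp: comm_group_def)

lemma normal_K0_relations: "K0_relations C \<lhd> K0_free C"
  using comm_group.normal_iff_subgroup[OF comm_group_K0_free] subgroup_K0_relations by blast

lemma comm_group_K0: "comm_group (K0 C)"
  unfolding K0_def using comm_group.abelian_FactGroup comm_group_K0_free subgroup_K0_relations by blast

lemma K0_class_closed: "U \<in> Ob C \<Longrightarrow> K0_class C U \<in> carrier (K0 C)"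
  unfolding K0_def K0_class_def carrier_FactGroup using frag_of_iso_class by blast

lemma K0_class_exact:
  assumes ex: "short_exact C U f V g W"
  shows "K0_class C U \<otimes>\<^bsub>K0 C\<^esub> K0_class C W = K0_class C V"
proof -
  have Ob: "U \<in> Ob C" "V \<in> Ob C" "W \<in> Ob C" using short_exact_Ob[OF ex] by auto
  interpret F: comm_group "K0_free C" by (rule comm_group_K0_free)
  interpret K: comm_group "K0 C" by (rule comm_group_K0)
  let ?c = "\<lambda>X. frag_of (iso_class C X)" and ?p = "\<lambda>a. K0_relations C #>\<^bsub>K0_free C\<^esub> a"
  interpret p: group_hom "K0_free C" "K0 C" ?p
    using normal.r_coset_hom_Mod[OF normal_K0_relations]
    by (simp add: group_hom_def group_hom_axioms_def K0_def[symmetric])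
  let ?r = "?c U \<otimes>\<^bsub>K0_free C\<^esub> ?c W \<otimes>\<^bsub>K0_free C\<^esub> inv\<^bsub>K0_free C\<^esub> ?c V"
  have c: "?c U \<in> carrier (K0_free C)" "?c V \<in> carrier (K0_free C)" "?c W \<in> carrier (K0_free C)"
    using Ob frag_of_iso_class by auto
  have "?r \<in> K0_relations C"
    unfolding K0_relations_def relation_eq[OF Ob, symmetric] using ex by (intro generate.incl) blast
  then have "?p ?r = K0_relations C"
    using c by (intro F.coset_join2 subgroup_K0_relations) auto
  then have "?p ?r = \<one>\<^bsub>K0 C\<^esub>"
    by (simp add: K0_def)
  moreover have "?p ?r = ?p (?c U) \<otimes>\<^bsub>K0 C\<^esub> ?p (?c W) \<otimes>\<^bsub>K0 C\<^esub> inv\<^bsub>K0 C\<^esub> ?p (?c V)"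
    using c by (simp add: p.hom_mult p.hom_inv)
  ultimately have "?p (?c U) \<otimes>\<^bsub>K0 C\<^esub> ?p (?c W) = ?p (?c V)"
    using p.hom_closed[OF c(1)] p.hom_closed[OF c(2)] p.hom_closed[OF c(3)]
    by (metis K.inv_closed K.inv_equality K.inv_inv K.m_closed)
  then show ?thesis
    by (simp add: K0_class_def)
qed

text \<open>An isomorphism-invariant function extends to the free group on isomorphism classes;
  additivity on short exact sequences puts the relations into the kernel of the extension, which
  therefore factors through the quotient.\<close>

lemma K0_universal:
  assumes A: "comm_group A" and \<phi>: "\<And>U. U \<in> Ob C \<Longrightarrow> \<phi> U \<in> carrier A"
    and iso: "\<And>U V. \<lbrakk>U \<in> Ob C; V \<in> Ob C; isomorphic C U V\<rbrakk> \<Longrightarrow> \<phi> U = \<phi> V"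
    and additive: "\<And>U f V g W. short_exact C U f V g W \<Longrightarrow> \<phi> U \<otimes>\<^bsub>A\<^esub> \<phi> W = \<phi> V"
  obtains \<Phi> where "\<Phi> \<in> hom (K0 C) A" "\<And>U. U \<in> Ob C \<Longrightarrow> \<Phi> (K0_class C U) = \<phi> U"
proof -
  interpret A: comm_group A by fact
  interpret F: comm_group "K0_free C" by (rule comm_group_K0_free)
  \<comment> \<open>A representative of each class is chosen; by \<open>iso\<close> the value is the
    same for any other.\<close>
  define T where "T c = \<phi> (SOME U. U \<in> Ob C \<and> iso_class C U = c)" for c
  have T: "T (iso_class C U) = \<phi> U" if U: "U \<in> Ob C" for U
  proof -
    have "\<exists>U'. U' \<in> Ob C \<and> iso_class C U' = iso_class C U"
      using U by blast
    from someI_ex[OF this] show ?thesis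
      unfolding T_def using U iso iso_class_cong by blast
  qed
  have "T ` (iso_class C ` Ob C) \<subseteq> carrier A"
    using T \<phi> by auto
  then obtain h where hom: "h \<in> hom (K0_free C) A" and "\<And>c. c \<in> iso_class C ` Ob C \<Longrightarrow> h (frag_of c) = T c"
    using A.free_Abelian_group_universal unfolding K0_free_def by metis
  then have h: "h (frag_of (iso_class C U)) = \<phi> U" if "U \<in> Ob C" for U
    using T that by simp
  interpret h: group_hom "K0_free C" A h
    using hom by (simp add: group_hom_def group_hom_axioms_def)
  have "K0_relations C \<subseteq> kernel (K0_free C) A h"
    unfolding K0_relations_def
  proof (rule F.generate_subgroup_incl[OF _ h.subgroup_kernel], safe)
    fix U V W f g assume ex: "short_exact C U f V g W"
    then have Ob: "U \<in> Ob C" "V \<in> Ob C" "W \<in> Ob C" using short_exact_Ob by auto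
    let ?r = "frag_of (iso_class C U) + frag_of (iso_class C W) - frag_of (iso_class C V)"
    have "?r \<in> carrier (K0_free C)"
      using relations_subset ex by blast
    moreover have "h ?r = \<one>\<^bsub>A\<^esub>"
      using Ob \<phi> additive[OF ex] unfolding relation_eq[OF Ob]
      by (simp add: frag_of_iso_class h)
    ultimately show "?r \<in> kernel (K0_free C) A h"
      by (simp add: kernel_def)
  qed
  then obtain \<Phi> where "\<Phi> \<in> hom (K0 C) A"
    "\<And>x. x \<in> carrier (K0_free C) \<Longrightarrow> \<Phi> (K0_relations C #>\<^bsub>K0_free C\<^esub> x) = h x"
    using h.FactGroup_universal_kernel[OF normal_K0_relations] unfolding K0_def by metis
  then show thesis
    using that h frag_of_iso_class unfolding K0_class_def by metis
qed

lemma exact_endofunctor_K0: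
  assumes "exact_endofunctor FO FA"
  shows "\<exists>\<Phi>\<in>hom (K0 C) (K0 C). \<forall>U\<in>Ob C. \<Phi> (K0_class C U) = K0_class C (FO U)"
proof -
  interpret endofunctor C FO FA
    using assms by (simp add: exact_endofunctor_def)
  show ?thesis
  proof (rule K0_universal[OF comm_group_K0, of "\<lambda>U. K0_class C (FO U)"])
    show "K0_class C (FO U) \<in> carrier (K0 C)" if "U \<in> Ob C" for U
      using that by (simp add: K0_class_closed)
    show "K0_class C (FO U) = K0_class C (FO V)" if "isomorphic C U V" for U V
      using that FO_isomorphic K0_class_iso by blast
    show "K0_class C (FO U) \<otimes>\<^bsub>K0 C\<^esub> K0_class C (FO W) = K0_class C (FO V)"
      if "short_exact C U f V g W" for U f V g W
      using that assms K0_class_exact unfolding exact_endofunctor_def by blast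
  qed blast
qed

end

section \<open>Tensoring with dualizable objects\<close>

context tensor_category
begin

lemma right_dual_reversed_iff: "right_dual (reversed C) D U b d \<longleftrightarrow> right_dual C U D b d"
  by (auto simp: right_dual_def)

text \<open>In the reversed category \<open>U\<close> is the dual of \<open>D\<close>, so changing
  the object becomes changing the dual there.\<close>

lemma right_dual_transport_left:
  assumes dual: "right_dual C U D b d" and i: "iso_arrow C i" and Ui: "Dom C i = U"
  shows "right_dual C (Cod C i) D ((i \<otimes>\<^sub>a Id C D) \<bullet> b) (d \<bullet> (Id C D \<otimes>\<^sub>a inv_arrow C i))"
proof -
  interpret R: tensor_category "reversed C" by (rule tensor_category_reversed)
  show ?thesis
    using R.right_dual_transport[of D U b d i] assms right_dual_reversed_iff by simp
qed

lemma isomorphic_assoc: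
  "\<lbrakk>U \<in> Ob C; V \<in> Ob C; W \<in> Ob C\<rbrakk> \<Longrightarrow> isomorphic C ((U \<otimes>\<^sub>o V) \<otimes>\<^sub>o W) (U \<otimes>\<^sub>o V \<otimes>\<^sub>o W)"
  unfolding isomorphic_def by (rule bexI[of _ "inv_arrow C (assoc C U V W)"]) simp_all

lemma isomorphic_lunit: "U \<in> Ob C \<Longrightarrow> isomorphic C (\<one>\<^sub>o \<otimes>\<^sub>o U) U"
  unfolding isomorphic_def by (rule bexI[of _ "lunit C U"]) simp_all

lemma isomorphic_runit: "U \<in> Ob C \<Longrightarrow> isomorphic C (U \<otimes>\<^sub>o \<one>\<^sub>o) U"
  unfolding isomorphic_def by (rule bexI[of _ "runit C U"]) simp_all

lemma Ob_r_unit: "\<one>\<^sub>o \<in> Ob_r C"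
  using right_dual_unit unfolding Ob_r_def left_dual_iff_right_dual by auto

lemma right_dual_tensor:
  assumes "right_dual C U F b d" "right_dual C V E b' d'"
  shows "right_dual C (U \<otimes>\<^sub>o V) (E \<otimes>\<^sub>o F) (predual_pair.tensor_b C U F b V E b') (predual_pair.tensor_d C U F d V E d')"
proof -
  interpret predual_pair C U F b d V E b' d'
    using assms predual_of_right_dual by (simp add: predual_pair_def)
  show ?thesis
    using assms by (rule right_dual_tensor)
qed

text \<open>Between isomorphisms, the inserted coevaluation is \<open>b'\<close> tensored with
  \<open>F\<close> on the right and then with \<open>U\<close> on the left. Since \<open>F\<close>
  is a right dual of \<open>U\<close>, both - \<otimes> F and U \<otimes> - are right adjoints, to -
  \<otimes> U and F \<otimes> - respectively.\<close>

lemma monic_tensor_b: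
  assumes "right_dual C U F b d" "right_dual C V E b' d'" and "monic C b" "monic C b'"
  shows "monic C (predual_pair.tensor_b C U F b V E b')"
proof -
  interpret predual_pair C U F b d V E b' d'
    using assms predual_of_right_dual by (simp add: predual_pair_def)
  interpret L: endo_adjunction C "TOb C F" "\<lambda>f. Id C F \<otimes>\<^sub>a f" "TOb C U" "\<lambda>f. Id C U \<otimes>\<^sub>a f" "P.\<eta>" "P.\<epsilon>"
    using assms(1) by (rule right_dual_adjunction)
  obtain u c where "endo_adjunction C (\<lambda>X. X \<otimes>\<^sub>o U) (\<lambda>f. f \<otimes>\<^sub>a Id C U) (\<lambda>X. X \<otimes>\<^sub>o F) (\<lambda>f. f \<otimes>\<^sub>a Id C F) u c"
    using assms(1) by (rule right_dual_adjunction_right)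
  then interpret R: endo_adjunction C "\<lambda>X. X \<otimes>\<^sub>o U" "\<lambda>f. f \<otimes>\<^sub>a Id C U" "\<lambda>X. X \<otimes>\<^sub>o F" "\<lambda>f. f \<otimes>\<^sub>a Id C F" u c .
  have "monic C (Q.\<eta> F)"
    unfolding coev_at_def using R.GA_monic[OF assms(4)]
    by (intro monic_comp[OF monic_comp[OF iso_monic] iso_monic]) simp_all
  then have "monic C (Id C U \<otimes>\<^sub>a Q.\<eta> F)"
    by (rule L.GA_monic)
  then show ?thesis
    unfolding tensor_b_def using assms(3)
    by (intro monic_comp[OF monic_comp iso_monic]) simp_all
qed

lemma Ob_r_tensor: "U \<in> Ob_r C \<Longrightarrow> V \<in> Ob_r C \<Longrightarrow> U \<otimes>\<^sub>o V \<in> Ob_r C"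
  unfolding Ob_r_def left_dual_iff_right_dual
  using right_dual_tensor by (simp, meson)

end

context abelian_tensor_category
begin

text \<open>The right dual \<open>D\<close> makes D \<otimes> - a left adjoint of U \<otimes> -, and
  the left dual \<open>E\<close> makes E \<otimes> - a right adjoint. For tensoring on the right,
  the two duals exchange these roles.\<close>

lemma Ob_r_exact_left:
  assumes "U \<in> Ob_r C"
  shows "exact_endofunctor (TOb C U) (\<lambda>f. Id C U \<otimes>\<^sub>a f)"
proof -
  obtain D b d E b' d' where "right_dual C U D b d" "right_dual C E U b' d'"
    using assms unfolding Ob_r_def left_dual_iff_right_dual by blast
  then show ?thesis
    by (intro exact_endofunctor_if_adjoints[OF right_dual_adjunction right_dual_adjunction])
qed

lemma Ob_r_exact_right:
  assumes "V \<in> Ob_r C"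
  shows "exact_endofunctor (\<lambda>X. X \<otimes>\<^sub>o V) (\<lambda>f. f \<otimes>\<^sub>a Id C V)"
proof -
  obtain D b d E b' d' where "right_dual C V D b d" "right_dual C E V b' d'"
    using assms unfolding Ob_r_def left_dual_iff_right_dual by blast
  then show ?thesis
    using right_dual_adjunction_right exact_endofunctor_if_adjoints by meson
qed

lemma bilinear_generators_K0r: "bilinear_generators (K0 C) (Ob_r C) (K0_class C) (TOb C)"
proof -
  interpret K: comm_group "K0 C" by (rule comm_group_K0)
  have sub: "Ob_r C \<subseteq> Ob C" by (auto simp: Ob_r_def)
  show ?thesis
  proof unfold_locales
    show "K0_class C U \<in> carrier (K0 C)" if "U \<in> Ob_r C" for U
      using that sub K0_class_closed by blast
    show "U \<otimes>\<^sub>o V \<in> Ob_r C" if "U \<in> Ob_r C" "V \<in> Ob_r C" for U V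
      using that by (rule Ob_r_tensor)
    show "\<exists>\<phi>\<in>hom (K0 C) (K0 C). \<forall>V\<in>Ob_r C. \<phi> (K0_class C V) = K0_class C (U \<otimes>\<^sub>o V)" if "U \<in> Ob_r C" for U
      using exact_endofunctor_K0[OF Ob_r_exact_left[OF that]] sub by blast
    show "\<exists>\<phi>\<in>hom (K0 C) (K0 C). \<forall>U\<in>Ob_r C. \<phi> (K0_class C U) = K0_class C (U \<otimes>\<^sub>o V)" if "V \<in> Ob_r C" for V
      using exact_endofunctor_K0[OF Ob_r_exact_right[OF that]] sub by blast
  qed
qed

end

section \<open>Condition C\<close>

text \<open>The Yoneda argument, with the presheaf given by the sets \<open>P X\<close> and the
  action \<open>act\<close> of arrows on them.\<close>

lemma (in category) isomorphic_if_represent_same: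
  assumes A: "A \<in> Ob C" and B: "B \<in> Ob C"
    and \<theta>: "\<And>X. X \<in> Ob C \<Longrightarrow> bij_betw (\<theta> X) (Hom C X A) (P X)"
    and \<theta>': "\<And>X. X \<in> Ob C \<Longrightarrow> bij_betw (\<theta>' X) (Hom C X B) (P X)"
    and nat: "\<And>X Y f h. \<lbrakk>f \<in> Hom C X Y; h \<in> Hom C Y A\<rbrakk> \<Longrightarrow> \<theta> X (h \<bullet> f) = act f (\<theta> Y h)"
    and nat': "\<And>X Y f h. \<lbrakk>f \<in> Hom C X Y; h \<in> Hom C Y B\<rbrakk> \<Longrightarrow> \<theta>' X (h \<bullet> f) = act f (\<theta>' Y h)"
  shows "isomorphic C A B"
proof -
  have idA: "Id C A \<in> Hom C A A" and idB: "Id C B \<in> Hom C B B"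
    using A B Id_Hom by auto
  \<comment> \<open>\<open>i\<close> is the arrow that \<open>\<theta>'\<close> sends to the
    universal element of \<open>A\<close>; \<open>j\<close> arises likewise from that of
    \<open>B\<close>. Both composites correspond to the universal elements and so are
    identities.\<close>
  obtain i where i: "i \<in> Hom C A B" "\<theta>' A i = \<theta> A (Id C A)"
    using \<theta>[OF A] \<theta>'[OF A] idA unfolding bij_betw_def by (metis imageE imageI)
  obtain j where j: "j \<in> Hom C B A" "\<theta> B j = \<theta>' B (Id C B)"
    using \<theta>[OF B] \<theta>'[OF B] idB unfolding bij_betw_def by (metis imageE imageI)
  have "\<theta> A (j \<bullet> i) = act i (\<theta> B j)"
    using nat i(1) j(1) by blast
  also have "\<dots> = \<theta>' A (Id C B \<bullet> i)"
    using nat'[OF i(1) idB] j(2) by simp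
  also have "\<dots> = \<theta> A (Id C A)"
    using i Id_left by simp
  finally have ji: "j \<bullet> i = Id C A"
    using \<theta>[OF A] idA Comp_Hom[OF i(1) j(1)] unfolding bij_betw_def by (meson inj_onD)
  have "\<theta>' B (i \<bullet> j) = act j (\<theta>' A i)"
    using nat' i(1) j(1) by blast
  also have "\<dots> = \<theta> B (Id C A \<bullet> j)"
    using nat[OF j(1) idA] i(2) by simp
  also have "\<dots> = \<theta>' B (Id C B)"
    using j Id_left by simp
  finally have ij: "i \<bullet> j = Id C B"
    using \<theta>'[OF B] idB Comp_Hom[OF j(1) i(1)] unfolding bij_betw_def by (meson inj_onD)
  have "iso_arrow C i"
    using i(1) j(1) ij ji by (intro iso_arrowI[of i j]) auto
  then show ?thesis
    unfolding isomorphic_def using i(1) by blast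
qed

lemma (in category) bij_betw_precompose_iso:
  assumes "iso_arrow C i"
  shows "bij_betw (\<lambda>p. p \<bullet> i) (Hom C (Cod C i) Y) (Hom C (Dom C i) Y)"
proof (rule bij_betw_byWitness[where f' = "\<lambda>q. q \<bullet> inv_arrow C i"])
  have [simp]: "i \<in> Ar C" using assms by (rule iso_Ar)
  show "\<forall>p\<in>Hom C (Cod C i) Y. (p \<bullet> i) \<bullet> inv_arrow C i = p"
    "\<forall>q\<in>Hom C (Dom C i) Y. (q \<bullet> inv_arrow C i) \<bullet> i = q"
    "(\<lambda>p. p \<bullet> i) ` Hom C (Cod C i) Y \<subseteq> Hom C (Dom C i) Y"
    "(\<lambda>q. q \<bullet> inv_arrow C i) ` Hom C (Dom C i) Y \<subseteq> Hom C (Cod C i) Y"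
    using assms by (auto simp: comp_assoc)
qed

lemma (in endo_adjunction) bij_betw_flat:
  assumes "X \<in> Ob C" "Y \<in> Ob C"
  shows "bij_betw (\<lambda>h. c Y \<bullet> FA h) (Hom C X (GO Y)) (Hom C (FO X) Y)"
proof (rule bij_betw_byWitness[where f' = "\<lambda>f. GA f \<bullet> u X"])
  show "\<forall>h\<in>Hom C X (GO Y). GA (c Y \<bullet> FA h) \<bullet> u X = h"
    using sharp_flat assms by fastforce
  show "\<forall>f\<in>Hom C (FO X) Y. c Y \<bullet> FA (GA f \<bullet> u X) = f"
    using flat_sharp assms by fastforce
qed (use assms in auto)

context condition_C
begin

lemma star_tensor:
  assumes dual: "right_dual C U (star_ob S U) b d" and V: "V \<in> Ob C"
  shows "isomorphic C (star_ob S (U \<otimes>\<^sub>o V)) (star_ob S V \<otimes>\<^sub>o star_ob S U)"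
proof -
  let ?s = "star_ob S"
  have [simp]: "U \<in> Ob C" "V \<in> Ob C" "?s U \<in> Ob C" "?s V \<in> Ob C" "?s (U \<otimes>\<^sub>o V) \<in> Ob C"
    using dual V star_ob_closed by (simp_all add: right_dual_def)
  obtain u c where "endo_adjunction C (\<lambda>X. X \<otimes>\<^sub>o U) (\<lambda>f. f \<otimes>\<^sub>a Id C U) (\<lambda>X. X \<otimes>\<^sub>o ?s U) (\<lambda>f. f \<otimes>\<^sub>a Id C (?s U)) u c"
    using dual by (rule right_dual_adjunction_right)
  then interpret A: endo_adjunction C "\<lambda>X. X \<otimes>\<^sub>o U" "\<lambda>f. f \<otimes>\<^sub>a Id C U" "\<lambda>X. X \<otimes>\<^sub>o ?s U" "\<lambda>f. f \<otimes>\<^sub>a Id C (?s U)" u c .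
  have star_hom_nat: "star_hom S X V (h \<bullet> f) = star_hom S Y V h \<bullet> (f \<otimes>\<^sub>a Id C V)"
    if "f \<in> Hom C X Y" "h \<in> Hom C Y (?s V)" "V \<in> Ob C" for X Y V f h
  proof -
    have "star_ar S (Id C V) \<bullet> h \<bullet> f = h \<bullet> f"
      using that star_ob_closed by (simp add: star_ar_Id)
    then show ?thesis
      using star_hom_natural[OF that(1) Id_Hom[OF that(3)] that(2)] by simp
  qed
  have star_hom_Hom: "star_hom S X V h \<in> Hom C (X \<otimes>\<^sub>o V) (?s \<one>\<^sub>o)"
    if "h \<in> Hom C X (?s V)" "X \<in> Ob C" "V \<in> Ob C" for X V h
    using star_hom_bij[OF that(2,3)] that(1) unfolding bij_betw_def by blast
  \<comment> \<open>The composite of the first three bijections: transposition,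
    \<open>star_hom\<close>, and precomposition with the associator.\<close>
  define \<theta> where "\<theta> X h = star_hom S (X \<otimes>\<^sub>o U) V (c (?s V) \<bullet> (h \<otimes>\<^sub>a Id C U)) \<bullet> assoc C X U V" for X h
  show ?thesis
  proof (rule isomorphic_if_represent_same[where \<theta> = "\<lambda>X. star_hom S X (U \<otimes>\<^sub>o V)" and \<theta>' = \<theta>
      and P = "\<lambda>X. Hom C (X \<otimes>\<^sub>o U \<otimes>\<^sub>o V) (?s \<one>\<^sub>o)" and act = "\<lambda>f p. p \<bullet> (f \<otimes>\<^sub>a Id C (U \<otimes>\<^sub>o V))"])
    show "bij_betw (star_hom S X (U \<otimes>\<^sub>o V)) (Hom C X (?s (U \<otimes>\<^sub>o V))) (Hom C (X \<otimes>\<^sub>o U \<otimes>\<^sub>o V) (?s \<one>\<^sub>o))"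
      if "X \<in> Ob C" for X
      using that by (intro star_hom_bij) simp_all
    show "bij_betw (\<theta> X) (Hom C X (?s V \<otimes>\<^sub>o ?s U)) (Hom C (X \<otimes>\<^sub>o U \<otimes>\<^sub>o V) (?s \<one>\<^sub>o))"
      if X: "X \<in> Ob C" for X
    proof -
      have "bij_betw (star_hom S (X \<otimes>\<^sub>o U) V \<circ> (\<lambda>h. c (?s V) \<bullet> (h \<otimes>\<^sub>a Id C U)))
          (Hom C X (?s V \<otimes>\<^sub>o ?s U)) (Hom C ((X \<otimes>\<^sub>o U) \<otimes>\<^sub>o V) (?s \<one>\<^sub>o))"
        using A.bij_betw_flat[of X "?s V"] star_hom_bij[of "X \<otimes>\<^sub>o U" V] X
        by (intro bij_betw_trans) simp_all
      then have "bij_betw ((\<lambda>p. p \<bullet> assoc C X U V) \<circ> (star_hom S (X \<otimes>\<^sub>o U) V \<circ> (\<lambda>h. c (?s V) \<bullet> (h \<otimes>\<^sub>a Id C U))))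
          (Hom C X (?s V \<otimes>\<^sub>o ?s U)) (Hom C (X \<otimes>\<^sub>o U \<otimes>\<^sub>o V) (?s \<one>\<^sub>o))"
        by (rule bij_betw_trans) (use bij_betw_precompose_iso[of "assoc C X U V" "?s \<one>\<^sub>o"] X in simp)
      then show ?thesis
        by (simp add: comp_def \<theta>_def[abs_def])
    qed
    show "star_hom S X (U \<otimes>\<^sub>o V) (h \<bullet> f) = star_hom S Y (U \<otimes>\<^sub>o V) h \<bullet> (f \<otimes>\<^sub>a Id C (U \<otimes>\<^sub>o V))"
      if "f \<in> Hom C X Y" "h \<in> Hom C Y (?s (U \<otimes>\<^sub>o V))" for X Y f h
      using that by (intro star_hom_nat) simp_all
    show "\<theta> X (h \<bullet> f) = \<theta> Y h \<bullet> (f \<otimes>\<^sub>a Id C (U \<otimes>\<^sub>o V))"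
      if f: "f \<in> Hom C X Y" and h: "h \<in> Hom C Y (?s V \<otimes>\<^sub>o ?s U)" for X Y f h
    proof -
      have [simp]: "X \<in> Ob C" "Y \<in> Ob C" "f \<in> Ar C" "h \<in> Ar C" and fh: "Dom C f = X" "Cod C f = Y" "Dom C h = Y"
        "Cod C h = ?s V \<otimes>\<^sub>o ?s U"
        using f h by auto
      let ?k = "c (?s V) \<bullet> (h \<otimes>\<^sub>a Id C U)"
      have k: "?k \<in> Hom C (Y \<otimes>\<^sub>o U) (?s V)"
        using fh by simp
      have p: "star_hom S (Y \<otimes>\<^sub>o U) V ?k \<in> Hom C ((Y \<otimes>\<^sub>o U) \<otimes>\<^sub>o V) (?s \<one>\<^sub>o)"
        using k by (intro star_hom_Hom) simp_all
      have "c (?s V) \<bullet> ((h \<bullet> f) \<otimes>\<^sub>a Id C U) = ?k \<bullet> (f \<otimes>\<^sub>a Id C U)"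
        using fh by (simp add: whisker_right comp_assoc)
      then have "\<theta> X (h \<bullet> f) = star_hom S (X \<otimes>\<^sub>o U) V (?k \<bullet> (f \<otimes>\<^sub>a Id C U)) \<bullet> assoc C X U V"
        by (simp add: \<theta>_def)
      also have "star_hom S (X \<otimes>\<^sub>o U) V (?k \<bullet> (f \<otimes>\<^sub>a Id C U))
          = star_hom S (Y \<otimes>\<^sub>o U) V ?k \<bullet> ((f \<otimes>\<^sub>a Id C U) \<otimes>\<^sub>a Id C V)"
        using fh k by (intro star_hom_nat) simp_all
      also have "\<dots> \<bullet> assoc C X U V
          = star_hom S (Y \<otimes>\<^sub>o U) V ?k \<bullet> ((f \<otimes>\<^sub>a Id C U) \<otimes>\<^sub>a Id C V) \<bullet> assoc C X U V"
        using p fh by (intro comp_assoc) simp_all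
      also have "((f \<otimes>\<^sub>a Id C U) \<otimes>\<^sub>a Id C V) \<bullet> assoc C X U V = assoc C Y U V \<bullet> (f \<otimes>\<^sub>a Id C (U \<otimes>\<^sub>o V))"
        using assoc_nat[of f "Id C U" "Id C V"] fh by simp
      also have "star_hom S (Y \<otimes>\<^sub>o U) V ?k \<bullet> \<dots> = (star_hom S (Y \<otimes>\<^sub>o U) V ?k \<bullet> assoc C Y U V) \<bullet> (f \<otimes>\<^sub>a Id C (U \<otimes>\<^sub>o V))"
        using p fh by (intro comp_assoc[symmetric]) simp_all
      finally show ?thesis
        by (simp add: \<theta>_def)
    qed
  qed simp_all
qed

lemma Ob_b_subset: "Ob_b C S \<subseteq> Ob_r C"
  unfolding Ob_b_def Ob_r_def by blast

lemma Ob_b_tensor: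
  assumes U: "U \<in> Ob_b C S" and V: "V \<in> Ob_b C S"
  shows "U \<otimes>\<^sub>o V \<in> Ob_b C S"
proof -
  let ?s = "star_ob S"
  obtain b1 d1 b1' d1' where U: "U \<in> Ob C" "right_dual C U (?s U) b1 d1" "right_dual C (?s U) U b1' d1'"
    "monic C b1" "monic C b1'"
    using U unfolding Ob_b_def left_dual_iff_right_dual by blast
  obtain b2 d2 b2' d2' where V: "V \<in> Ob C" "right_dual C V (?s V) b2 d2" "right_dual C (?s V) V b2' d2'"
    "monic C b2" "monic C b2'"
    using V unfolding Ob_b_def left_dual_iff_right_dual by blast
  have [simp]: "U \<in> Ob C" "V \<in> Ob C" "?s U \<in> Ob C" "?s V \<in> Ob C" "?s (U \<otimes>\<^sub>o V) \<in> Ob C"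
    using U V star_ob_closed by simp_all
  obtain i where i: "iso_arrow C i" "Dom C i = ?s V \<otimes>\<^sub>o ?s U" "Cod C i = ?s (U \<otimes>\<^sub>o V)"
    using isomorphic_sym[OF star_tensor[OF U(2) V(1)]] unfolding isomorphic_def by auto
  have [simp]: "i \<in> Ar C" using i(1) by (rule iso_Ar)
  obtain b d where b: "right_dual C (U \<otimes>\<^sub>o V) (?s V \<otimes>\<^sub>o ?s U) b d" "monic C b"
    using right_dual_tensor[OF U(2) V(2)] monic_tensor_b[OF U(2) V(2) U(4) V(4)] by blast
  \<comment> \<open>Left duals are read as right duals of V* and U*, tensored in this order;
    reversal of the factors then returns U \<otimes> V as the dual.\<close>
  obtain b' d' where b': "right_dual C (?s V \<otimes>\<^sub>o ?s U) (U \<otimes>\<^sub>o V) b' d'" "monic C b'"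
    using right_dual_tensor[OF V(3) U(3)] monic_tensor_b[OF V(3) U(3) V(5) U(5)] by blast
  have "monic C ((Id C (U \<otimes>\<^sub>o V) \<otimes>\<^sub>a i) \<bullet> b)"
    using b i by (intro monic_comp[OF _ iso_monic]) (simp_all add: right_dual_def)
  moreover have "monic C ((i \<otimes>\<^sub>a Id C (U \<otimes>\<^sub>o V)) \<bullet> b')"
    using b' i by (intro monic_comp[OF _ iso_monic]) (simp_all add: right_dual_def)
  ultimately show ?thesis
    using right_dual_transport[OF b(1) i(1,2)] right_dual_transport_left[OF b'(1) i(1,2)] i(3)
    unfolding Ob_b_def left_dual_iff_right_dual by auto
qed

end

text \<open>That the rule on classes of objects is well defined is rendered as existence of a
  biadditive \<open>mul\<close> together with uniqueness on \<open>carrier (K0r C)\<close>; outside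
  the carrier a total function stays unconstrained. The same \<open>mul\<close> serves every
  structure \<open>S\<close>, so the last clause is a genuine restriction.\<close>

theorem mainTheorem4:
  fixes C :: "('o, 'm, 'x) tensor_cat_scheme"
  assumes "abelian_tensor_category C"
  shows "\<exists>mul. K0r_product C mul \<and>
    (\<forall>mul'. K0r_product C mul' \<longrightarrow>
      (\<forall>x\<in>carrier (K0r C). \<forall>y\<in>carrier (K0r C). mul' x y = mul x y)) \<and>
    (\<forall>x\<in>carrier (K0r C). \<forall>y\<in>carrier (K0r C). \<forall>z\<in>carrier (K0r C).
      mul (mul x y) z = mul x (mul y z)) \<and>
    K0_class C \<one>\<^sub>o\<^bsub>C\<^esub> \<in> carrier (K0r C) \<and>
    (\<forall>x\<in>carrier (K0r C). mul (K0_class C \<one>\<^sub>o\<^bsub>C\<^esub>) x = x \<and> mul x (K0_class C \<one>\<^sub>o\<^bsub>C\<^esub>) = x) \<and>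
    (\<forall>S. condition_C C S \<longrightarrow>
      carrier (K0b C S) \<subseteq> carrier (K0r C) \<and>
      (\<forall>x\<in>carrier (K0b C S). \<forall>y\<in>carrier (K0b C S). mul x y \<in> carrier (K0b C S)))"
proof -
  interpret abelian_tensor_category C by fact
  interpret B: bilinear_generators "K0 C" "Ob_r C" "K0_class C" "TOb C"
    by (rule bilinear_generators_K0r)
  have product_iff: "K0r_product C mul \<longleftrightarrow> B.bilinear_product mul" for mul
    unfolding K0r_product_def B.bilinear_product_def K0r_def ..
  obtain mul where mul: "B.bilinear_product mul"
    using B.ex_product by blast
  have Ob: "U \<in> Ob C" if "U \<in> Ob_r C" for U
    using that by (simp add: Ob_r_def)
  have restrict: "carrier (K0b C S) \<subseteq> carrier (K0r C) \<and>
      (\<forall>x\<in>carrier (K0b C S). \<forall>y\<in>carrier (K0b C S). mul x y \<in> carrier (K0b C S))"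
    if "condition_C C S" for S
  proof -
    interpret condition_C C S by fact
    have "K0_class C ` Ob_b C S \<subseteq> carrier (K0r C)"
      using Ob_b_subset B.cls_in_H unfolding K0r_def by blast
    then have "carrier (K0b C S) \<subseteq> carrier (K0r C)"
      unfolding K0b_def K0r_def using B.subgroup_generated_minimal[OF B.subgroup_subgroup_generated] by blast
    then show ?thesis
      using B.product_restricts[OF mul Ob_b_subset Ob_b_tensor] unfolding K0b_def by blast
  qed
  show ?thesis
  proof (intro exI[of _ mul] conjI allI impI ballI)
    show "K0r_product C mul"
      using mul product_iff by blast
    show "mul' x y = mul x y"
      if "K0r_product C mul'" "x \<in> carrier (K0r C)" "y \<in> carrier (K0r C)" for mul' x y
      using that B.product_unique[OF mul] product_iff unfolding K0r_def by blast
    show "mul (mul x y) z = mul x (mul y z)"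
      if "x \<in> carrier (K0r C)" "y \<in> carrier (K0r C)" "z \<in> carrier (K0r C)" for x y z
      using that B.product_assoc[OF mul _ that[unfolded K0r_def]] K0_class_iso[OF isomorphic_assoc] Ob by blast
    show "K0_class C \<one>\<^sub>o\<^bsub>C\<^esub> \<in> carrier (K0r C)"
      using B.cls_in_H[OF Ob_r_unit] unfolding K0r_def .
    show "mul (K0_class C \<one>\<^sub>o\<^bsub>C\<^esub>) x = x" "mul x (K0_class C \<one>\<^sub>o\<^bsub>C\<^esub>) = x"
      if "x \<in> carrier (K0r C)" for x
      using B.product_unit[OF mul Ob_r_unit _ _ that[unfolded K0r_def]] K0_class_iso isomorphic_lunit isomorphic_runit Ob by blast+
  qed (use restrict in blast)+
qed

end
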